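(* Let $G$ be a very well-covered graph. Then for every positive integer $s$ with $s\leq \mathrm{match}(G)$, we have $$\mathrm{reg}\big(I(G)^{[s]}\big)\leq \mathrm{match}(G)+s.$$
   Context: Let $\mathbb{K}$ be a field and $S=\mathbb{K}[x_1,\ldots,x_n]$ the standard graded polynomial ring. Graphs are finite and simple. For a graph $G$ with vertex set $V(G)=\{x_1,\ldots,x_n\}$ (vertices are identified with variables of $S$), the edge ideal is $I(G)=(x_ix_j : x_ix_j\in E(G))\subseteq S$. A matching is a set of pairwise disjoint edges, and $\mathrm{match}(G)$ is the maximum size of a matching of $G$. For a squarefree monomial ideal $I$, the $s$-th squarefree power $I^{[s]}$ is the ideal generated by the squarefree monomials belonging to $I^s$; thus $I(G)^{[s]}$ is generated by the products $e_1\cdots e_s$ with $\{e_1,\ldots,e_s\}$ a matching of $G$. For a finitely generated graded $S$-module $M$ with graded Betti numbers $\beta_{i,j}(M)$, the Castelnuovo--Mumford regularity is $\mathrm{reg}(M)=\max\{j-i : \beta_{i,j}(M)\neq 0\}$. A vertex cover of $G$ is a set $C\subseteq V(G)$ such that every edge is incident to at least one vertex of $C$; it is minimal if no proper subset of it is a vertex cover. A graph $G$ without isolated vertices is very well-covered if $|V(G)|$ is even and every minimal vertex cover of $G$ has cardinality $|V(G)|/2$. *)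

theory Defs
  imports
    "HOL-Library.Poly_Mapping"
    "HOL-Library.Disjoint_Sets"
    "HOL-Library.Cardinality"
    "Jordan_Normal_Form.Matrix_Kernel"
begin

section \<open>Graphs\<close>

text \<open>A graph is given by its edge set; its vertex set is the whole finite type \<open>'v\<close>.\<close>

definition simple_graph :: "'v::finite set set \<Rightarrow> bool" where
  "simple_graph E \<longleftrightarrow> (\<forall>e\<in>E. card e = 2)"

definition matching :: "'v::finite set set \<Rightarrow> 'v set set \<Rightarrow> bool" where
  "matching E M \<longleftrightarrow> M \<subseteq> E \<and> disjoint M"

definition match :: "'v::finite set set \<Rightarrow> nat" where
  "match E = Max (card ` {M. matching E M})"

definition vertex_cover :: "'v::finite set set \<Rightarrow> 'v set \<Rightarrow> bool" where
  "vertex_cover E C \<longleftrightarrow> (\<forall>e\<in>E. e \<inter> C \<noteq> {})"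

definition minimal_vertex_cover :: "'v::finite set set \<Rightarrow> 'v set \<Rightarrow> bool" where
  "minimal_vertex_cover E C \<longleftrightarrow> vertex_cover E C \<and> (\<forall>C'. C' \<subset> C \<longrightarrow> \<not> vertex_cover E C')"

definition very_well_covered :: "'v::finite set set \<Rightarrow> bool" where
  "very_well_covered E \<longleftrightarrow>
     (\<forall>v. \<exists>e\<in>E. v \<in> e) \<and>
     even (CARD('v)) \<and>
     (\<forall>C. minimal_vertex_cover E C \<longrightarrow> card C = CARD('v) div 2)"


section \<open>The polynomial ring and its ideals\<close>

text \<open>
  The ring \<open>\<bbbK>[x\<^sub>v : v \<in> V(G)]\<close> is the type below: exponent vectors are finitely supported
  functions \<open>'v \<Rightarrow>\<^sub>0 nat\<close>, and polynomials are finitely supported functions from exponent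
  vectors to coefficients, with convolution as product.
\<close>

type_synonym ('v, 'k) mpoly = "('v \<Rightarrow>\<^sub>0 nat) \<Rightarrow>\<^sub>0 'k"

definition var :: "'v \<Rightarrow> ('v, 'k::comm_ring_1) mpoly" where
  "var v = Poly_Mapping.single (Poly_Mapping.single v 1) 1"

definition mdeg :: "('v::finite \<Rightarrow>\<^sub>0 nat) \<Rightarrow> nat" where
  "mdeg u = (\<Sum>v\<in>UNIV. Poly_Mapping.lookup u v)"

text \<open>The ideal generated by a set: its span in the ring, viewed as a module over itself.\<close>

definition ideal_gen :: "'a::comm_ring_1 set \<Rightarrow> 'a set" where
  "ideal_gen B = module.span (*) B"

definition ideal_power :: "'a::comm_ring_1 set \<Rightarrow> nat \<Rightarrow> 'a set" where
  "ideal_power I s = ideal_gen {\<Prod>i<s. f i | f. \<forall>i<s. f i \<in> I}"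

definition squarefree_monomial :: "('v, 'k::comm_ring_1) mpoly \<Rightarrow> bool" where
  "squarefree_monomial m \<longleftrightarrow>
     (\<exists>u. m = Poly_Mapping.single u 1 \<and> (\<forall>v. Poly_Mapping.lookup u v \<le> 1))"

definition squarefree_power :: "('v, 'k::comm_ring_1) mpoly set \<Rightarrow> nat \<Rightarrow> ('v, 'k) mpoly set" where
  "squarefree_power I s = ideal_gen {m \<in> ideal_power I s. squarefree_monomial m}"

definition edge_ideal :: "'v::finite set set \<Rightarrow> ('v, 'k::field) mpoly set" where
  "edge_ideal E = ideal_gen {var v * var w | v w. {v, w} \<in> E}"

definition irrelevant_ideal :: "('v, 'k::field) mpoly set" where
  "irrelevant_ideal = {f. Poly_Mapping.lookup f 0 = 0}"


section \<open>Minimal graded free resolutions and regularity\<close>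

text \<open>
  A list \<open>ds\<close> of integers encodes the graded free module \<open>\<Oplus>\<^sub>l S(- ds ! l)\<close>.
  A homomorphism between two such modules is a matrix acting on column vectors. It is
  homogeneous of degree 0 iff the entry in row \<open>k\<close> and column \<open>l\<close> is zero or homogeneous of
  degree \<open>ds ! l - es ! k\<close>.
\<close>

definition graded_hom ::
  "int list \<Rightarrow> int list \<Rightarrow> ('v::finite, 'k::field) mpoly mat \<Rightarrow> bool" where
  "graded_hom ds es A \<longleftrightarrow>
     A \<in> carrier_mat (length es) (length ds) \<and>
     (\<forall>k < length es. \<forall>l < length ds. \<forall>u \<in> Poly_Mapping.keys (A $$ (k, l)).
        int (mdeg u) = ds ! l - es ! k)"

definition mat_image :: "'a::comm_ring_1 mat \<Rightarrow> 'a vec set" where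
  "mat_image A = {A *\<^sub>v v | v. v \<in> carrier_vec (dim_col A)}"

text \<open>
  The resolution \<open>\<dots> \<rightarrow> F\<^sub>1 \<rightarrow> F\<^sub>0 \<rightarrow> I \<rightarrow> 0\<close> of an ideal \<open>I\<close> of \<open>S\<close>: \<open>D i\<close> lists the twists of \<open>F\<^sub>i\<close>,
  \<open>\<phi> 0\<close> is the augmentation \<open>F\<^sub>0 \<rightarrow> I \<subseteq> S\<close> (a matrix with one row), and \<open>\<phi> (Suc i)\<close> is the
  differential \<open>F\<^bsub>i+1\<^esub> \<rightarrow> F\<^sub>i\<close>. Minimality says that the differentials map into
  \<open>\<mm> F\<^sub>i\<close>, where \<open>\<mm>\<close> is the irrelevant ideal. The columns of
  \<open>\<phi> 0\<close> are then automatically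
  minimal generators of \<open>I\<close>, as \<open>ker (\<phi> 0) \<subseteq> \<mm> F\<^sub>0\<close>.
\<close>

definition minimal_free_resolution ::
  "('v::finite, 'k::field) mpoly set \<Rightarrow> (nat \<Rightarrow> int list) \<Rightarrow> (nat \<Rightarrow> ('v, 'k) mpoly mat) \<Rightarrow> bool" where
  "minimal_free_resolution I D \<phi> \<longleftrightarrow>
     graded_hom (D 0) [0] (\<phi> 0) \<and>
     (\<forall>i. graded_hom (D (Suc i)) (D i) (\<phi> (Suc i))) \<and>
     mat_image (\<phi> 0) = {w \<in> carrier_vec 1. w $ 0 \<in> I} \<and>
     (\<forall>i. mat_image (\<phi> (Suc i)) = mat_kernel (\<phi> i)) \<and>
     (\<forall>i. \<forall>k < length (D i). \<forall>l < length (D (Suc i)).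
        \<phi> (Suc i) $$ (k, l) \<in> irrelevant_ideal)"

text \<open>
  The graded Betti number \<open>\<beta>\<^bsub>i,j\<^esub>(I)\<close> is the multiplicity of \<open>S(-j)\<close> in \<open>F\<^sub>i\<close>. Every homogeneous
  ideal has a minimal graded free resolution, unique up to isomorphism, so the choice made
  here does not matter.
\<close>

definition betti :: "('v::finite, 'k::field) mpoly set \<Rightarrow> nat \<Rightarrow> int \<Rightarrow> nat" where
  "betti I i j = count_list ((SOME D. \<exists>\<phi>. minimal_free_resolution I D \<phi>) i) j"

text \<open>For a nonzero homogeneous ideal the set below is finite and nonempty, so \<open>Max\<close> is meaningful.\<close>

definition reg :: "('v::finite, 'k::field) mpoly set \<Rightarrow> int" where
  "reg I = Max {j - int i | i j. betti I i j \<noteq> 0}"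

end

theory Submission
  imports Defs
begin

text \<open>
  For disjoint sets \<open>A\<close>, \<open>B\<close> of vertices let \<open>J(A,B)\<close> be the colon ideal, by the product of
  the variables in \<open>A\<close>, of the \<open>s\<close>-th squarefree power for the graph induced on \<open>A \<union> B\<close>, and let
  \<open>\<rho>(A,B)\<close> be the largest number of vertices of \<open>A\<close> covered by one matching of that graph.
  Induction on \<open>B\<close> gives a free resolution of \<open>J(A,B)\<close> whose \<open>i\<close>-th module has twists at most
  \<open>i + (|B| - \<rho>(A,B)) / 2 + s\<close> (or \<open>i\<close>, if that is larger). If adding some \<open>y \<in> B\<close> to \<open>A\<close> increases
  \<open>\<rho>\<close>, then \<open>J(A,B) = J(A,B-y) + y J(A+y,B-y)\<close> is resolved by a mapping cone: the first
  summand loses a vertex and at most one from \<open>\<rho>\<close>, the second loses a vertex and gains one in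
  \<open>\<rho>\<close>, which pays for the twist by \<open>y\<close>. If no such \<open>y\<close> exists, Berge's augmentation argument
  shows that \<open>A\<close> already contains a maximum matching of \<open>A \<union> B\<close>, so \<open>J(A,B)\<close> is \<open>0\<close> or the whole
  ring. For \<open>A = \<emptyset>\<close> the bound is \<open>|V| / 2 + s\<close>, and a very well-covered graph has a
  perfect matching. Finally, the twists of a minimal resolution occur in every resolution.
\<close>

section \<open>Matchings\<close>

text \<open>The cone comes from the exact sequence 0 -> J(A,B-y)(-1) -> J(A,B-y) + J(A+y,B-y)(-1) ->
  J(A,B) -> 0 with a direct sum in the middle and first map f -> (yf, -f). It is exact because y
  does not occur in the generators of J(A,B-y). The left-hand copy is twisted by 1 but enters the
  cone one homological step later, so it leaves t - i unchanged. Only J(A+y,B-y)(-1) costs 1, and a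
  choice of y that increases rho lowers |B| - rho by 2 there.

  Regularity is read off a minimal resolution picked by choice. A bound on the twists of some
  resolution is therefore not enough: a minimal resolution must exist, and the set of differences t
  - i must be finite and nonempty. Existence requires finitely generated syzygies. These are not
  derived from Noetherianity but from a homotopy comparison with the resolution that the cones have
  already produced, and the same comparison shows that its twists contain those of the minimal one.

  The perfect matching comes from Hall's theorem, applied to a maximal independent set; Hall's
  condition is verified by an exchange between maximal independent sets, which all have the same
  size.\<close>

lemma card_Union_matching:
  assumes "finite M" "\<forall>e\<in>M. card e = 2" "disjoint M"
  shows "card (\<Union>M) = 2 * card M"
proof -
  have "card (\<Union>M) = sum card M"
    using assms by (intro card_Union_disjoint) (auto intro: card_ge_0_finite)
  also have "\<dots> = (\<Sum>e\<in>M. 2)" using assms by (intro sum.cong) auto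
  finally show ?thesis by simp
qed

lemma disjoint_insertI:
  assumes "disjoint M" "\<And>a. a \<in> M \<Longrightarrow> a \<inter> e = {}"
  shows "disjoint (insert e M)"
  using assms by (auto simp: disjoint_def Int_commute)

text \<open>A weak form of Berge's augmenting path theorem. The induction removes an end \<open>u\<close> of the
  path together with its first two edges.\<close>

lemma matching_augment:
  assumes "finite M" "finite N" "\<forall>e\<in>M \<union> N. card e = 2" "disjoint M" "disjoint N" "card M < card N"
  shows "\<exists>M'. M' \<subseteq> M \<union> N \<and> disjoint M' \<and> \<Union>M \<subset> \<Union>M'"
  using assms
proof (induction "card M" arbitrary: M N rule: less_induct)
  case less
  have cM: "card (\<Union>M) = 2 * card M" and cN: "card (\<Union>N) = 2 * card N"
    using less.prems by (auto intro!: card_Union_matching)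
  have fin: "finite (\<Union>M)"
  proof (rule finite_Union[OF less.prems(1)])
    show "finite a" if "a \<in> M" for a
      using that less.prems(3) by (intro card_ge_0_finite) auto
  qed
  have "\<not> \<Union>N \<subseteq> \<Union>M"
    using card_mono[OF fin, of "\<Union>N"] cM cN less.prems(6) by auto
  then obtain u e where u: "u \<in> e" "e \<in> N" "u \<notin> \<Union>M" by blast
  have "card e = 2" using u less.prems(3) by auto
  then obtain v where e: "e = {u, v}" "u \<noteq> v"
    using u(1) unfolding card_2_iff by auto
  show ?case
  proof (cases "v \<in> \<Union>M")
    case False
    then have "disjoint (insert e M)"
      using less.prems(4) u(3) e unfolding disjoint_def by auto
    moreover have "\<Union>M \<subset> \<Union>(insert e M)" using u by auto
    ultimately show ?thesis using u(2) by (intro exI[of _ "insert e M"]) auto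
  next
    case True
    then obtain f where f: "f \<in> M" "v \<in> f" by auto
    have "card f = 2" using f less.prems(3) by auto
    then obtain w where fw: "f = {v, w}" "v \<noteq> w"
      using f(2) unfolding card_2_iff by auto
    have "card (M - {f}) < card M" "card (M - {f}) < card (N - {e})"
    proof -
      have "card M = Suc (card (M - {f}))" "card N = Suc (card (N - {e}))"
        using f u less.prems(1,2) by (simp_all only: card_Suc_Diff1)
      then show "card (M - {f}) < card M" "card (M - {f}) < card (N - {e})"
        using less.prems(6) by linarith+
    qed
    moreover have "disjoint (M - {f})" "disjoint (N - {e})"
      using less.prems(4,5) unfolding disjoint_def by auto
    moreover have "finite (M - {f})" "finite (N - {e})" "\<forall>a\<in>(M - {f}) \<union> (N - {e}). card a = 2"
      using less.prems(1-3) by auto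
    ultimately obtain M' where M': "M' \<subseteq> (M - {f}) \<union> (N - {e})" "disjoint M'"
        "\<Union>(M - {f}) \<subset> \<Union>M'"
      using less.hyps[of "M - {f}" "N - {e}"] by metis
    \<comment> \<open>All edges of \<open>M\<close> avoid u, and those other than \<open>f\<close>
      avoid v; the edges of \<open>N\<close> other than \<open>e\<close> avoid both ends of
      \<open>e\<close>. So neither u nor v can obstruct putting \<open>e\<close> or \<open>f\<close>
      back.\<close>
    have fresh: "a \<inter> {u, v} = {}" if "a \<in> M'" for a
    proof -
      have "a \<in> M - {f} \<or> a \<in> N - {e}" using that M'(1) by auto
      then show ?thesis
      proof
        assume "a \<in> M - {f}"
        then have "a \<in> M" "a \<inter> f = {}" using disjointD[OF less.prems(4), of a f] f(1) by auto
        then show ?thesis using f(2) u(3) by auto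
      next
        assume "a \<in> N - {e}"
        then show ?thesis using disjointD[OF less.prems(5), of a e] u(2) e by auto
      qed
    qed
    have UM: "\<Union>M = \<Union>(M - {f}) \<union> {v, w}" using f fw by auto
    show ?thesis
    \<comment> \<open>If w is already covered, adding \<open>e\<close> covers v again and gains u.
      Otherwise adding \<open>f\<close> restores v and w, and the gain is a vertex z supplied by the
      induction hypothesis.\<close>
    proof (cases "w \<in> \<Union>M'")
      case True
      have "disjoint (insert e M')" using fresh M'(2) e by (intro disjoint_insertI) auto
      moreover have "\<Union>M \<subset> \<Union>(insert e M')"
      proof
        show "\<Union>M \<subseteq> \<Union>(insert e M')" unfolding UM Union_insert using M'(3) True e by blast
        show "\<Union>M \<noteq> \<Union>(insert e M')" using u by blast
      qed
      moreover have "insert e M' \<subseteq> M \<union> N" using M'(1) u(2) by auto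
      ultimately show ?thesis by (intro exI[of _ "insert e M'"] conjI)
    next
      case False
      have "v \<notin> a" "w \<notin> a" if "a \<in> M'" for a using fresh[OF that] False that by auto
      then have "disjoint (insert f M')" using M'(2) fw by (intro disjoint_insertI) auto
      obtain z where z: "z \<in> \<Union>M'" "z \<notin> \<Union>(M - {f})" using M'(3) by blast
      have "z \<noteq> w" using z(1) False by metis
      moreover have "z \<noteq> v" using z(1) fresh by blast
      ultimately have "z \<notin> \<Union>M" using z(2) unfolding UM by simp
      have "\<Union>M \<subset> \<Union>(insert f M')"
      proof
        show "\<Union>M \<subseteq> \<Union>(insert f M')" unfolding UM Union_insert using M'(3) fw by blast
        show "\<Union>M \<noteq> \<Union>(insert f M')" using z(1) \<open>z \<notin> \<Union>M\<close> by blast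
      qed
      moreover have "insert f M' \<subseteq> M \<union> N" using M'(1) f by auto
      ultimately show ?thesis using \<open>disjoint (insert f M')\<close> by (intro exI[of _ "insert f M'"] conjI)
    qed
  qed
qed

section \<open>Matchings inside a vertex set and the vertices they cover\<close>

definition matchings_in :: "'v::finite set set \<Rightarrow> 'v set \<Rightarrow> 'v set set set" where
  "matchings_in E X = {M. matching E M \<and> \<Union>M \<subseteq> X}"

definition mnum :: "'v::finite set set \<Rightarrow> 'v set \<Rightarrow> nat" where
  "mnum E X = Max (card ` matchings_in E X)"

text \<open>For \<open>X = A \<union> B\<close> this is rho(A,B). It counts vertices of
  \<open>A\<close>, so a matching edge inside \<open>A\<close> counts twice and an edge from
  \<open>A\<close> to \<open>B\<close> once.\<close>

definition coverable :: "'v::finite set set \<Rightarrow> 'v set \<Rightarrow> 'v set \<Rightarrow> nat" where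
  "coverable E X A = Max ((\<lambda>M. card (A \<inter> \<Union>M)) ` matchings_in E X)"

lemma empty_in_matchings_in [simp]: "{} \<in> matchings_in E X"
  by (simp add: matchings_in_def matching_def)

lemma mnum_ge: "M \<in> matchings_in E X \<Longrightarrow> card M \<le> mnum E X"
  unfolding mnum_def by (intro Max_ge) auto

lemma mnum_attained: obtains M where "M \<in> matchings_in E X" "card M = mnum E X"
proof -
  have "mnum E X \<in> card ` matchings_in E X"
    unfolding mnum_def using empty_in_matchings_in[of E X] by (intro Max_in) (auto simp del: empty_in_matchings_in)
  then show thesis using that by auto
qed

lemma coverable_ge: "M \<in> matchings_in E X \<Longrightarrow> card (A \<inter> \<Union>M) \<le> coverable E X A"
  unfolding coverable_def by (intro Max_ge) auto

lemma coverable_attained: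
  obtains M where "M \<in> matchings_in E X" "card (A \<inter> \<Union>M) = coverable E X A"
proof -
  have "coverable E X A \<in> (\<lambda>M. card (A \<inter> \<Union>M)) ` matchings_in E X"
    unfolding coverable_def using empty_in_matchings_in[of E X] by (intro Max_in) (auto simp del: empty_in_matchings_in)
  then show thesis using that by auto
qed

lemma mnum_mono: assumes "X \<subseteq> Y" shows "mnum E X \<le> mnum E Y"
proof -
  obtain M where "M \<in> matchings_in E X" "card M = mnum E X" by (rule mnum_attained)
  with assms mnum_ge[of M E Y] show ?thesis by (auto simp: matchings_in_def)
qed

lemma match_eq_mnum: "match E = mnum E UNIV"
  by (simp add: match_def mnum_def matchings_in_def)

text \<open>In an optimal matching at most one edge contains y, and this edge has at most one end in
  \<open>A\<close> because y itself is outside \<open>A\<close>. Deleting it loses at most one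
  covered vertex.\<close>

lemma coverable_remove:
  assumes "y \<notin> A" "simple_graph E"
  shows "coverable E X A \<le> coverable E (X - {y}) A + 1"
proof -
  obtain M where M: "M \<in> matchings_in E X" "card (A \<inter> \<Union>M) = coverable E X A"
    by (rule coverable_attained)
  show ?thesis
  proof (cases "y \<in> \<Union>M")
    case False
    then have "M \<in> matchings_in E (X - {y})" using M by (auto simp: matchings_in_def)
    then show ?thesis using coverable_ge M(2) by (metis trans_le_add1)
  next
    case True
    then obtain e where e: "e \<in> M" "y \<in> e" by auto
    have "card e = 2" using e M assms(2)
      by (auto simp: matchings_in_def matching_def simple_graph_def)
    then obtain z where z: "e = {y, z}" using e(2) unfolding card_2_iff by auto
    have "y \<notin> \<Union>(M - {e})"
    proof
      assume "y \<in> \<Union>(M - {e})"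
      then obtain a where a: "a \<in> M" "a \<noteq> e" "y \<in> a" by auto
      have "disjoint M" using M by (simp add: matchings_in_def matching_def)
      then show False using e a by (meson disjointD disjoint_iff)
    qed
    then have "M - {e} \<in> matchings_in E (X - {y})"
      using M by (auto simp: matchings_in_def matching_def disjoint_def)
    then have "card (A \<inter> \<Union>(M - {e})) \<le> coverable E (X - {y}) A" by (rule coverable_ge)
    moreover have "A \<inter> \<Union>M \<subseteq> insert z (A \<inter> \<Union>(M - {e}))" using z assms(1) by auto
    then have "card (A \<inter> \<Union>M) \<le> card (A \<inter> \<Union>(M - {e})) + 1"
      using card_mono[of "insert z (A \<inter> \<Union>(M - {e}))" "A \<inter> \<Union>M"]
        card_Un_le[of "{z}" "A \<inter> \<Union>(M - {e})"] by simp
    ultimately show ?thesis using M(2) by linarith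
  qed
qed

text \<open>An optimal matching \<open>M\<close> for \<open>coverable E X A\<close> lies inside
  \<open>A\<close>: a covered vertex y outside \<open>A\<close> would make \<open>M\<close> count
  one more for \<open>insert y A\<close>. If \<open>M\<close> were not maximum in \<open>X\<close>,
  augmentation would keep all vertices of \<open>M\<close> and cover a further z; then the count for
  \<open>A\<close> or for \<open>insert z A\<close> would exceed the optimum.\<close>

lemma mnum_eq_if_not_extendable:
  assumes "simple_graph E" "A \<subseteq> X" "\<forall>y\<in>X - A. coverable E X (insert y A) \<le> coverable E X A"
  shows "mnum E X = mnum E A"
proof -
  obtain M where M: "M \<in> matchings_in E X" "card (A \<inter> \<Union>M) = coverable E X A"
    by (rule coverable_attained)
  have "\<Union>M \<subseteq> A"
  proof
    fix y assume y: "y \<in> \<Union>M"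
    show "y \<in> A"
    proof (rule ccontr)
      assume "y \<notin> A"
      then have "card (insert y A \<inter> \<Union>M) = card (A \<inter> \<Union>M) + 1" using y by simp
      moreover have "y \<in> X - A" using y M \<open>y \<notin> A\<close> by (auto simp: matchings_in_def)
      ultimately show False using assms(3) coverable_ge[OF M(1), of "insert y A"] M(2) by force
    qed
  qed
  then have MA: "M \<in> matchings_in E A" using M(1) by (auto simp: matchings_in_def)
  have "mnum E X \<le> card M"
  proof (rule ccontr)
    assume "\<not> mnum E X \<le> card M"
    moreover obtain N where N: "N \<in> matchings_in E X" "card N = mnum E X" by (rule mnum_attained)
    ultimately have "card M < card N" by linarith
    moreover have "\<forall>e\<in>M \<union> N. card e = 2" "disjoint M" "disjoint N"
      using M(1) N(1) assms(1) by (auto simp: matchings_in_def matching_def simple_graph_def)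
    ultimately obtain M' where M': "M' \<subseteq> M \<union> N" "disjoint M'" "\<Union>M \<subset> \<Union>M'"
      using matching_augment[of M N] by (metis finite_class.finite_code)
    then have M'X: "M' \<in> matchings_in E X"
      using M(1) N(1) unfolding matchings_in_def matching_def by blast
    obtain z where z: "z \<in> \<Union>M'" "z \<notin> \<Union>M" using M'(3) by blast
    have "A \<inter> \<Union>M \<subset> insert z A \<inter> \<Union>M'" using z M'(3) by auto
    then have "card (A \<inter> \<Union>M) < card (insert z A \<inter> \<Union>M')" by (intro psubset_card_mono) auto
    also have "\<dots> \<le> coverable E X (insert z A)" by (rule coverable_ge[OF M'X])
    also have "\<dots> \<le> coverable E X A"
    proof (cases "z \<in> A")
      case True then show ?thesis by (simp add: insert_absorb)
    next
      case False
      then show ?thesis using assms(3) M'X z by (auto simp: matchings_in_def)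
    qed
    finally show False using M(2) by simp
  qed
  then show ?thesis using mnum_ge[OF MA] mnum_mono[OF assms(2), of E] by linarith
qed

text \<open>Edges of an optimal matching inside \<open>A\<close> form a matching of \<open>A\<close>
  and contribute two vertices each. Every other edge contributes at most one, and the chosen ends
  outside \<open>A\<close> of these edges are distinct elements of \<open>X - A\<close>. The
  inequality keeps the regularity bound positive as long as \<open>A\<close> contains no matching of
  size s.\<close>

lemma coverable_le:
  assumes "simple_graph E" "A \<subseteq> X"
  shows "coverable E X A \<le> card (X - A) + 2 * mnum E A"
proof -
  obtain M where M: "M \<in> matchings_in E X" "card (A \<inter> \<Union>M) = coverable E X A"
    by (rule coverable_attained)
  have c2: "card e = 2" if "e \<in> M" for e
    using that M assms(1) by (auto simp: matchings_in_def matching_def simple_graph_def)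
  have disj: "disjoint M" using M by (auto simp: matchings_in_def matching_def)
  define P where "P = {e \<in> M. e \<subseteq> A}"
  define Q where "Q = M - P"
  have PA: "P \<in> matchings_in E A"
    using M disj by (auto simp: P_def matchings_in_def matching_def disjoint_def)
  have "card (\<Union>P) = 2 * card P"
    using c2 disj by (intro card_Union_matching) (auto simp: P_def disjoint_def)
  then have P: "card (\<Union>P) \<le> 2 * mnum E A" using mnum_ge[OF PA] by simp
  have "\<forall>e\<in>Q. \<exists>x y. e = {x, y} \<and> y \<notin> A"
  proof
    fix e assume e: "e \<in> Q"
    then obtain y where y: "y \<in> e" "y \<notin> A" by (auto simp: Q_def P_def)
    have "card e = 2" using c2 e by (auto simp: Q_def)
    then obtain x where "e = {x, y}" using y(1) unfolding card_2_iff by auto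
    then show "\<exists>x y. e = {x, y} \<and> y \<notin> A" using y by auto
  qed
  then obtain f g where fg: "\<And>e. e \<in> Q \<Longrightarrow> e = {f e, g e} \<and> g e \<notin> A" by metis
  have "inj_on g Q"
  proof (rule inj_onI)
    fix a b assume ab: "a \<in> Q" "b \<in> Q" "g a = g b"
    then have "g a \<in> a \<inter> b" using fg by (metis IntI insertCI)
    then show "a = b" using disj ab by (auto simp: Q_def disjoint_def)
  qed
  moreover have "g e \<in> X - A" if "e \<in> Q" for e
  proof -
    have "g e \<in> e" using fg[OF that] by (metis insertCI)
    then show ?thesis using fg[OF that] that M(1) by (auto simp: Q_def matchings_in_def)
  qed
  then have "g ` Q \<subseteq> X - A" by auto
  ultimately have Q: "card Q \<le> card (X - A)" by (metis card_inj_on_le finite_class.finite_code)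
  have "A \<inter> \<Union>M \<subseteq> \<Union>P \<union> f ` Q"
  proof
    fix x assume x: "x \<in> A \<inter> \<Union>M"
    then obtain e where e: "e \<in> M" "x \<in> e" by auto
    show "x \<in> \<Union>P \<union> f ` Q"
    proof (cases "e \<in> P")
      case True then show ?thesis using e by auto
    next
      case False
      then have "e \<in> Q" using e by (auto simp: Q_def)
      then have "x = f e" using fg[of e] e(2) x by auto
      then show ?thesis using \<open>e \<in> Q\<close> by auto
    qed
  qed
  then have "card (A \<inter> \<Union>M) \<le> card (\<Union>P \<union> f ` Q)" by (intro card_mono) auto
  also have "\<dots> \<le> card (\<Union>P) + card (f ` Q)" by (rule card_Un_le)
  also have "\<dots> \<le> card (\<Union>P) + card Q" by (simp add: card_image_le)
  finally show ?thesis using P Q M(2) by linarith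
qed

text \<open>Rado's proof of Hall's theorem: as long as some set has two elements, one of them can be
  removed without violating Hall's condition.\<close>

lemma hall:
  assumes "finite I" "\<And>i. i \<in> I \<Longrightarrow> finite (A i)" "\<And>S. S \<subseteq> I \<Longrightarrow> card S \<le> card (\<Union>i\<in>S. A i)"
  shows "\<exists>f. inj_on f I \<and> (\<forall>i\<in>I. f i \<in> A i)"
  using assms(2,3)
proof (induction "\<Sum>i\<in>I. card (A i)" arbitrary: A rule: less_induct)
  case less
  have ne: "card (A i) \<ge> 1" if "i \<in> I" for i using less.prems(2)[of "{i}"] that by auto
  show ?case
  proof (cases "\<forall>i\<in>I. card (A i) = 1")
    case True
    then have "\<forall>i\<in>I. \<exists>x. A i = {x}" by (auto simp: card_1_singleton_iff)
    then obtain f where f: "\<And>i. i \<in> I \<Longrightarrow> A i = {f i}" by metis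
    have "inj_on f I"
    proof (rule inj_onI, rule ccontr)
      fix i j assume ij: "i \<in> I" "j \<in> I" "f i = f j" "i \<noteq> j"
      then have "(\<Union>k\<in>{i, j}. A k) = {f i}" using f by auto
      then show False using less.prems(2)[of "{i, j}"] ij by auto
    qed
    then show ?thesis using f by auto
  next
    case False
    then obtain i where i: "i \<in> I" "card (A i) \<noteq> 1" by blast
    then have "card (A i) \<ge> 2" using ne[of i] by linarith
    then obtain B where "B \<subseteq> A i" "card B = 2" using obtain_subset_with_card_n by metis
    then obtain x y where xy: "x \<in> A i" "y \<in> A i" "x \<noteq> y" by (auto simp: card_2_iff)
    have lt: "(\<Sum>j\<in>I. card ((A(i := A i - {z})) j)) < (\<Sum>j\<in>I. card (A j))" if "z \<in> A i" for z
    proof -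
      have "0 < card (A i)" using that i(1) less.prems(1) by (auto simp: card_gt_0_iff)
      then show ?thesis using that i(1) assms(1)
        by (intro sum_strict_mono_ex1) (auto simp: card_Diff_singleton_if)
    qed
    have fin: "finite ((A(i := A i - {z})) j)" if "j \<in> I" for j z using less.prems(1) that by auto
    have "\<exists>z\<in>{x, y}. \<forall>S\<subseteq>I. card S \<le> card (\<Union>j\<in>S. (A(i := A i - {z})) j)"
    proof (rule ccontr)
      assume neg: "\<not> ?thesis"
      \<comment> \<open>A set S violating Hall's condition after the removal of z must contain i, as
        the other sets are unchanged. With \<open>K = S - {i}\<close> the strict inequality for S
        becomes a weak one for K.\<close>
      have bad: "\<exists>K. K \<subseteq> I \<and> i \<notin> K \<and> card ((\<Union>j\<in>K. A j) \<union> (A i - {z})) \<le> card K"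
        if "z \<in> {x, y}" for z
      proof -
        have "\<not> (\<forall>S\<subseteq>I. card S \<le> card (\<Union>j\<in>S. (A(i := A i - {z})) j))"
          by (rule contrapos_nn[OF neg]) (rule bexI[OF _ that])
        then obtain S where S: "S \<subseteq> I" "card (\<Union>j\<in>S. (A(i := A i - {z})) j) < card S"
          unfolding not_all not_imp not_le by blast
        have "i \<in> S"
        proof (rule ccontr)
          assume "i \<notin> S"
          then have "(\<Union>j\<in>S. (A(i := A i - {z})) j) = (\<Union>j\<in>S. A j)" by auto
          then show False using S less.prems(2)[OF S(1)] by simp
        qed
        then have "(\<Union>j\<in>S. (A(i := A i - {z})) j) = (\<Union>j\<in>S - {i}. A j) \<union> (A i - {z})"
          by (auto split: if_splits)
        moreover have "card S = Suc (card (S - {i}))"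
          using \<open>i \<in> S\<close> finite_subset[OF S(1) assms(1)] by (simp only: card_Suc_Diff1)
        ultimately show ?thesis using S by (intro exI[of _ "S - {i}"]) auto
      qed
      obtain K where K: "K \<subseteq> I" "i \<notin> K" "card ((\<Union>j\<in>K. A j) \<union> (A i - {x})) \<le> card K"
        using bad[of x] by auto
      obtain L where L: "L \<subseteq> I" "i \<notin> L" "card ((\<Union>j\<in>L. A j) \<union> (A i - {y})) \<le> card L"
        using bad[of y] by auto
      let ?P = "(\<Union>j\<in>K. A j) \<union> (A i - {x})" and ?Q = "(\<Union>j\<in>L. A j) \<union> (A i - {y})"
      have finKL: "finite K" "finite L" using K L assms(1) finite_subset by blast+
      have finPQ: "finite ?P" "finite ?Q" using K L less.prems(1) i(1) finKL by auto
      \<comment> \<open>Since x and y differ, the two truncated copies of \<open>A i\<close> in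
        \<open>?P\<close> and \<open>?Q\<close> together give back \<open>A i\<close>. Hall's
        condition for \<open>insert i (K \<union> L)\<close> and for \<open>K \<inter> L\<close>
        then forces |P| + |Q| > |K| + |L|, against the choice of K and L.\<close>
      have "card (K \<union> L) + 1 = card (insert i (K \<union> L))" using K L finKL by simp
      also have "\<dots> \<le> card (\<Union>j\<in>insert i (K \<union> L). A j)" using K L i(1) by (intro less.prems(2)) auto
      also have "(\<Union>j\<in>insert i (K \<union> L). A j) = ?P \<union> ?Q" using xy by auto
      finally have 1: "card (K \<union> L) + 1 \<le> card (?P \<union> ?Q)" .
      have "card (K \<inter> L) \<le> card (\<Union>j\<in>K \<inter> L. A j)" using K by (intro less.prems(2)) auto
      also have "\<dots> \<le> card (?P \<inter> ?Q)" using finPQ by (intro card_mono) auto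
      finally have 2: "card (K \<inter> L) \<le> card (?P \<inter> ?Q)" .
      show False
        using 1 2 K(3) L(3) card_Un_Int[OF finPQ] card_Un_Int[OF finKL] by linarith
    qed
    then obtain z where z: "z \<in> A i" "\<forall>S\<subseteq>I. card S \<le> card (\<Union>j\<in>S. (A(i := A i - {z})) j)"
      using xy by auto
    obtain f where "inj_on f I" "\<forall>j\<in>I. f j \<in> (A(i := A i - {z})) j"
      using less.hyps[OF lt[OF z(1)], of] fin z(2) by blast
    then show ?thesis by (intro exI[of _ f]) (auto split: if_splits)
  qed
qed

section \<open>Very well-covered graphs\<close>

definition independent_set :: "'v::finite set set \<Rightarrow> 'v set \<Rightarrow> bool" where
  "independent_set E T \<longleftrightarrow> (\<forall>e\<in>E. \<not> e \<subseteq> T)"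

lemma vertex_cover_Compl: "vertex_cover E (- T) \<longleftrightarrow> independent_set E T"
  unfolding vertex_cover_def independent_set_def by blast

lemma independent_set_mono: "independent_set E T \<Longrightarrow> S \<subseteq> T \<Longrightarrow> independent_set E S"
  unfolding independent_set_def by blast

text \<open>The bounding set \<open>X\<close> serves two purposes: \<open>UNIV\<close> yields
  maximal independent sets of the graph, while a neighbourhood yields the set \<open>Q\<close> that
  is exchanged in \<open>card_neighbours_ge\<close>.\<close>

lemma independent_set_extend:
  assumes "independent_set E T" "T \<subseteq> X"
  obtains T' where "independent_set E T'" "T \<subseteq> T'" "T' \<subseteq> X"
    "\<And>T''. independent_set E T'' \<Longrightarrow> T' \<subseteq> T'' \<Longrightarrow> T'' \<subseteq> X \<Longrightarrow> T'' = T'"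
proof -
  let ?F = "{T'. independent_set E T' \<and> T \<subseteq> T' \<and> T' \<subseteq> X}"
  have "T \<in> ?F" using assms by simp
  then have ne: "?F \<noteq> {}" by (metis empty_iff)
  from finite_has_maximal[OF finite ne] obtain m
    where m: "m \<in> ?F" and max: "\<forall>x\<in>?F. m \<subseteq> x \<longrightarrow> m = x" by (rule bexE)
  show thesis
  proof (rule that[of m])
    fix T'' assume "independent_set E T''" "m \<subseteq> T''" "T'' \<subseteq> X"
    moreover from this have "T'' \<in> ?F" using m by auto
    ultimately show "T'' = m" using max by metis
  qed (use m in auto)
qed

definition neighbours :: "'v set set \<Rightarrow> 'v set \<Rightarrow> 'v set" where
  "neighbours E S = {w. \<exists>v\<in>S. {v, w} \<in> E}"

text \<open>The complement of a maximal independent set is a minimal vertex cover, because a smaller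
  cover would have a larger independent complement. It contains half of the vertices, so the other
  half remains.\<close>

lemma card_maximal_independent:
  assumes "very_well_covered (E :: 'v::finite set set)" "independent_set E T"
    "\<And>T'. independent_set E T' \<Longrightarrow> T \<subseteq> T' \<Longrightarrow> T' = T"
  shows "2 * card T = CARD('v)"
proof -
  have "minimal_vertex_cover E (- T)"
    unfolding minimal_vertex_cover_def
  proof (intro conjI allI impI)
    show "vertex_cover E (- T)" using assms(2) by (simp add: vertex_cover_Compl)
    fix C' assume C': "C' \<subset> - T"
    show "\<not> vertex_cover E C'"
    proof
      assume "vertex_cover E C'"
      then have "independent_set E (- C')" using vertex_cover_Compl[of E "- C'"] by simp
      then show False using assms(3)[of "- C'"] C' by auto
    qed
  qed
  then have "card (- T) = CARD('v) div 2" "even CARD('v)"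
    using assms(1) unfolding very_well_covered_def by auto
  moreover have "card (- T) + card T = CARD('v)"
    using card_Un_disjoint[of "- T" T] by simp
  ultimately show ?thesis by presburger
qed

lemma card_independent_le:
  assumes "very_well_covered (E :: 'v::finite set set)" "independent_set E T"
  shows "2 * card T \<le> CARD('v)"
proof -
  obtain T' where "independent_set E T'" "T \<subseteq> T'"
    "\<And>T''. independent_set E T'' \<Longrightarrow> T' \<subseteq> T'' \<Longrightarrow> T'' = T'"
    by (rule independent_set_extend[OF assms(2), of UNIV]) auto
  moreover from this have "2 * card T' = CARD('v)" by (intro card_maximal_independent[OF assms(1)])
  moreover have "card T \<le> card T'" using \<open>T \<subseteq> T'\<close> by (intro card_mono) auto
  ultimately show ?thesis by linarith
qed

lemma simple_graph_edge:
  assumes "simple_graph E" "e \<in> E" "v \<in> e"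
  obtains w where "e = {v, w}" "v \<noteq> w"
proof -
  have "card e = 2" using assms unfolding simple_graph_def by auto
  then obtain x y where "e = {x, y}" "x \<noteq> y" unfolding card_2_iff by auto
  then show thesis using assms(3) that[of y] that[of x] by auto
qed

text \<open>Berge's exchange: \<open>Q\<close> is a maximal independent subset of the neighbourhood of \<open>S\<close>; in a
  maximal independent set containing \<open>Q\<close> and the part of \<open>S\<close> not adjacent to \<open>Q\<close>, replace \<open>Q\<close>
  by \<open>S\<close>.\<close>

lemma card_neighbours_ge:
  assumes "very_well_covered (E :: 'v::finite set set)" "simple_graph E" "independent_set E S"
  shows "card S \<le> card (neighbours E S)"
  using assms(3)
proof (induction "card S" arbitrary: S rule: less_induct)
  case less
  show ?case
  proof (cases "S = {}")
    case False
    have nonisolated: "\<exists>w. {v, w} \<in> E" for v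
    proof -
      obtain e where "e \<in> E" "v \<in> e" using assms(1) unfolding very_well_covered_def by metis
      then show ?thesis using simple_graph_edge[OF assms(2)] by metis
    qed
    have indep_emp: "independent_set E {w}" for w
    proof -
      have "\<not> e \<subseteq> {w}" if "e \<in> E" for e
      proof
        assume "e \<subseteq> {w}"
        then have "card e \<le> 1" using card_mono[of "{w}" e] by simp
        then show False using assms(2) that unfolding simple_graph_def by auto
      qed
      then show ?thesis unfolding independent_set_def by blast
    qed
    \<comment> \<open>Seeding \<open>Q\<close> with a neighbour w0 of v0 makes v0 adjacent to
      \<open>Q\<close>. This excludes v0 from \<open>S0\<close>, so \<open>S0\<close> is strictly
      smaller than \<open>S\<close> and the induction hypothesis applies to it.\<close>
    obtain v0 w0 where vw0: "v0 \<in> S" "{v0, w0} \<in> E" using False nonisolated by blast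
    then have w0: "w0 \<in> neighbours E S" by (auto simp: neighbours_def)
    obtain Q where Q: "independent_set E Q" "{w0} \<subseteq> Q" "Q \<subseteq> neighbours E S"
      "\<And>T. independent_set E T \<Longrightarrow> Q \<subseteq> T \<Longrightarrow> T \<subseteq> neighbours E S \<Longrightarrow> T = Q"
      by (rule independent_set_extend[OF indep_emp[of w0], of "neighbours E S"]) (use w0 in auto)
    define S0 where "S0 = S - neighbours E Q"
    have v0: "v0 \<in> neighbours E Q"
      using vw0 Q(2) by (auto simp: neighbours_def insert_commute)
    then have "S0 \<subset> S" using vw0 by (auto simp: S0_def)
    then have cS0: "card S0 < card S" by (intro psubset_card_mono) auto
    have indS0: "independent_set E S0"
      using less.prems independent_set_mono \<open>S0 \<subset> S\<close> by (metis psubset_imp_subset)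
    have IH: "card S0 \<le> card (neighbours E S0)" by (rule less.hyps[OF cS0 indS0])
    have "independent_set E (Q \<union> S0)"
      unfolding independent_set_def
    proof (intro ballI notI)
      fix e assume e: "e \<in> E" "e \<subseteq> Q \<union> S0"
      have "\<not> e \<subseteq> S0" using e(1) indS0 unfolding independent_set_def by metis
      then obtain v where v: "v \<in> e" "v \<in> Q" using e(2) by auto
      obtain w where w: "e = {v, w}" using simple_graph_edge[OF assms(2) e(1) v(1)] by metis
      have "\<not> e \<subseteq> Q" using e(1) Q(1) unfolding independent_set_def by metis
      then have "w \<notin> Q" using w v by auto
      then have "w \<in> S0" using e w by auto
      moreover have "w \<in> neighbours E Q" using e w v by (auto simp: neighbours_def)
      ultimately show False by (auto simp: S0_def)
    qed
    then obtain T where T: "independent_set E T" "Q \<union> S0 \<subseteq> T"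
      "\<And>T'. independent_set E T' \<Longrightarrow> T \<subseteq> T' \<Longrightarrow> T' = T"
      by (rule independent_set_extend[where X = UNIV]) auto
    have cT: "2 * card T = CARD('v)" by (rule card_maximal_independent[OF assms(1) T(1) T(3)])
    \<comment> \<open>The intersection is an independent subset of the neighbourhood of
      \<open>S\<close> that contains \<open>Q\<close>, and \<open>Q\<close> is maximal among
      these.\<close>
    have TN: "T \<inter> neighbours E S = Q"
      using Q(3) T(2) by (intro Q(4) independent_set_mono[OF T(1)]) auto
    have TS: "T \<inter> S = S0"
    proof -
      have "x \<notin> neighbours E Q" if "x \<in> T" for x
      proof
        assume "x \<in> neighbours E Q"
        then obtain q where "q \<in> Q" "{q, x} \<in> E" by (auto simp: neighbours_def)
        moreover from this have "\<not> {q, x} \<subseteq> T" using T(1) unfolding independent_set_def by metis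
        ultimately show False using T(2) that by auto
      qed
      then show ?thesis using T(2) by (auto simp: S0_def)
    qed
    \<comment> \<open>A vertex of \<open>T\<close> adjacent to \<open>S\<close> lies in
      \<open>T \<inter> neighbours E S = Q\<close> and has been taken out.\<close>
    have "independent_set E ((T - Q) \<union> S)"
      unfolding independent_set_def
    proof (intro ballI notI)
      fix e assume e: "e \<in> E" "e \<subseteq> (T - Q) \<union> S"
      have "\<not> e \<subseteq> T" using e(1) T(1) unfolding independent_set_def by metis
      then obtain v where v: "v \<in> e" "v \<in> S" using e(2) by auto
      obtain w where w: "e = {v, w}" using simple_graph_edge[OF assms(2) e(1) v(1)] by metis
      have "w \<in> neighbours E S" using e w v by (auto simp: neighbours_def)
      moreover have "\<not> e \<subseteq> S" using e(1) less.prems unfolding independent_set_def by metis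
      then have "w \<notin> S" using w v by auto
      ultimately show False using e(2) w TN by auto
    qed
    then have "2 * card ((T - Q) \<union> S) \<le> CARD('v)" by (rule card_independent_le[OF assms(1)])
    moreover have "S \<inter> neighbours E S = {}"
    proof -
      have "\<not> {v, w} \<subseteq> S" if "{v, w} \<in> E" for v w
        using that less.prems unfolding independent_set_def by metis
      then show ?thesis by (auto simp: neighbours_def)
    qed
    then have "S0 \<subseteq> T - Q" using T(2) Q(3) \<open>S0 \<subset> S\<close> by auto
    then have "(T - Q) \<union> S = (T - Q) \<union> (S - S0)" by auto
    moreover have "card ((T - Q) \<union> (S - S0)) = card (T - Q) + card (S - S0)"
      using TS by (intro card_Un_disjoint) auto
    moreover have "card (T - Q) = card T - card Q" "card Q \<le> card T"
      using T(2) by (auto intro!: card_Diff_subset card_mono)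
    moreover have "card (S - S0) = card S - card S0"
      using \<open>S0 \<subset> S\<close> by (intro card_Diff_subset) auto
    \<comment> \<open>The exchanged set has |T| - |Q| + |S| - |S0| elements, and this is at most
      |V|/2 = |T|. It remains to bound |S0| by its neighbours, which are disjoint from
      \<open>Q\<close> because no vertex of \<open>S0\<close> is adjacent to
      \<open>Q\<close>.\<close>
    ultimately have "card S \<le> card S0 + card Q" using cT cS0 by simp
    also have "\<dots> \<le> card (neighbours E S0) + card Q" using IH by simp
    also have "\<dots> = card (neighbours E S0 \<union> Q)"
    proof -
      have "x \<notin> Q" if "v \<in> S0" "{v, x} \<in> E" for v x
      proof
        assume "x \<in> Q"
        moreover have "{x, v} \<in> E" using that(2) by (simp add: insert_commute)
        ultimately have "v \<in> neighbours E Q" by (auto simp: neighbours_def)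
        then show False using that(1) by (simp add: S0_def)
      qed
      then have "neighbours E S0 \<inter> Q = {}" by (auto simp: neighbours_def)
      then show ?thesis by (simp add: card_Un_disjoint)
    qed
    also have "\<dots> \<le> card (neighbours E S)"
      using Q(3) by (intro card_mono) (auto simp: S0_def neighbours_def)
    finally show ?thesis .
  qed simp
qed

text \<open>A maximal independent set \<open>T\<close> has |V|/2 elements, and Hall's condition
  holds for the neighbourhoods of its vertices. The resulting injection maps \<open>T\<close> to
  vertices outside \<open>T\<close>, as \<open>T\<close> is independent, so the edges
  \<open>{v, f v}\<close> are pairwise disjoint and form a perfect matching.\<close>

lemma very_well_covered_match:
  assumes "very_well_covered (E :: 'v::finite set set)" "simple_graph E"
  shows "CARD('v) \<le> 2 * match E"
proof -
  have "independent_set E {}"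
    using assms(2) by (auto simp: independent_set_def simple_graph_def)
  then obtain T where T: "independent_set E T"
      "\<And>T'. independent_set E T' \<Longrightarrow> T \<subseteq> T' \<Longrightarrow> T' = T"
    by (rule independent_set_extend[where X = UNIV]) auto
  have cT: "2 * card T = CARD('v)" by (rule card_maximal_independent[OF assms(1) T])
  have "card S \<le> card (\<Union>v\<in>S. {w. {v, w} \<in> E})" if "S \<subseteq> T" for S
  proof -
    have "(\<Union>v\<in>S. {w. {v, w} \<in> E}) = neighbours E S" by (auto simp: neighbours_def)
    then show ?thesis
      using card_neighbours_ge[OF assms independent_set_mono[OF T(1) that]] by simp
  qed
  then obtain f where f: "inj_on f T" "\<forall>v\<in>T. {v, f v} \<in> E"
    using hall[of T "\<lambda>v. {w. {v, w} \<in> E}"] by auto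
  let ?M = "(\<lambda>v. {v, f v}) ` T"
  have fT: "f v \<notin> T" if "v \<in> T" for v
    using f(2) that T(1) unfolding independent_set_def by (metis empty_subsetI insert_subset)
  have "disjoint ?M"
    unfolding disjoint_def using f(1) fT by (auto dest: inj_onD)
  then have "?M \<in> matchings_in E UNIV" using f(2) by (auto simp: matchings_in_def matching_def)
  moreover have "card ?M = card T"
  proof (rule card_image, rule inj_onI)
    fix x y assume "x \<in> T" "y \<in> T" "{x, f x} = {y, f y}"
    then show "x = y" using fT by (metis doubleton_eq_iff)
  qed
  ultimately show ?thesis using mnum_ge[of ?M E UNIV] cT by (simp add: match_eq_mnum)
qed

section \<open>Homogeneous polynomials and graded matrices\<close>

text \<open>Selecting monomials by a property of their exponent vectors covers two needs:
  homogeneous components, and the separation of the terms divisible by a given variable.\<close>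

definition restrict_keys :: "('a \<Rightarrow> bool) \<Rightarrow> ('a \<Rightarrow>\<^sub>0 'b::zero) \<Rightarrow> ('a \<Rightarrow>\<^sub>0 'b)" where
  "restrict_keys P p = Poly_Mapping.mapp (\<lambda>u c. if P u then c else 0) p"

lemma lookup_restrict_keys:
  "Poly_Mapping.lookup (restrict_keys P p) u = (if P u then Poly_Mapping.lookup p u else 0)"
  unfolding restrict_keys_def lookup_mapp by (simp add: when_def in_keys_iff)

lemma keys_restrict_keys: "Poly_Mapping.keys (restrict_keys P p) = {u \<in> Poly_Mapping.keys p. P u}"
  by (auto simp: in_keys_iff lookup_restrict_keys split: if_splits)

lemma restrict_keys_add:
  "restrict_keys P (p + q) = restrict_keys P p + restrict_keys P (q :: 'a \<Rightarrow>\<^sub>0 'b::monoid_add)"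
  by (rule poly_mapping_eqI) (simp add: lookup_restrict_keys lookup_add)

lemma restrict_keys_zero [simp]: "restrict_keys P 0 = 0"
  by (rule poly_mapping_eqI) (simp add: lookup_restrict_keys)

lemma restrict_keys_sum:
  "restrict_keys P (\<Sum>i\<in>A. f i) = (\<Sum>i\<in>A. restrict_keys P (f i :: 'a \<Rightarrow>\<^sub>0 'b::comm_monoid_add))"
  by (induction A rule: infinite_finite_induct) (simp_all add: restrict_keys_add)

lemma restrict_keys_split:
  "p = restrict_keys P p + restrict_keys (\<lambda>u. \<not> P u) (p :: 'a \<Rightarrow>\<^sub>0 'b::monoid_add)"
  by (rule poly_mapping_eqI) (simp add: lookup_restrict_keys lookup_add)

lemma restrict_keys_id:
  assumes "\<And>u. u \<in> Poly_Mapping.keys p \<Longrightarrow> P u"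
  shows "restrict_keys P p = p"
  using assms by (intro poly_mapping_eqI) (auto simp: lookup_restrict_keys in_keys_iff)

lemma restrict_keys_empty:
  assumes "\<And>u. u \<in> Poly_Mapping.keys p \<Longrightarrow> \<not> P u"
  shows "restrict_keys P p = 0"
  using assms by (intro poly_mapping_eqI) (auto simp: lookup_restrict_keys in_keys_iff)

lemma mdeg_add: "mdeg (u + v) = mdeg u + mdeg v"
  by (simp add: mdeg_def lookup_add sum.distrib)

lemma mdeg_zero [simp]: "mdeg 0 = 0"
  by (simp add: mdeg_def)

lemma mdeg_eq_0_iff: "mdeg u = 0 \<longleftrightarrow> u = 0"
proof
  assume "mdeg u = 0"
  then have "Poly_Mapping.lookup u v = 0" for v by (simp add: mdeg_def)
  then show "u = 0" by (intro poly_mapping_eqI) simp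
qed simp

lemma mdeg_single [simp]: "mdeg (Poly_Mapping.single v n) = n"
  by (simp add: mdeg_def lookup_single when_def)

section \<open>Homogeneous components and the irrelevant ideal\<close>

definition homog :: "int \<Rightarrow> ('v::finite, 'k::zero) mpoly \<Rightarrow> bool" where
  "homog d p \<longleftrightarrow> (\<forall>u\<in>Poly_Mapping.keys p. int (mdeg u) = d)"

definition hpart :: "int \<Rightarrow> ('v::finite, 'k::zero) mpoly \<Rightarrow> ('v, 'k) mpoly" where
  "hpart d = restrict_keys (\<lambda>u. int (mdeg u) = d)"

lemma homog_zero [simp]: "homog d 0"
  by (simp add: homog_def)

lemma homog_one: "homog 0 (1 :: ('v::finite, 'k::comm_ring_1) mpoly)"
  by (simp add: homog_def)

lemma homog_add: "homog d p \<Longrightarrow> homog d q \<Longrightarrow> homog d (p + q)"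
  unfolding homog_def using keys_add[of p q] by blast

lemma homog_sum:
  fixes f :: "'a \<Rightarrow> ('v::finite, 'k::comm_monoid_add) mpoly"
  shows "(\<And>i. i \<in> A \<Longrightarrow> homog d (f i)) \<Longrightarrow> homog d (\<Sum>i\<in>A. f i)"
  by (induction A rule: infinite_finite_induct) (simp_all add: homog_add)

lemma keys_uminus: "Poly_Mapping.keys (- p) = Poly_Mapping.keys (p :: 'a \<Rightarrow>\<^sub>0 'b::ab_group_add)"
  by (auto simp: in_keys_iff)

lemma homog_uminus: "homog d p \<Longrightarrow> homog d (- p :: ('v::finite, 'k::ab_group_add) mpoly)"
  by (simp add: homog_def keys_uminus)

lemma homog_diff:
  "homog d p \<Longrightarrow> homog d q \<Longrightarrow> homog d (p - q :: ('v::finite, 'k::ab_group_add) mpoly)"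
  using homog_add[of d p "- q"] homog_uminus[of d q] by simp

lemma homog_mult:
  fixes p q :: "('v::finite, 'k::comm_ring_1) mpoly"
  assumes "homog d p" "homog e q"
  shows "homog (d + e) (p * q)"
  unfolding homog_def
proof
  fix u assume "u \<in> Poly_Mapping.keys (p * q)"
  then obtain a b where "u = a + b" "a \<in> Poly_Mapping.keys p" "b \<in> Poly_Mapping.keys q"
    using keys_mult[of p q] by blast
  then show "int (mdeg u) = d + e" using assms by (simp add: mdeg_add homog_def)
qed

lemma homog_hpart: "homog d (hpart d p)"
  by (simp add: homog_def hpart_def keys_restrict_keys)

lemma hpart_id: "homog d p \<Longrightarrow> hpart d p = p"
  unfolding hpart_def homog_def by (intro restrict_keys_id) auto

text \<open>Multiplication by \<open>p\<close> raises every degree by exactly d, so the monomials of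
  \<open>q\<close> outside degree n - d contribute nothing to degree n.\<close>

lemma hpart_mult:
  fixes p q :: "('v::finite, 'k::comm_ring_1) mpoly"
  assumes "homog d p"
  shows "hpart n (p * q) = p * hpart (n - d) q"
proof -
  let ?r = "restrict_keys (\<lambda>u. int (mdeg u) \<noteq> n - d) q"
  have q: "q = hpart (n - d) q + ?r" unfolding hpart_def by (rule restrict_keys_split)
  have "homog n (p * hpart (n - d) q)"
    using homog_mult[OF assms homog_hpart[of "n - d" q]] by simp
  moreover have "hpart n (p * ?r) = 0"
    unfolding hpart_def
  proof (rule restrict_keys_empty)
    fix u assume "u \<in> Poly_Mapping.keys (p * ?r)"
    then obtain a b where "u = a + b" "a \<in> Poly_Mapping.keys p" "b \<in> Poly_Mapping.keys ?r"
      using keys_mult[of p ?r] by blast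
    then show "int (mdeg u) \<noteq> n" using assms by (simp add: mdeg_add homog_def keys_restrict_keys)
  qed
  ultimately have "hpart n (p * hpart (n - d) q + p * ?r) = p * hpart (n - d) q"
    by (simp add: hpart_def restrict_keys_add) (simp add: hpart_def[symmetric] hpart_id)
  then show ?thesis by (subst q) (simp only: distrib_left)
qed

lemma irrelevant_ideal_iff: "p \<in> irrelevant_ideal \<longleftrightarrow> 0 \<notin> Poly_Mapping.keys p"
  by (simp add: irrelevant_ideal_def in_keys_iff)

lemma irrelevant_zero [simp]: "0 \<in> irrelevant_ideal"
  by (simp add: irrelevant_ideal_iff)

lemma irrelevant_add: "p \<in> irrelevant_ideal \<Longrightarrow> q \<in> irrelevant_ideal \<Longrightarrow> p + q \<in> irrelevant_ideal"
  by (simp add: irrelevant_ideal_def lookup_add)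

lemma irrelevant_sum: "(\<And>i. i \<in> A \<Longrightarrow> f i \<in> irrelevant_ideal) \<Longrightarrow> (\<Sum>i\<in>A. f i) \<in> irrelevant_ideal"
  by (induction A rule: infinite_finite_induct) (simp_all add: irrelevant_add)

lemma irrelevant_mult_left: "p \<in> irrelevant_ideal \<Longrightarrow> p * q \<in> irrelevant_ideal"
proof (unfold irrelevant_ideal_iff, rule notI)
  assume p: "0 \<notin> Poly_Mapping.keys p" and "0 \<in> Poly_Mapping.keys (p * q)"
  then obtain a b where ab: "0 = a + b" "a \<in> Poly_Mapping.keys p"
    using keys_mult[of p q] by blast
  have "Poly_Mapping.lookup a v = 0" for v
    using arg_cong[OF ab(1), of "\<lambda>x. Poly_Mapping.lookup x v"] by (simp add: lookup_add)
  then have "a = 0" by (intro poly_mapping_eqI) simp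
  then show False using p ab(2) by simp
qed

lemma irrelevant_mult_right: "q \<in> irrelevant_ideal \<Longrightarrow> p * q \<in> irrelevant_ideal"
  using irrelevant_mult_left[of q p] by (simp add: mult.commute)

lemma homog_irrelevant: "homog d p \<Longrightarrow> d \<noteq> 0 \<Longrightarrow> p \<in> irrelevant_ideal"
  by (auto simp: homog_def irrelevant_ideal_iff)

lemma homog_degree_pos:
  assumes "homog d p" "p \<in> irrelevant_ideal" "p \<noteq> 0"
  shows "d \<ge> 1"
proof -
  obtain u where u: "u \<in> Poly_Mapping.keys p" using assms(3) by (metis keys_eq_empty ex_in_conv)
  then have "mdeg u \<noteq> 0" using assms(2) by (auto simp: mdeg_eq_0_iff irrelevant_ideal_iff)
  then show ?thesis using assms(1) u by (auto simp: homog_def)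
qed

lemma homog_degree_nonneg:
  assumes "homog d p" "p \<noteq> 0"
  shows "d \<ge> 0"
proof -
  obtain u where u: "u \<in> Poly_Mapping.keys p" using assms(2) by (metis keys_eq_empty ex_in_conv)
  then show ?thesis using assms(1) by (auto simp: homog_def)
qed

lemma hpart_0: "hpart 0 p = Poly_Mapping.single 0 (Poly_Mapping.lookup p 0)"
  by (rule poly_mapping_eqI)
     (auto simp: hpart_def lookup_restrict_keys mdeg_eq_0_iff lookup_single when_def)

lemma homog_var: "homog 1 (var v :: ('v::finite, 'k::comm_ring_1) mpoly)"
  by (simp add: homog_def var_def)

section \<open>Degree-preserving maps between graded free modules\<close>

lemma graded_hom_iff:
  "graded_hom ds es A \<longleftrightarrow> A \<in> carrier_mat (length es) (length ds) \<and>
     (\<forall>k < length es. \<forall>l < length ds. homog (ds ! l - es ! k) (A $$ (k, l)))"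
  by (simp add: graded_hom_def homog_def)

lemma graded_hom_carrier: "graded_hom ds es A \<Longrightarrow> A \<in> carrier_mat (length es) (length ds)"
  by (simp add: graded_hom_def)

lemma graded_hom_homog:
  "graded_hom ds es A \<Longrightarrow> k < length es \<Longrightarrow> l < length ds \<Longrightarrow> homog (ds ! l - es ! k) (A $$ (k, l))"
  by (simp add: graded_hom_iff)

lemma graded_hom_one: "graded_hom ds ds (1\<^sub>m (length ds))"
  by (auto simp: graded_hom_iff homog_one)

lemma graded_hom_zero: "graded_hom ds es (0\<^sub>m (length es) (length ds))"
  by (auto simp: graded_hom_iff)

lemma graded_hom_minus: "graded_hom ds es A \<Longrightarrow> graded_hom ds es B \<Longrightarrow> graded_hom ds es (A - B)"
  by (auto simp: graded_hom_iff intro!: homog_diff)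

lemma graded_hom_uminus: "graded_hom ds es A \<Longrightarrow> graded_hom ds es (- A)"
  by (auto simp: graded_hom_iff intro!: homog_uminus)

lemma index_mult_mat_sum:
  assumes "A \<in> carrier_mat a b" "B \<in> carrier_mat b c" "k < a" "l < c"
  shows "(A * B) $$ (k, l) = (\<Sum>j\<in>{0..<b}. A $$ (k, j) * B $$ (j, l))"
  using assms by (auto simp: scalar_prod_def intro!: sum.cong)

lemma index_mult_mat_vec_sum:
  assumes "A \<in> carrier_mat a b" "v \<in> carrier_vec b" "k < a"
  shows "(A *\<^sub>v v) $ k = (\<Sum>j\<in>{0..<b}. A $$ (k, j) * v $ j)"
  using assms by (auto simp: scalar_prod_def intro!: sum.cong)

lemma graded_hom_mult:
  assumes "graded_hom ds es A" "graded_hom cs ds B"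
  shows "graded_hom cs es (A * B)"
  unfolding graded_hom_iff
proof (intro conjI allI impI)
  note A = graded_hom_carrier[OF assms(1)] and B = graded_hom_carrier[OF assms(2)]
  show "A * B \<in> carrier_mat (length es) (length cs)" using A B by simp
  fix k l assume kl: "k < length es" "l < length cs"
  have "homog (cs ! l - es ! k) (A $$ (k, j) * B $$ (j, l))" if "j < length ds" for j
    using homog_mult[OF graded_hom_homog[OF assms(1) kl(1) that] graded_hom_homog[OF assms(2) that kl(2)]]
    by simp
  then show "homog (cs ! l - es ! k) ((A * B) $$ (k, l))"
    by (subst index_mult_mat_sum[OF A B kl]) (auto intro!: homog_sum)
qed

text \<open>The component of degree d in the graded free module with twists \<open>es\<close>: its
  k-th basis vector has degree \<open>es ! k\<close>, so the k-th coordinate is cut down to degree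
  \<open>d - es ! k\<close>.\<close>

definition vhpart :: "int \<Rightarrow> int list \<Rightarrow> ('v::finite, 'k::zero) mpoly vec \<Rightarrow> ('v, 'k) mpoly vec" where
  "vhpart d es v = vec (length es) (\<lambda>k. hpart (d - es ! k) (v $ k))"

lemma vhpart_carrier [simp]: "vhpart d es v \<in> carrier_vec (length es)"
  by (simp add: vhpart_def)

lemma vhpart_zero: "vhpart d es (0\<^sub>v (length es)) = 0\<^sub>v (length es)"
  by (auto simp: vhpart_def hpart_def)

lemma vhpart_mult:
  assumes "graded_hom ds es A" "v \<in> carrier_vec (length ds)"
  shows "vhpart d es (A *\<^sub>v v) = A *\<^sub>v vhpart d ds v"
proof (rule eq_vecI)
  note A = graded_hom_carrier[OF assms(1)]
  show "dim_vec (vhpart d es (A *\<^sub>v v)) = dim_vec (A *\<^sub>v vhpart d ds v)" using A by (simp add: vhpart_def)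
  fix k assume "k < dim_vec (A *\<^sub>v vhpart d ds v)"
  then have k: "k < length es" using A by simp
  have "vhpart d es (A *\<^sub>v v) $ k = (\<Sum>j\<in>{0..<length ds}. hpart (d - es ! k) (A $$ (k, j) * v $ j))"
    using k index_mult_mat_vec_sum[OF A assms(2) k]
    by (simp add: vhpart_def) (simp add: hpart_def restrict_keys_sum)
  also have "\<dots> = (\<Sum>j\<in>{0..<length ds}. A $$ (k, j) * vhpart d ds v $ j)"
  proof (rule sum.cong[OF refl])
    fix j assume "j \<in> {0..<length ds}"
    then have "j < length ds" by simp
    then show "hpart (d - es ! k) (A $$ (k, j) * v $ j) = A $$ (k, j) * vhpart d ds v $ j"
      using hpart_mult[OF graded_hom_homog[OF assms(1) k, of j], of "d - es ! k" "v $ j"]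
      by (simp add: vhpart_def)
  qed
  also have "\<dots> = (A *\<^sub>v vhpart d ds v) $ k" using index_mult_mat_vec_sum[OF A vhpart_carrier k] by simp
  finally show "vhpart d es (A *\<^sub>v v) $ k = (A *\<^sub>v vhpart d ds v) $ k" .
qed

lemma mat_imageI: "A \<in> carrier_mat n m \<Longrightarrow> v \<in> carrier_vec m \<Longrightarrow> A *\<^sub>v v \<in> mat_image A"
  unfolding mat_image_def by auto

lemma mat_imageE:
  assumes "w \<in> mat_image A" "A \<in> carrier_mat n m"
  obtains v where "v \<in> carrier_vec m" "w = A *\<^sub>v v"
  using assms unfolding mat_image_def by auto

lemma mult_mat_unit_vec:
  fixes A :: "'a::comm_ring_1 mat"
  assumes "A \<in> carrier_mat n m" "l < m"
  shows "A *\<^sub>v unit_vec m l = col A l"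
  using assms by (intro eq_vecI) auto

text \<open>This is projectivity of graded free modules. Any preimage of the l-th column of
  \<open>B\<close> can be replaced by its component of degree \<open>cs ! l\<close>, because the
  column itself is homogeneous of that degree and \<open>A\<close> preserves degrees.\<close>

lemma graded_lift:
  assumes "graded_hom ds es A" "graded_hom cs es B" "mat_image B \<subseteq> mat_image A"
  shows "\<exists>X. graded_hom cs ds X \<and> A * X = B"
proof -
  note A = graded_hom_carrier[OF assms(1)] and B = graded_hom_carrier[OF assms(2)]
  have "\<exists>w. w \<in> carrier_vec (length ds) \<and> A *\<^sub>v w = col B l \<and>
      (\<forall>j < length ds. homog (cs ! l - ds ! j) (w $ j))" if l: "l < length cs" for l
  proof -
    have "col B l \<in> mat_image A"
      using assms(3) mat_imageI[OF B, of "unit_vec (length cs) l"] mult_mat_unit_vec[OF B l] by auto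
    then obtain v where v: "v \<in> carrier_vec (length ds)" "col B l = A *\<^sub>v v"
      by (rule mat_imageE[OF _ A])
    have "vhpart (cs ! l) es (col B l) = col B l"
      using B l graded_hom_homog[OF assms(2)] by (intro eq_vecI) (auto simp: vhpart_def hpart_id)
    then have "A *\<^sub>v vhpart (cs ! l) ds v = col B l"
      using vhpart_mult[OF assms(1) v(1), of "cs ! l"] v(2) by simp
    then show ?thesis by (intro exI[of _ "vhpart (cs ! l) ds v"]) (simp add: vhpart_def homog_hpart)
  qed
  then obtain w where w: "\<And>l. l < length cs \<Longrightarrow> w l \<in> carrier_vec (length ds)"
    "\<And>l. l < length cs \<Longrightarrow> A *\<^sub>v w l = col B l"
    "\<And>l j. l < length cs \<Longrightarrow> j < length ds \<Longrightarrow> homog (cs ! l - ds ! j) (w l $ j)" by metis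
  define X where "X = mat (length ds) (length cs) (\<lambda>(j, l). w l $ j)"
  have X: "X \<in> carrier_mat (length ds) (length cs)" by (simp add: X_def)
  have colX: "col X l = w l" if "l < length cs" for l
    using that w(1)[OF that] by (intro eq_vecI) (auto simp: X_def)
  have "graded_hom cs ds X" using w(3) by (simp add: graded_hom_iff X_def)
  moreover have "A * X = B"
  proof (rule mat_col_eqI)
    fix l assume "l < dim_col B"
    then have l: "l < length cs" using B by simp
    show "col (A * X) l = col B l" unfolding col_mult2[OF A X l] colX[OF l] by (rule w(2)[OF l])
  qed (use A B X in simp_all)
  ultimately show ?thesis by blast
qed

section \<open>Comparison of resolutions\<close>

lemma smult_mult_mat_vec:
  fixes A :: "'a::comm_ring_1 mat"
  assumes "A \<in> carrier_mat n m" "v \<in> carrier_vec m"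
  shows "A *\<^sub>v (c \<cdot>\<^sub>v v) = c \<cdot>\<^sub>v (A *\<^sub>v v)"
proof (rule eq_vecI)
  show "dim_vec (A *\<^sub>v (c \<cdot>\<^sub>v v)) = dim_vec (c \<cdot>\<^sub>v (A *\<^sub>v v))" using assms by simp
  fix i assume "i < dim_vec (c \<cdot>\<^sub>v (A *\<^sub>v v))"
  then have i: "i < n" using assms by simp
  show "(A *\<^sub>v (c \<cdot>\<^sub>v v)) $ i = (c \<cdot>\<^sub>v (A *\<^sub>v v)) $ i"
    using i assms by simp
qed

lemma mult_mat_zero_vec:
  fixes A :: "'a::comm_ring_1 mat"
  shows "A \<in> carrier_mat n m \<Longrightarrow> A *\<^sub>v 0\<^sub>v m = 0\<^sub>v n"
  by (intro eq_vecI) auto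

lemma vec_add_minus_cancel:
  fixes x y :: "'a::ab_group_add vec"
  assumes "x \<in> carrier_vec n" "y \<in> carrier_vec n"
  shows "x + y - x - y = 0\<^sub>v n"
  using assms by (intro eq_vecI) auto

lemma one_mat_split:
  fixes X Y :: "'a::comm_ring_1 mat"
  assumes "X \<in> carrier_mat n n" "Y \<in> carrier_mat n n"
  shows "1\<^sub>m n = X + (1\<^sub>m n - X - Y) + Y"
  using assms by (intro eq_matI) auto

definition hcat :: "'a::zero mat \<Rightarrow> 'a mat \<Rightarrow> 'a mat" where
  "hcat A B = mat (dim_row A) (dim_col A + dim_col B)
     (\<lambda>(i, j). if j < dim_col A then A $$ (i, j) else B $$ (i, j - dim_col A))"

lemma hcat_carrier: "A \<in> carrier_mat n m \<Longrightarrow> B \<in> carrier_mat n k \<Longrightarrow> hcat A B \<in> carrier_mat n (m + k)"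
  by (simp add: hcat_def)

lemma hcat_mult_vec:
  fixes A B :: "'a::comm_ring_1 mat"
  assumes "A \<in> carrier_mat n m" "B \<in> carrier_mat n k" "v \<in> carrier_vec m" "w \<in> carrier_vec k"
  shows "hcat A B *\<^sub>v (v @\<^sub>v w) = A *\<^sub>v v + B *\<^sub>v w"
proof (rule eq_vecI)
  show "dim_vec (hcat A B *\<^sub>v (v @\<^sub>v w)) = dim_vec (A *\<^sub>v v + B *\<^sub>v w)"
    using assms by (simp add: hcat_def)
  fix i assume "i < dim_vec (A *\<^sub>v v + B *\<^sub>v w)"
  then have i: "i < n" using assms by simp
  have r: "row (hcat A B) i = row A i @\<^sub>v row B i"
    using assms i by (intro eq_vecI) (auto simp: hcat_def)
  show "(hcat A B *\<^sub>v (v @\<^sub>v w)) $ i = (A *\<^sub>v v + B *\<^sub>v w) $ i"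
    using assms i scalar_prod_append[of "row A i" m "row B i" k v w]
    by (simp add: r hcat_def[THEN arg_cong[of _ _ dim_row]])
qed

lemma graded_hom_hcat:
  assumes "graded_hom ds es A" "graded_hom ds' es B"
  shows "graded_hom (ds @ ds') es (hcat A B)"
  unfolding graded_hom_iff
proof (intro conjI allI impI)
  note A = graded_hom_carrier[OF assms(1)] and B = graded_hom_carrier[OF assms(2)]
  show "hcat A B \<in> carrier_mat (length es) (length (ds @ ds'))" using hcat_carrier[OF A B] by simp
  fix k l assume kl: "k < length es" "l < length (ds @ ds')"
  show "homog ((ds @ ds') ! l - es ! k) (hcat A B $$ (k, l))"
  proof (cases "l < length ds")
    case True
    then show ?thesis using graded_hom_homog[OF assms(1) kl(1) True] kl A B
      by (simp add: hcat_def nth_append)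
  next
    case False
    then have "l - length ds < length ds'" using kl by simp
    from graded_hom_homog[OF assms(2) kl(1) this] show ?thesis using False kl A B
      by (simp add: hcat_def nth_append)
  qed
qed

text \<open>A homotopy equivalence between two resolutions is built one degree at a time: \<open>K\<close> and \<open>L\<close> are
  the syzygy modules that remain to be resolved, and \<open>\<kappa>\<close> is the part of \<open>1 - b a\<close> that the
  next homotopy has to absorb.\<close>

definition comparison ::
  "int list \<Rightarrow> int list \<Rightarrow> ('v::finite, 'k::field) mpoly vec set \<Rightarrow> ('v, 'k) mpoly vec set \<Rightarrow>
   ('v, 'k) mpoly mat \<Rightarrow> ('v, 'k) mpoly mat \<Rightarrow> ('v, 'k) mpoly mat \<Rightarrow> bool" where
  "comparison ds es K L a b \<kappa> \<longleftrightarrow>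
     graded_hom ds es a \<and> graded_hom es ds b \<and> graded_hom ds ds \<kappa> \<and>
     (\<forall>z\<in>K. a *\<^sub>v z \<in> L) \<and> (\<forall>z\<in>L. b *\<^sub>v z \<in> K) \<and> mat_image \<kappa> \<subseteq> K \<and>
     (\<forall>z\<in>K. z = b *\<^sub>v (a *\<^sub>v z) + \<kappa> *\<^sub>v z)"

text \<open>Here \<open>a'\<close> lifts \<open>a * \<phi>\<close> along \<open>\<psi>\<close>,
  while \<open>b'\<close> lifts \<open>b * \<psi>\<close> and \<open>h\<close> lifts
  \<open>\<kappa>\<close> along \<open>\<phi>\<close>. The new remainder is
  \<open>\<kappa>' = 1 - b' * a' - h * \<phi>\<close>. Applying \<open>\<phi>\<close> to it gives
  \<open>\<phi> - b * a * \<phi> - \<kappa> * \<phi>\<close>, which vanishes by the old identity on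
  the image of \<open>\<phi>\<close>. On the kernel of \<open>\<phi>\<close> the homotopy term
  \<open>h * \<phi>\<close> drops out, so the identity holds again with the new maps.\<close>

lemma comparison_step:
  fixes \<phi> \<psi> :: "('v::finite, 'k::field) mpoly mat"
  assumes comp: "comparison ds es (mat_image \<phi>) (mat_image \<psi>) a b \<kappa>"
    and \<phi>: "graded_hom ds' ds \<phi>" and \<psi>: "graded_hom es' es \<psi>"
  shows "\<exists>a' b' \<kappa>' h. comparison ds' es' (mat_kernel \<phi>) (mat_kernel \<psi>) a' b' \<kappa>' \<and>
     graded_hom ds ds' h \<and> \<phi> * h = \<kappa> \<and> 1\<^sub>m (length ds') = b' * a' + \<kappa>' + h * \<phi>"
proof -
  note c = comp[unfolded comparison_def]
  from c have a: "graded_hom ds es a" and b: "graded_hom es ds b" and \<kappa>: "graded_hom ds ds \<kappa>" by simp_all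
  note Ca = graded_hom_carrier[OF a] and Cb = graded_hom_carrier[OF b]
    and C\<kappa> = graded_hom_carrier[OF \<kappa>] and C\<phi> = graded_hom_carrier[OF \<phi>] and C\<psi> = graded_hom_carrier[OF \<psi>]
  have "mat_image (a * \<phi>) \<subseteq> mat_image \<psi>"
  proof
    fix w assume "w \<in> mat_image (a * \<phi>)"
    then obtain v where v: "v \<in> carrier_vec (length ds')" "w = (a * \<phi>) *\<^sub>v v"
      by (rule mat_imageE[OF _ mult_carrier_mat[OF Ca C\<phi>]])
    then have "w = a *\<^sub>v (\<phi> *\<^sub>v v)" using Ca C\<phi> by simp
    then show "w \<in> mat_image \<psi>" using c mat_imageI[OF C\<phi> v(1)] by simp
  qed
  then obtain a' where a': "graded_hom ds' es' a'" "\<psi> * a' = a * \<phi>"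
    using graded_lift[OF \<psi> graded_hom_mult[OF a \<phi>]] by blast
  have "mat_image (b * \<psi>) \<subseteq> mat_image \<phi>"
  proof
    fix w assume "w \<in> mat_image (b * \<psi>)"
    then obtain v where v: "v \<in> carrier_vec (length es')" "w = (b * \<psi>) *\<^sub>v v"
      by (rule mat_imageE[OF _ mult_carrier_mat[OF Cb C\<psi>]])
    then have "w = b *\<^sub>v (\<psi> *\<^sub>v v)" using Cb C\<psi> by simp
    then show "w \<in> mat_image \<phi>" using c mat_imageI[OF C\<psi> v(1)] by simp
  qed
  then obtain b' where b': "graded_hom es' ds' b'" "\<phi> * b' = b * \<psi>"
    using graded_lift[OF \<phi> graded_hom_mult[OF b \<psi>]] by blast
  have "mat_image \<kappa> \<subseteq> mat_image \<phi>" using c by simp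
  then obtain h where h: "graded_hom ds ds' h" "\<phi> * h = \<kappa>"
    using graded_lift[OF \<phi> \<kappa>] by blast
  note Ca' = graded_hom_carrier[OF a'(1)] and Cb' = graded_hom_carrier[OF b'(1)]
    and Ch = graded_hom_carrier[OF h(1)]
  define \<kappa>' where "\<kappa>' = 1\<^sub>m (length ds') - b' * a' - h * \<phi>"
  have g\<kappa>': "graded_hom ds' ds' \<kappa>'"
    unfolding \<kappa>'_def by (intro graded_hom_minus graded_hom_one graded_hom_mult[OF b'(1) a'(1)] graded_hom_mult[OF h(1) \<phi>])
  note C\<kappa>' = graded_hom_carrier[OF g\<kappa>']
  have \<kappa>'v: "\<kappa>' *\<^sub>v v = v - b' *\<^sub>v (a' *\<^sub>v v) - h *\<^sub>v (\<phi> *\<^sub>v v)" if "v \<in> carrier_vec (length ds')" for v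
  proof -
    note C = mult_carrier_mat[OF Cb' Ca'] mult_carrier_mat[OF Ch C\<phi>]
    have "\<kappa>' *\<^sub>v v = (1\<^sub>m (length ds') - b' * a') *\<^sub>v v - (h * \<phi>) *\<^sub>v v"
      unfolding \<kappa>'_def by (rule minus_mult_distrib_mat_vec[OF minus_carrier_mat[OF C(1)] C(2) that])
    also have "(1\<^sub>m (length ds') - b' * a') *\<^sub>v v = 1\<^sub>m (length ds') *\<^sub>v v - (b' * a') *\<^sub>v v"
      by (rule minus_mult_distrib_mat_vec[OF one_carrier_mat C(1) that])
    finally show ?thesis using Ca' Cb' Ch C\<phi> that by simp
  qed
  have sq_a: "\<psi> *\<^sub>v (a' *\<^sub>v v) = a *\<^sub>v (\<phi> *\<^sub>v v)" if "v \<in> carrier_vec (length ds')" for v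
    using arg_cong[OF a'(2), of "\<lambda>M. M *\<^sub>v v"] Ca' C\<psi> Ca C\<phi> that by simp
  have sq_b: "\<phi> *\<^sub>v (b' *\<^sub>v v) = b *\<^sub>v (\<psi> *\<^sub>v v)" if "v \<in> carrier_vec (length es')" for v
    using arg_cong[OF b'(2), of "\<lambda>M. M *\<^sub>v v"] Cb' C\<psi> Cb C\<phi> that by simp
  have sq_h: "\<phi> *\<^sub>v (h *\<^sub>v v) = \<kappa> *\<^sub>v v" if "v \<in> carrier_vec (length ds)" for v
    using arg_cong[OF h(2), of "\<lambda>M. M *\<^sub>v v"] Ch C\<phi> that by simp
  have im: "mat_image \<kappa>' \<subseteq> mat_kernel \<phi>"
  proof
    fix w assume "w \<in> mat_image \<kappa>'"
    then obtain v where v: "v \<in> carrier_vec (length ds')" "w = \<kappa>' *\<^sub>v v" by (rule mat_imageE[OF _ C\<kappa>'])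
    have av: "a' *\<^sub>v v \<in> carrier_vec (length es')" using Ca' v by simp
    have bav: "b' *\<^sub>v (a' *\<^sub>v v) \<in> carrier_vec (length ds')" using Cb' av by simp
    have \<phi>v: "\<phi> *\<^sub>v v \<in> carrier_vec (length ds)" using C\<phi> v by simp
    have hv: "h *\<^sub>v (\<phi> *\<^sub>v v) \<in> carrier_vec (length ds')" using Ch \<phi>v by simp
    have "\<phi> *\<^sub>v w = \<phi> *\<^sub>v v - \<phi> *\<^sub>v (b' *\<^sub>v (a' *\<^sub>v v)) - \<phi> *\<^sub>v (h *\<^sub>v (\<phi> *\<^sub>v v))"
      unfolding v(2) \<kappa>'v[OF v(1)] using v(1) bav hv
      by (subst mult_minus_distrib_mat_vec[OF C\<phi>], simp, simp)
         (subst mult_minus_distrib_mat_vec[OF C\<phi>], simp_all)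
    also have "\<dots> = \<phi> *\<^sub>v v - b *\<^sub>v (a *\<^sub>v (\<phi> *\<^sub>v v)) - \<kappa> *\<^sub>v (\<phi> *\<^sub>v v)"
      by (simp only: sq_b[OF av] sq_a[OF v(1)] sq_h[OF \<phi>v])
    also have "\<dots> = 0\<^sub>v (length ds)"
    proof -
      let ?z = "\<phi> *\<^sub>v v"
      have z: "?z = b *\<^sub>v (a *\<^sub>v ?z) + \<kappa> *\<^sub>v ?z" using c mat_imageI[OF C\<phi> v(1)] by blast
      have "b *\<^sub>v (a *\<^sub>v ?z) \<in> carrier_vec (length ds)" "\<kappa> *\<^sub>v ?z \<in> carrier_vec (length ds)"
        using Ca Cb C\<kappa> \<phi>v by simp_all
      then have "b *\<^sub>v (a *\<^sub>v ?z) + \<kappa> *\<^sub>v ?z - b *\<^sub>v (a *\<^sub>v ?z) - \<kappa> *\<^sub>v ?z = 0\<^sub>v (length ds)"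
        by (rule vec_add_minus_cancel)
      then show ?thesis using z by simp
    qed
    finally show "w \<in> mat_kernel \<phi>"
      using C\<phi> C\<kappa>' v by (intro mat_kernelI[OF C\<phi>]) simp_all
  qed
  have "comparison ds' es' (mat_kernel \<phi>) (mat_kernel \<psi>) a' b' \<kappa>'"
    unfolding comparison_def
  proof (intro conjI ballI)
    show "a' *\<^sub>v z \<in> mat_kernel \<psi>" if "z \<in> mat_kernel \<phi>" for z
    proof (rule mat_kernelI[OF C\<psi>])
      note z = mat_kernelD[OF C\<phi> that]
      show "a' *\<^sub>v z \<in> carrier_vec (length es')" using Ca' z by simp
      show "\<psi> *\<^sub>v (a' *\<^sub>v z) = 0\<^sub>v (length es)" using sq_a[OF z(1)] z(2) mult_mat_zero_vec[OF Ca] by simp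
    qed
    show "b' *\<^sub>v z \<in> mat_kernel \<phi>" if "z \<in> mat_kernel \<psi>" for z
    proof (rule mat_kernelI[OF C\<phi>])
      note z = mat_kernelD[OF C\<psi> that]
      show "b' *\<^sub>v z \<in> carrier_vec (length ds')" using Cb' z by simp
      show "\<phi> *\<^sub>v (b' *\<^sub>v z) = 0\<^sub>v (length ds)" using sq_b[OF z(1)] z(2) mult_mat_zero_vec[OF Cb] by simp
    qed
    show "z = b' *\<^sub>v (a' *\<^sub>v z) + \<kappa>' *\<^sub>v z" if "z \<in> mat_kernel \<phi>" for z
    proof -
      note z = mat_kernelD[OF C\<phi> that]
      have "a' *\<^sub>v z \<in> carrier_vec (length es')" using Ca' z by simp
      then have "b' *\<^sub>v (a' *\<^sub>v z) \<in> carrier_vec (length ds')" using Cb' by simp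
      moreover have "h *\<^sub>v 0\<^sub>v (length ds) = 0\<^sub>v (length ds')" by (rule mult_mat_zero_vec[OF Ch])
      ultimately show ?thesis using z(1) Cb' unfolding \<kappa>'v[OF z(1)] z(2) by (intro eq_vecI) auto
    qed
  qed (use a' b' g\<kappa>' im in auto)
  moreover have "1\<^sub>m (length ds') = b' * a' + \<kappa>' + h * \<phi>"
  proof -
    have "b' * a' \<in> carrier_mat (length ds') (length ds')" "h * \<phi> \<in> carrier_mat (length ds') (length ds')"
      using Ca' Cb' Ch C\<phi> by simp_all
    then show ?thesis unfolding \<kappa>'_def by (rule one_mat_split)
  qed
  ultimately show ?thesis using h by blast
qed

text \<open>This takes the place of the Hilbert basis theorem. Each z in \<open>K\<close> equals b(a
  z) + \<open>\<kappa>\<close> z, and a z is a combination of the columns of \<open>\<psi>'\<close>;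
  hence the columns of \<open>b * \<psi>'\<close> and of \<open>\<kappa>\<close> generate
  \<open>K\<close>. Finite generation of one syzygy module is thus transferred to another.\<close>

lemma comparison_finitely_generated:
  fixes \<psi>' :: "('v::finite, 'k::field) mpoly mat"
  assumes comp: "comparison ds es K (mat_image \<psi>') a b \<kappa>" and \<psi>': "graded_hom es' es \<psi>'"
    and K: "K \<subseteq> carrier_vec (length ds)" "\<And>x y. x \<in> K \<Longrightarrow> y \<in> K \<Longrightarrow> x + y \<in> K"
  shows "\<exists>cs X. graded_hom cs ds X \<and> mat_image X = K"
proof (intro exI conjI)
  note c = comp[unfolded comparison_def]
  from c have a: "graded_hom ds es a" and b: "graded_hom es ds b" and \<kappa>: "graded_hom ds ds \<kappa>" by simp_all
  note Ca = graded_hom_carrier[OF a] and Cb = graded_hom_carrier[OF b]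
    and C\<kappa> = graded_hom_carrier[OF \<kappa>] and C\<psi>' = graded_hom_carrier[OF \<psi>']
  let ?X = "hcat (b * \<psi>') \<kappa>"
  show "graded_hom (es' @ ds) ds ?X" by (intro graded_hom_hcat graded_hom_mult[OF b \<psi>'] \<kappa>)
  note Cb\<psi> = mult_carrier_mat[OF Cb C\<psi>']
  note CX = hcat_carrier[OF Cb\<psi> C\<kappa>]
  show "mat_image ?X = K"
  proof
    show "mat_image ?X \<subseteq> K"
    proof
      fix w assume "w \<in> mat_image ?X"
      then obtain v where v: "v \<in> carrier_vec (length es' + length ds)" "w = ?X *\<^sub>v v"
        by (rule mat_imageE[OF _ CX])
      define v1 v2 where "v1 = vec_first v (length es')" and "v2 = vec_last v (length ds)"
      have v12: "v = v1 @\<^sub>v v2" "v1 \<in> carrier_vec (length es')" "v2 \<in> carrier_vec (length ds)"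
        using v(1) by (simp_all add: v1_def v2_def)
      have "w = (b * \<psi>') *\<^sub>v v1 + \<kappa> *\<^sub>v v2"
        unfolding v(2) v12(1) by (rule hcat_mult_vec[OF Cb\<psi> C\<kappa> v12(2,3)])
      also have "(b * \<psi>') *\<^sub>v v1 = b *\<^sub>v (\<psi>' *\<^sub>v v1)" using Cb C\<psi>' v12 by simp
      finally show "w \<in> K"
        using c mat_imageI[OF C\<psi>' v12(2)] mat_imageI[OF C\<kappa> v12(3)] K(2) by auto
    qed
    show "K \<subseteq> mat_image ?X"
    proof
      fix z assume z: "z \<in> K"
      then have Cz: "z \<in> carrier_vec (length ds)" using K(1) by auto
      have "a *\<^sub>v z \<in> mat_image \<psi>'" using c z by auto
      then obtain w where w: "w \<in> carrier_vec (length es')" "a *\<^sub>v z = \<psi>' *\<^sub>v w"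
        by (rule mat_imageE[OF _ C\<psi>'])
      have "z = b *\<^sub>v (\<psi>' *\<^sub>v w) + \<kappa> *\<^sub>v z" using c z w(2) by auto
      also have "\<dots> = ?X *\<^sub>v (w @\<^sub>v z)"
        using hcat_mult_vec[OF Cb\<psi> C\<kappa> w(1) Cz] Cb C\<psi>' w by simp
      finally show "z \<in> mat_image ?X"
        using mat_imageI[OF CX, of "w @\<^sub>v z"] w(1) Cz by auto
    qed
  qed
qed

text \<open>In a resolution the kernel of one map is the image of the next, so this is minimality of
  the next differential. Stated through the kernel, it can be arranged before the next map has been
  chosen.\<close>

definition minimal_kernel :: "('v::finite, 'k::field) mpoly mat \<Rightarrow> bool" where
  "minimal_kernel A \<longleftrightarrow> (\<forall>z\<in>mat_kernel A. \<forall>l < dim_col A. z $ l \<in> irrelevant_ideal)"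

text \<open>A relation whose l-th coefficient has a nonzero constant term yields a homogeneous
  relation whose l-th coefficient is 1. The l-th column is then a combination of the others and can
  be deleted without changing the image.\<close>

lemma drop_redundant_generator:
  fixes A :: "('v::finite, 'k::field) mpoly mat"
  assumes A: "graded_hom ds es A" and z: "z \<in> mat_kernel A" and l: "l < length ds"
    and nz: "z $ l \<notin> irrelevant_ideal"
  shows "\<exists>ds' A'. graded_hom ds' es A' \<and> length ds' < length ds \<and> mat_image A' = mat_image A"
proof -
  note CA = graded_hom_carrier[OF A]
  note Cz = mat_kernelD[OF CA z]
  define n where "n = length ds"
  define c where "c = Poly_Mapping.lookup (z $ l) 0"
  \<comment> \<open>In degree \<open>ds ! l\<close> the l-th coordinate has degree 0, so it is the
    constant term c of \<open>z $ l\<close>. Division by c normalises it to 1.\<close>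
  define y where "y = Poly_Mapping.single 0 (1 / c) \<cdot>\<^sub>v vhpart (ds ! l) ds z"
  have Cy: "y \<in> carrier_vec n" by (simp add: y_def n_def)
  have Ay: "A *\<^sub>v y = 0\<^sub>v (length es)"
  proof -
    have "A *\<^sub>v vhpart (ds ! l) ds z = 0\<^sub>v (length es)"
      using vhpart_mult[OF A Cz(1), of "ds ! l"] Cz(2) by (simp add: vhpart_zero)
    then show ?thesis unfolding y_def using smult_mult_mat_vec[OF CA vhpart_carrier] by (auto intro!: eq_vecI)
  qed
  have yl: "y $ l = 1"
    using nz l by (simp add: y_def vhpart_def hpart_0 mult_single c_def irrelevant_ideal_def)
  define skip where "skip j = (if j < l then j else Suc j)" for j
  have ln: "l < n" using l by (simp add: n_def)
  have bij: "bij_betw skip {0..<n - 1} ({0..<n} - {l})"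
    unfolding bij_betw_def
  proof
    show "inj_on skip {0..<n - 1}" by (rule inj_onI) (simp add: skip_def split: if_splits)
    show "skip ` {0..<n - 1} = {0..<n} - {l}"
    proof
      show "skip ` {0..<n - 1} \<subseteq> {0..<n} - {l}" using ln by (auto simp: skip_def)
      show "{0..<n} - {l} \<subseteq> skip ` {0..<n - 1}"
      proof
        fix x assume x: "x \<in> {0..<n} - {l}"
        show "x \<in> skip ` {0..<n - 1}"
        proof (rule image_eqI)
          show "x = skip (if x < l then x else x - 1)" "(if x < l then x else x - 1) \<in> {0..<n - 1}"
            using x ln unfolding skip_def by (auto split: if_splits)
        qed
      qed
    qed
  qed
  define ds' where "ds' = map (\<lambda>j. ds ! skip j) [0..<n - 1]"
  define A' where "A' = mat (length es) (n - 1) (\<lambda>(k, j). A $$ (k, skip j))"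
  have len: "length ds' = n - 1" by (simp add: ds'_def)
  have CA': "A' \<in> carrier_mat (length es) (n - 1)" by (simp add: A'_def)
  have skip_lt: "skip j < n" if "j < n - 1" for j using ln that less_diff_conv[of j n 1] unfolding skip_def by auto
  have key: "A *\<^sub>v u = A' *\<^sub>v vec (n - 1) (\<lambda>j. u $ skip j)"
    if u: "u \<in> carrier_vec n" "u $ l = 0" for u
  proof (rule eq_vecI)
    show "dim_vec (A *\<^sub>v u) = dim_vec (A' *\<^sub>v vec (n - 1) (\<lambda>j. u $ skip j))" using CA CA' by simp
    fix k assume "k < dim_vec (A' *\<^sub>v vec (n - 1) (\<lambda>j. u $ skip j))"
    then have k: "k < length es" using CA' by simp
    have "(A *\<^sub>v u) $ k = (\<Sum>j\<in>{0..<n}. A $$ (k, j) * u $ j)"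
      using index_mult_mat_vec_sum[OF CA _ k] u(1) by (simp add: n_def)
    also have "\<dots> = A $$ (k, l) * u $ l + (\<Sum>j\<in>{0..<n} - {l}. A $$ (k, j) * u $ j)"
      using ln by (intro sum.remove) auto
    also have "\<dots> = (\<Sum>j\<in>{0..<n} - {l}. A $$ (k, j) * u $ j)" using u(2) by simp
    also have "\<dots> = (\<Sum>j\<in>{0..<n - 1}. A $$ (k, skip j) * u $ skip j)"
      by (rule sum.reindex_bij_betw[OF bij, symmetric])
    also have "\<dots> = (\<Sum>j\<in>{0..<n - 1}. A' $$ (k, j) * vec (n - 1) (\<lambda>j. u $ skip j) $ j)"
      using k by (intro sum.cong) (auto simp: A'_def)
    also have "\<dots> = (A' *\<^sub>v vec (n - 1) (\<lambda>j. u $ skip j)) $ k"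
      by (rule index_mult_mat_vec_sum[OF CA' _ k, symmetric]) simp
    finally show "(A *\<^sub>v u) $ k = (A' *\<^sub>v vec (n - 1) (\<lambda>j. u $ skip j)) $ k" .
  qed
  have "graded_hom ds' es A'"
    unfolding graded_hom_iff
  proof (intro conjI allI impI)
    show "A' \<in> carrier_mat (length es) (length ds')" using CA' len by simp
    fix k j assume kj: "k < length es" "j < length ds'"
    then have "skip j < length ds" using skip_lt len by (simp add: n_def)
    from graded_hom_homog[OF A kj(1) this] show "homog (ds' ! j - es ! k) (A' $$ (k, j))"
      using kj len by (simp add: ds'_def A'_def)
  qed
  moreover have "mat_image A' = mat_image A"
  proof
    show "mat_image A' \<subseteq> mat_image A"
    proof
      fix x assume "x \<in> mat_image A'"
      then obtain w where w: "w \<in> carrier_vec (n - 1)" "x = A' *\<^sub>v w" by (rule mat_imageE[OF _ CA'])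
      define u where "u = vec n (\<lambda>j. if j = l then 0 else w $ (if j < l then j else j - 1))"
      have "vec (n - 1) (\<lambda>j. u $ skip j) = w"
        using w(1) skip_lt by (intro eq_vecI) (auto simp: u_def skip_def)
      then have "x = A *\<^sub>v u" using key[of u] w(2) ln by (simp add: u_def)
      moreover have "u \<in> carrier_vec n" by (simp add: u_def)
      ultimately show "x \<in> mat_image A" using mat_imageI[OF CA, of u] by (simp add: n_def)
    qed
    show "mat_image A \<subseteq> mat_image A'"
    proof
      fix x assume "x \<in> mat_image A"
      then obtain v where v: "v \<in> carrier_vec n" "x = A *\<^sub>v v"
        unfolding n_def by (rule mat_imageE[OF _ CA])
      \<comment> \<open>Subtracting this multiple of the relation \<open>y\<close> kills the l-th
        coordinate and leaves the image under \<open>A\<close> unchanged.\<close>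
      define u where "u = v - v $ l \<cdot>\<^sub>v y"
      have Cu: "u \<in> carrier_vec n" using v Cy by (simp add: u_def)
      have "u $ l = 0" using v(1) Cy yl ln by (simp add: u_def)
      have "A *\<^sub>v u = A *\<^sub>v v - v $ l \<cdot>\<^sub>v (A *\<^sub>v y)"
        unfolding u_def using v(1) Cy CA
        by (subst mult_minus_distrib_mat_vec[OF CA]) (simp_all add: n_def smult_mult_mat_vec[OF CA])
      also have "\<dots> = x" using CA unfolding Ay v(2) by (intro eq_vecI) auto
      finally have "x = A' *\<^sub>v vec (n - 1) (\<lambda>j. u $ skip j)" using key[OF Cu \<open>u $ l = 0\<close>] by simp
      then show "x \<in> mat_image A'" using mat_imageI[OF CA', of "vec (n - 1) (\<lambda>j. u $ skip j)"] by simp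
    qed
  qed
  ultimately show ?thesis using len ln by (intro exI[of _ ds'] exI[of _ A']) (simp add: n_def)
qed

text \<open>Every deletion of a redundant column shortens the list of twists, so the process ends,
  and it ends only when no relation has a coefficient with a nonzero constant term.\<close>

lemma minimal_generators:
  fixes X :: "('v::finite, 'k::field) mpoly mat"
  assumes "graded_hom cs es X"
  shows "\<exists>ds A. graded_hom ds es A \<and> mat_image A = mat_image X \<and> minimal_kernel A"
  using assms
proof (induction "length cs" arbitrary: cs X rule: less_induct)
  case less
  show ?case
  proof (cases "minimal_kernel X")
    case True then show ?thesis using less.prems by blast
  next
    case False
    then obtain z l where "z \<in> mat_kernel X" "l < length cs" "z $ l \<notin> irrelevant_ideal"
      using graded_hom_carrier[OF less.prems] unfolding minimal_kernel_def by auto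
    from drop_redundant_generator[OF less.prems this] obtain ds' A'
      where "graded_hom ds' es A'" "length ds' < length cs" "mat_image A' = mat_image X" by blast
    then show ?thesis using less.hyps[of ds' A'] by metis
  qed
qed

text \<open>The resolved object is a submodule \<open>K\<close> of a graded free module with
  arbitrary twists \<open>es\<close>. Mapping cones need this generality, since they involve shifted
  ideals and direct sums of ideals.\<close>

definition resolution ::
  "int list \<Rightarrow> ('v::finite, 'k::field) mpoly vec set \<Rightarrow> (nat \<Rightarrow> int list) \<Rightarrow> (nat \<Rightarrow> ('v, 'k) mpoly mat) \<Rightarrow> bool" where
  "resolution es K D \<phi> \<longleftrightarrow>
     graded_hom (D 0) es (\<phi> 0) \<and> (\<forall>i. graded_hom (D (Suc i)) (D i) (\<phi> (Suc i))) \<and>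
     mat_image (\<phi> 0) = K \<and> (\<forall>i. mat_image (\<phi> (Suc i)) = mat_kernel (\<phi> i))"

definition ideal_vecs :: "'a set \<Rightarrow> 'a vec set" where
  "ideal_vecs I = {w \<in> carrier_vec 1. w $ 0 \<in> I}"

text \<open>These are the twists of the target of the i-th map. The augmentation becomes a
  differential like the others, which avoids a case distinction in statements about
  \<open>\<phi> i\<close>.\<close>

definition augmented :: "int list \<Rightarrow> (nat \<Rightarrow> int list) \<Rightarrow> nat \<Rightarrow> int list" where
  "augmented es D i = (case i of 0 \<Rightarrow> es | Suc j \<Rightarrow> D j)"

lemma resolution_graded:
  "resolution es K D \<phi> \<Longrightarrow> graded_hom (D i) (augmented es D i) (\<phi> i)"
  by (cases i) (simp_all add: resolution_def augmented_def)

lemma resolution_image_0: "resolution es K D \<phi> \<Longrightarrow> mat_image (\<phi> 0) = K"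
  by (simp add: resolution_def)

lemma resolution_exact: "resolution es K D \<phi> \<Longrightarrow> mat_image (\<phi> (Suc i)) = mat_kernel (\<phi> i)"
  by (simp add: resolution_def)

lemma resolution_graded_Suc: "resolution es K D \<phi> \<Longrightarrow> graded_hom (D (Suc i)) (D i) (\<phi> (Suc i))"
  by (simp add: resolution_def)

text \<open>The columns of \<open>\<phi> (Suc i)\<close> are images of unit vectors and generate the
  kernel of \<open>\<phi> i\<close>. Hence all matrix entries are irrelevant exactly when all
  coordinates of kernel elements are.\<close>

lemma minimal_free_resolution_iff:
  "minimal_free_resolution I D \<phi> \<longleftrightarrow> resolution [0] (ideal_vecs I) D \<phi> \<and> (\<forall>i. minimal_kernel (\<phi> i))"
proof -
  have "(\<forall>k < length (D i). \<forall>l < length (D (Suc i)). \<phi> (Suc i) $$ (k, l) \<in> irrelevant_ideal)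
      \<longleftrightarrow> minimal_kernel (\<phi> i)" if res: "resolution [0] (ideal_vecs I) D \<phi>" for i
  proof -
    have C0: "\<phi> (Suc i) \<in> carrier_mat (length (D i)) (length (D (Suc i)))"
      by (rule graded_hom_carrier[OF resolution_graded_Suc[OF res]])
    have C1: "\<phi> i \<in> carrier_mat (length (augmented [0] D i)) (length (D i))"
      by (rule graded_hom_carrier[OF resolution_graded[OF res]])
    have ker: "mat_kernel (\<phi> i) = mat_image (\<phi> (Suc i))" using resolution_exact[OF res] by simp
    show ?thesis
    proof
      assume irr: "\<forall>k < length (D i). \<forall>l < length (D (Suc i)). \<phi> (Suc i) $$ (k, l) \<in> irrelevant_ideal"
      show "minimal_kernel (\<phi> i)"
        unfolding minimal_kernel_def ker
      proof (intro ballI allI impI)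
        fix z k assume "z \<in> mat_image (\<phi> (Suc i))" "k < dim_col (\<phi> i)"
        then obtain v where v: "v \<in> carrier_vec (length (D (Suc i)))" "z = \<phi> (Suc i) *\<^sub>v v"
          and k: "k < length (D i)"
          using C1 mat_imageE[OF _ C0] by auto
        show "z $ k \<in> irrelevant_ideal"
          unfolding v(2) index_mult_mat_vec_sum[OF C0 v(1) k]
          using irr k by (intro irrelevant_sum irrelevant_mult_left) auto
      qed
    next
      assume min: "minimal_kernel (\<phi> i)"
      show "\<forall>k < length (D i). \<forall>l < length (D (Suc i)). \<phi> (Suc i) $$ (k, l) \<in> irrelevant_ideal"
      proof (intro allI impI)
        fix k l assume kl: "k < length (D i)" "l < length (D (Suc i))"
        have "col (\<phi> (Suc i)) l \<in> mat_kernel (\<phi> i)"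
          unfolding ker mult_mat_unit_vec[OF C0 kl(2), symmetric] by (rule mat_imageI[OF C0]) simp
        then have "col (\<phi> (Suc i)) l $ k \<in> irrelevant_ideal"
          using min kl(1) C1 unfolding minimal_kernel_def by auto
        then show "\<phi> (Suc i) $$ (k, l) \<in> irrelevant_ideal" using C0 kl by simp
      qed
    qed
  qed
  then show ?thesis
    unfolding minimal_free_resolution_def resolution_def ideal_vecs_def by blast
qed

lemma mat_kernel_add:
  fixes A :: "'a::comm_ring_1 mat"
  assumes "A \<in> carrier_mat n m" "x \<in> mat_kernel A" "y \<in> mat_kernel A"
  shows "x + y \<in> mat_kernel A"
proof (rule mat_kernelI[OF assms(1)])
  note x = mat_kernelD[OF assms(1,2)] and y = mat_kernelD[OF assms(1,3)]
  show "x + y \<in> carrier_vec m" using x y by simp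
  show "A *\<^sub>v (x + y) = 0\<^sub>v n" using mult_add_distrib_mat_vec[OF assms(1) x(1) y(1)] x y by simp
qed

text \<open>The start of every comparison: two resolutions of the same submodule agree below degree
  0, so identities serve as maps and nothing is left to absorb.\<close>

lemma comparison_refl:
  fixes K :: "('v::finite, 'k::field) mpoly vec set"
  assumes "K \<subseteq> carrier_vec (length es)" "0\<^sub>v (length es) \<in> K"
  shows "comparison es es K K (1\<^sub>m (length es)) (1\<^sub>m (length es)) (0\<^sub>m (length es) (length es))"
proof -
  have z: "0\<^sub>m (length es) (length es) *\<^sub>v z = 0\<^sub>v (length es)"
    if "z \<in> carrier_vec (length es)" for z :: "('v, 'k) mpoly vec"
    using that by (intro eq_vecI) auto
  have C: "z \<in> carrier_vec (length es)" if "z \<in> K" for z using assms(1) that by blast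
  have "mat_image (0\<^sub>m (length es) (length es)) \<subseteq> K"
    unfolding mat_image_def using assms(2) z by auto
  then show ?thesis unfolding comparison_def
    using C z by (auto simp: graded_hom_one graded_hom_zero)
qed

lemma mat_image_zero_mem:
  fixes A :: "'a::comm_ring_1 mat"
  assumes "A \<in> carrier_mat n m"
  shows "0\<^sub>v n \<in> mat_image A"
  using mat_imageI[OF assms zero_carrier_vec] mult_mat_zero_vec[OF assms] by simp

lemma mat_image_carrier: "A \<in> carrier_mat n m \<Longrightarrow> mat_image A \<subseteq> carrier_vec n"
  unfolding mat_image_def by auto

text \<open>Minimal generators are chosen for one kernel after another. Along the way a comparison
  with the given resolution is maintained, since this is what makes the next kernel finitely
  generated.\<close>

lemma minimal_resolution_exists:
  fixes \<psi> :: "nat \<Rightarrow> ('v::finite, 'k::field) mpoly mat"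
  assumes res: "resolution es L G \<psi>"
  shows "\<exists>D \<phi>. resolution es L D \<phi> \<and> (\<forall>i. minimal_kernel (\<phi> i))"
proof -
  \<comment> \<open>A state consists of the twists of the target, the twists of the source, and the
    map itself. \<open>P\<close> is the invariant of a single stage, including its comparison with
    stage n of \<open>\<psi>\<close>; \<open>Q\<close> links consecutive stages by
    exactness.\<close>
  define P :: "nat \<Rightarrow> int list \<times> int list \<times> ('v, 'k) mpoly mat \<Rightarrow> bool" where
    "P n = (\<lambda>(ds, ds', \<phi>). graded_hom ds' ds \<phi> \<and> minimal_kernel \<phi> \<and>
       (\<exists>a b \<kappa>. comparison ds (augmented es G n) (mat_image \<phi>) (mat_image (\<psi> n)) a b \<kappa>))" for n
  define Q :: "int list \<times> int list \<times> ('v, 'k) mpoly mat \<Rightarrow> int list \<times> int list \<times> ('v, 'k) mpoly mat \<Rightarrow> bool" where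
    "Q = (\<lambda>(ds, ds', \<phi>) (cs, cs', \<phi>'). cs = ds' \<and> mat_image \<phi>' = mat_kernel \<phi>)"
  note G0 = resolution_graded[OF res, of 0, unfolded augmented_def nat.case]
  note C0 = graded_hom_carrier[OF G0]
  obtain D0 \<phi>0 where D0: "graded_hom D0 es \<phi>0" "mat_image \<phi>0 = L" "minimal_kernel \<phi>0"
    using minimal_generators[OF G0] resolution_image_0[OF res] by auto
  have "P 0 (es, D0, \<phi>0)"
    using D0 comparison_refl[of L es] mat_image_carrier[OF C0] mat_image_zero_mem[OF C0]
      resolution_image_0[OF res]
    by (auto simp: P_def augmented_def)
  moreover have "\<exists>y. P (Suc n) y \<and> Q x y" if Px: "P n x" for n x
  proof -
    obtain ds ds' \<phi> where x: "x = (ds, ds', \<phi>)" by (cases x)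
    from Px obtain a b \<kappa> where g: "graded_hom ds' ds \<phi>"
      and c: "comparison ds (augmented es G n) (mat_image \<phi>) (mat_image (\<psi> n)) a b \<kappa>"
      by (auto simp: P_def x)
    obtain a' b' \<kappa>' where "comparison ds' (G n) (mat_kernel \<phi>) (mat_kernel (\<psi> n)) a' b' \<kappa>'"
      using comparison_step[OF c g resolution_graded[OF res]] by blast
    then have c': "comparison ds' (G n) (mat_kernel \<phi>) (mat_image (\<psi> (Suc n))) a' b' \<kappa>'"
      using resolution_exact[OF res] by simp
    obtain cs X where X: "graded_hom cs ds' X" "mat_image X = mat_kernel \<phi>"
      using comparison_finitely_generated[OF c' resolution_graded_Suc[OF res]
          mat_kernel_carrier[OF graded_hom_carrier[OF g]] mat_kernel_add[OF graded_hom_carrier[OF g]]]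
      by blast
    obtain ds'' \<phi>' where "graded_hom ds'' ds' \<phi>'" "mat_image \<phi>' = mat_image X" "minimal_kernel \<phi>'"
      using minimal_generators[OF X(1)] by blast
    then have "P (Suc n) (ds', ds'', \<phi>') \<and> Q x (ds', ds'', \<phi>')"
      using c' X(2) unfolding P_def Q_def x by (auto simp: augmented_def)
    then show ?thesis by blast
  qed
  ultimately obtain f where f: "\<And>n. P n (f n)" "\<And>n. Q (f n) (f (Suc n))" "f 0 = (es, D0, \<phi>0)"
    using dependent_nat_choice[where P = "\<lambda>n x. P n x \<and> (n = 0 \<longrightarrow> x = (es, D0, \<phi>0))" and Q = "\<lambda>_. Q"]
    by (metis nat.distinct(1))
  let ?D = "\<lambda>n. fst (snd (f n))" and ?\<phi> = "\<lambda>n. snd (snd (f n))"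
  have "resolution es L ?D ?\<phi>"
    unfolding resolution_def
  proof (intro conjI allI)
    show "graded_hom (?D 0) es (?\<phi> 0)" "mat_image (?\<phi> 0) = L" using f(3) D0 by simp_all
    fix i
    have "fst (f (Suc i)) = ?D i" "mat_image (?\<phi> (Suc i)) = mat_kernel (?\<phi> i)"
      using f(2)[of i] by (auto simp: Q_def split: prod.splits)
    moreover have "graded_hom (?D (Suc i)) (fst (f (Suc i))) (?\<phi> (Suc i))"
      using f(1)[of "Suc i"] by (auto simp: P_def split: prod.splits)
    ultimately show "graded_hom (?D (Suc i)) (?D i) (?\<phi> (Suc i))"
      "mat_image (?\<phi> (Suc i)) = mat_kernel (?\<phi> i)" by simp_all
  qed
  moreover have "minimal_kernel (?\<phi> i)" for i
    using f(1)[of i] by (auto simp: P_def split: prod.splits)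
  ultimately show ?thesis by blast
qed

text \<open>The composite of comparison maps from a minimal resolution to another one and back is the
  identity modulo the irrelevant ideal, so the first of them has a unit entry in every column.\<close>

lemma minimal_resolution_twists:
  fixes \<phi> \<psi> :: "nat \<Rightarrow> ('v::finite, 'k::field) mpoly mat"
  assumes F: "resolution es L D \<phi>" and G: "resolution es L G \<psi>"
    and min: "\<And>i. minimal_kernel (\<phi> i)"
  shows "set (D i) \<subseteq> set (G i)"
proof -
  note gF = resolution_graded[OF F] and gG = resolution_graded[OF G]
  have C0: "\<phi> 0 \<in> carrier_mat (length es) (length (D 0))"
    using graded_hom_carrier[OF gF[of 0]] by (simp add: augmented_def)
  \<comment> \<open>The equation \<open>\<kappa> = 0\<close> is recorded for n = 0 because the
    augmentation may have unit entries, as it does for the unit ideal. There the homotopy term must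
    be controlled through \<open>h\<close> and not through \<open>\<phi> 0\<close>.\<close>
  have ex: "\<exists>a b \<kappa>. comparison (augmented es D n) (augmented es G n) (mat_image (\<phi> n)) (mat_image (\<psi> n)) a b \<kappa> \<and>
      (n = 0 \<longrightarrow> \<kappa> = 0\<^sub>m (length es) (length es))" for n
  proof (induction n)
    case 0
    have "L \<subseteq> carrier_vec (length es)" "0\<^sub>v (length es) \<in> L"
      using mat_image_carrier[OF C0] mat_image_zero_mem[OF C0] resolution_image_0[OF F] by simp_all
    then show ?case
      using comparison_refl[of L es] resolution_image_0[OF F] resolution_image_0[OF G]
      by (auto simp: augmented_def)
  next
    case (Suc n)
    then obtain a b \<kappa> where
      "comparison (augmented es D n) (augmented es G n) (mat_image (\<phi> n)) (mat_image (\<psi> n)) a b \<kappa>" by blast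
    from comparison_step[OF this gF gG] show ?case
      by (auto simp: augmented_def resolution_exact[OF F] resolution_exact[OF G])
  qed
  obtain a b \<kappa> where c: "comparison (augmented es D i) (augmented es G i) (mat_image (\<phi> i)) (mat_image (\<psi> i)) a b \<kappa>"
    and \<kappa>0: "i = 0 \<Longrightarrow> \<kappa> = 0\<^sub>m (length es) (length es)" using ex by blast
  obtain a' b' \<kappa>' h where c': "comparison (D i) (G i) (mat_kernel (\<phi> i)) (mat_kernel (\<psi> i)) a' b' \<kappa>'"
    and h: "graded_hom (augmented es D i) (D i) h" "\<phi> i * h = \<kappa>"
    and id: "1\<^sub>m (length (D i)) = b' * a' + \<kappa>' + h * \<phi> i"
    using comparison_step[OF c gF gG] by blast
  from c' have a': "graded_hom (D i) (G i) a'" and b': "graded_hom (G i) (D i) b'"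
    and \<kappa>': "graded_hom (D i) (D i) \<kappa>'" "mat_image \<kappa>' \<subseteq> mat_kernel (\<phi> i)"
    unfolding comparison_def by simp_all
  note Ca = graded_hom_carrier[OF a'] and Cb = graded_hom_carrier[OF b']
    and C\<kappa> = graded_hom_carrier[OF \<kappa>'(1)] and Ch = graded_hom_carrier[OF h(1)]
    and C\<phi> = graded_hom_carrier[OF gF[of i]]
  have irr_col: "M $$ (k, l) \<in> irrelevant_ideal"
    if "M \<in> carrier_mat (length (D j)) m" "mat_image M \<subseteq> mat_kernel (\<phi> j)" "k < length (D j)" "l < m"
    for M m j k l
  proof -
    have "col M l \<in> mat_kernel (\<phi> j)"
      using that(2) mat_imageI[OF that(1), of "unit_vec m l"] mult_mat_unit_vec[OF that(1,4)] by auto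
    then have "col M l $ k \<in> irrelevant_ideal"
      using min[of j] that(3) graded_hom_carrier[OF gF[of j]] unfolding minimal_kernel_def by auto
    then show ?thesis using that by simp
  qed
  \<comment> \<open>In each product one factor is irrelevant. For i = 0 the equation
    \<open>\<phi> 0 * h = 0\<close> puts the columns of \<open>h\<close> into the minimal kernel of
    \<open>\<phi> 0\<close>; for larger i the columns of \<open>\<phi> i\<close> lie in the minimal
    kernel of the preceding map.\<close>
  have h\<phi>: "(h * \<phi> i) $$ (l, l) \<in> irrelevant_ideal" if l: "l < length (D i)" for l
  proof -
    have "h $$ (l, j) * \<phi> i $$ (j, l) \<in> irrelevant_ideal" if j: "j < length (augmented es D i)" for j
    proof (cases i)
      case 0
      have "mat_image h \<subseteq> mat_kernel (\<phi> i)"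
      proof
        fix w assume "w \<in> mat_image h"
        then obtain v where v: "v \<in> carrier_vec (length (augmented es D i))" "w = h *\<^sub>v v"
          by (rule mat_imageE[OF _ Ch])
        have "\<phi> i *\<^sub>v w = \<kappa> *\<^sub>v v" using v C\<phi> Ch h(2)[symmetric] by simp
        also have "\<dots> = 0\<^sub>v (length (augmented es D i))"
          using \<kappa>0[OF 0] v 0 by (intro eq_vecI) (auto simp: augmented_def)
        finally show "w \<in> mat_kernel (\<phi> i)" using v Ch by (intro mat_kernelI[OF C\<phi>]) simp_all
      qed
      from irr_col[OF Ch this l j] show ?thesis by (rule irrelevant_mult_left)
    next
      case (Suc i')
      have "mat_image (\<phi> i) = mat_kernel (\<phi> i')" using resolution_exact[OF F] Suc by simp
      moreover have "\<phi> i \<in> carrier_mat (length (D i')) (length (D i))"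
        using C\<phi> Suc by (simp add: augmented_def)
      ultimately have "\<phi> i $$ (j, l) \<in> irrelevant_ideal"
        using irr_col[of "\<phi> i" i' "length (D i)" j l] j l Suc by (simp add: augmented_def)
      then show ?thesis by (rule irrelevant_mult_right)
    qed
    then show ?thesis by (subst index_mult_mat_sum[OF Ch C\<phi> l l]) (auto intro!: irrelevant_sum)
  qed
  show ?thesis
  proof
    fix t assume "t \<in> set (D i)"
    then obtain l where l: "l < length (D i)" "t = D i ! l" by (auto simp: in_set_conv_nth)
    \<comment> \<open>Otherwise all three summands of the identity matrix have an irrelevant entry
      at position (l, l), and 1 would be irrelevant.\<close>
    have "\<exists>k < length (G i). a' $$ (k, l) \<notin> irrelevant_ideal"
    proof (rule ccontr)
      assume "\<not> ?thesis"
      then have "(b' * a') $$ (l, l) \<in> irrelevant_ideal"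
        by (subst index_mult_mat_sum[OF Cb Ca l(1) l(1)]) (auto intro!: irrelevant_sum irrelevant_mult_right)
      moreover have "\<kappa>' $$ (l, l) \<in> irrelevant_ideal" by (rule irr_col[OF C\<kappa> \<kappa>'(2) l(1) l(1)])
      ultimately have "(b' * a' + \<kappa>' + h * \<phi> i) $$ (l, l) \<in> irrelevant_ideal"
        using h\<phi>[OF l(1)] l(1) Ca Cb C\<kappa> Ch C\<phi> by (auto intro!: irrelevant_add)
      then have "(1 :: ('v, 'k) mpoly) \<in> irrelevant_ideal" using l(1) unfolding id[symmetric] by simp
      then show False by (simp add: irrelevant_ideal_def)
    qed
    then obtain k where k: "k < length (G i)" "a' $$ (k, l) \<notin> irrelevant_ideal" by blast
    \<comment> \<open>A homogeneous polynomial with a nonzero constant term has degree 0, so the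
      unit entry forces the two twists to coincide.\<close>
    then have "D i ! l - G i ! k = 0"
      using homog_irrelevant[OF graded_hom_homog[OF a' k(1) l(1)]] by blast
    then show "t \<in> set (G i)" using k(1) l(2) by (metis eq_iff_diff_eq_0 nth_mem)
  qed
qed

text \<open>No column of a differential is zero, since a unit vector in the kernel would contradict
  minimality. A nonzero irrelevant entry has degree at least 1, so twists grow by at least 1 per
  step. This bounds the differences t - i from below, as needed for their finiteness.\<close>

lemma minimal_resolution_twists_ge:
  fixes \<phi> :: "nat \<Rightarrow> ('v::finite, 'k::field) mpoly mat"
  assumes F: "resolution [0] L D \<phi>" and min: "\<And>i. minimal_kernel (\<phi> i)" and t: "t \<in> set (D i)"
  shows "int i \<le> t"
  using t
proof (induction i arbitrary: t)
  have nz: "\<exists>k < length (augmented [0] D i). \<phi> i $$ (k, l) \<noteq> 0" if l: "l < length (D i)" for i l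
  proof (rule ccontr)
    assume neg: "\<not> ?thesis"
    note C = graded_hom_carrier[OF resolution_graded[OF F, of i]]
    have "col (\<phi> i) l = 0\<^sub>v (length (augmented [0] D i))" using neg C l by (intro eq_vecI) auto
    then have "unit_vec (length (D i)) l \<in> mat_kernel (\<phi> i)"
      by (intro mat_kernelI[OF C]) (simp_all add: mult_mat_unit_vec[OF C l])
    moreover have "z $ l \<in> irrelevant_ideal" if "z \<in> mat_kernel (\<phi> i)" for z
      using min[of i] that l C unfolding minimal_kernel_def by auto
    ultimately have "(unit_vec (length (D i)) l :: ('v, 'k) mpoly vec) $ l \<in> irrelevant_ideal" by blast
    then show False using l by (simp add: irrelevant_ideal_def)
  qed
  {
    case 0
    then obtain l where l: "l < length (D 0)" "t = D 0 ! l" by (auto simp: in_set_conv_nth)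
    from nz[OF l(1)] have "\<phi> 0 $$ (0, l) \<noteq> 0" by (simp add: augmented_def)
    moreover have "homog (D 0 ! l - 0) (\<phi> 0 $$ (0, l))"
      using graded_hom_homog[OF resolution_graded[OF F, of 0], of 0 l] l(1) by (simp add: augmented_def)
    ultimately show ?case using homog_degree_nonneg l(2) by fastforce
  next
    case (Suc i)
    then obtain l where l: "l < length (D (Suc i))" "t = D (Suc i) ! l" by (auto simp: in_set_conv_nth)
    from nz[OF l(1)] obtain k where k: "k < length (D i)" "\<phi> (Suc i) $$ (k, l) \<noteq> 0"
      by (auto simp: augmented_def)
    note C = graded_hom_carrier[OF resolution_graded_Suc[OF F, of i]]
    have "col (\<phi> (Suc i)) l \<in> mat_kernel (\<phi> i)"
      unfolding resolution_exact[OF F, symmetric] mult_mat_unit_vec[OF C l(1), symmetric]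
      by (rule mat_imageI[OF C]) simp
    then have "col (\<phi> (Suc i)) l $ k \<in> irrelevant_ideal"
      using min[of i] k(1) graded_hom_carrier[OF resolution_graded[OF F, of i]]
      unfolding minimal_kernel_def by auto
    then have "\<phi> (Suc i) $$ (k, l) \<in> irrelevant_ideal" using C k l by simp
    then have "D (Suc i) ! l - D i ! k \<ge> 1"
      using homog_degree_pos[OF graded_hom_homog[OF resolution_graded_Suc[OF F] k(1) l(1)]] k(2) by blast
    moreover have "int i \<le> D i ! k" using Suc.IH k(1) by simp
    ultimately show ?case using l(2) by simp
  }
qed

text \<open>\<open>Max\<close> says something only about finite nonempty sets. The comparison with
  \<open>G\<close> and the lower bound on minimal twists confine the differences to
  \<open>{0..r}\<close>; a nonzero element of the ideal forces at least one generator.\<close>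

lemma reg_le:
  fixes I :: "('v::finite, 'k::field) mpoly set"
  assumes G: "resolution [0] (ideal_vecs I) G \<psi>"
    and bound: "\<And>i t. t \<in> set (G i) \<Longrightarrow> t - int i \<le> r"
    and nz: "\<exists>p\<in>I. p \<noteq> 0"
  shows "reg I \<le> r"
proof -
  define D where "D = (SOME D. \<exists>\<phi>. minimal_free_resolution I D \<phi>)"
  have "\<exists>D \<phi>. minimal_free_resolution I D \<phi>"
    using minimal_resolution_exists[OF G] unfolding minimal_free_resolution_iff .
  then have "\<exists>\<phi>. minimal_free_resolution I D \<phi>" unfolding D_def by (rule someI_ex)
  then obtain \<phi> where F: "resolution [0] (ideal_vecs I) D \<phi>" "\<And>i. minimal_kernel (\<phi> i)"
    unfolding minimal_free_resolution_iff by blast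
  let ?S = "{j - int i | i j. betti I i j \<noteq> 0}"
  have S: "?S = {j - int i | i j. j \<in> set (D i)}"
    unfolding betti_def D_def[symmetric] by (simp add: count_list_0_iff)
  have "?S \<subseteq> {0..r}"
    unfolding S using minimal_resolution_twists[OF F(1) G F(2)] bound minimal_resolution_twists_ge[OF F]
    by fastforce
  moreover have "?S \<noteq> {}"
  proof -
    have "D 0 \<noteq> []"
    proof
      assume "D 0 = []"
      then have C: "\<phi> 0 \<in> carrier_mat 1 0"
        using graded_hom_carrier[OF resolution_graded[OF F(1), of 0]] by (simp add: augmented_def)
      obtain p where p: "p \<in> I" "p \<noteq> 0" using nz by blast
      have "vec 1 (\<lambda>_. p) \<in> mat_image (\<phi> 0)"
        unfolding resolution_image_0[OF F(1)] ideal_vecs_def using p by simp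
      then obtain v where v: "v \<in> carrier_vec 0" "vec 1 (\<lambda>_. p) = \<phi> 0 *\<^sub>v v" by (rule mat_imageE[OF _ C])
      have "vec 1 (\<lambda>_. p) $ 0 = (\<phi> 0 *\<^sub>v v) $ 0" using v(2) by simp
      also have "\<dots> = 0" by (subst index_mult_mat_vec_sum[OF C v(1)]) auto
      finally show False using p by simp
    qed
    then have "hd (D 0) - int 0 \<in> ?S" unfolding S using list.set_sel(1) by blast
    then show ?thesis by blast
  qed
  moreover have "finite ?S" using calculation(1) finite_subset by blast
  ultimately have "Max ?S \<in> {0..r}" using Max_in by blast
  then show ?thesis unfolding reg_def by simp
qed

section \<open>Mapping cones\<close>

lemma graded_hom_four_block:
  assumes "graded_hom ds es A" "graded_hom ds' es B" "graded_hom ds es' C" "graded_hom ds' es' D"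
  shows "graded_hom (ds @ ds') (es @ es') (four_block_mat A B C D)"
  unfolding graded_hom_iff
proof (intro conjI allI impI)
  note CA = graded_hom_carrier[OF assms(1)] and CB = graded_hom_carrier[OF assms(2)]
    and CC = graded_hom_carrier[OF assms(3)] and CD = graded_hom_carrier[OF assms(4)]
  show "four_block_mat A B C D \<in> carrier_mat (length (es @ es')) (length (ds @ ds'))"
    using four_block_carrier_mat[OF CA CD] by simp
  fix k l assume kl: "k < length (es @ es')" "l < length (ds @ ds')"
  have eq: "four_block_mat A B C D $$ (k, l) =
    (if k < length es then if l < length ds then A $$ (k, l) else B $$ (k, l - length ds)
     else if l < length ds then C $$ (k - length es, l) else D $$ (k - length es, l - length ds))"
    using index_mat_four_block(1)[of k A D l B C] kl CA CD by simp
  show "homog ((ds @ ds') ! l - (es @ es') ! k) (four_block_mat A B C D $$ (k, l))"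
    unfolding eq nth_append
    using graded_hom_homog[OF assms(1)] graded_hom_homog[OF assms(2)]
      graded_hom_homog[OF assms(3)] graded_hom_homog[OF assms(4)] kl by auto
qed

lemma append_vec_cases:
  assumes "x \<in> carrier_vec (n + m)"
  obtains v w where "x = v @\<^sub>v w" "v \<in> carrier_vec n" "w \<in> carrier_vec m"
  using that[of "vec_first x n" "vec_last x m"] assms by simp

lemma append_vec_inj:
  assumes "v \<in> carrier_vec n" "v' \<in> carrier_vec n"
  shows "v @\<^sub>v w = v' @\<^sub>v w' \<longleftrightarrow> v = v' \<and> w = w'"
  using append_vec_eq[OF assms] .

lemma zero_vec_append: "0\<^sub>v (n + m) = 0\<^sub>v n @\<^sub>v 0\<^sub>v m"
  by (intro eq_vecI) auto

lemma zero_mult_mat_vec: "v \<in> carrier_vec m \<Longrightarrow> 0\<^sub>m n m *\<^sub>v v = (0\<^sub>v n :: 'a::comm_ring_1 vec)"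
  by (intro eq_vecI) auto

lemma uminus_mult_mat_vec:
  fixes A :: "'a::comm_ring_1 mat"
  assumes "A \<in> carrier_mat n m" "v \<in> carrier_vec m"
  shows "(- A) *\<^sub>v v = - (A *\<^sub>v v)"
  using assms by (intro eq_vecI) auto

lemma mult_mat_vec_uminus:
  fixes A :: "'a::comm_ring_1 mat"
  assumes "A \<in> carrier_mat n m" "v \<in> carrier_vec m"
  shows "A *\<^sub>v (- v) = - (A *\<^sub>v v)"
  using assms by (intro eq_vecI) auto

section \<open>Shifts, direct sums and the cone of a chain map\<close>

lemma resolution_shift:
  assumes "resolution es K D \<phi>"
  shows "resolution (map (\<lambda>t. t + c) es) K (\<lambda>i. map (\<lambda>t. t + c) (D i)) \<phi>"
proof -
  have "graded_hom (map (\<lambda>t. t + c) ds) (map (\<lambda>t. t + c) ds') A" if "graded_hom ds ds' A"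
    for ds ds' and A :: "('a, 'b) mpoly mat"
    using that by (simp add: graded_hom_iff)
  then show ?thesis using assms by (auto simp: resolution_def)
qed

lemma resolution_direct_sum:
  assumes F: "resolution es K D \<phi>" and G: "resolution es' K' D' \<phi>'"
  shows "\<exists>\<chi>. resolution (es @ es') {v @\<^sub>v w | v w. v \<in> K \<and> w \<in> K'} (\<lambda>i. D i @ D' i) \<chi>"
proof
  define m n m' n' where "m i = length (augmented es D i)" and "n i = length (D i)"
    and "m' i = length (augmented es' D' i)" and "n' i = length (D' i)" for i
  define \<chi> where "\<chi> i = four_block_mat (\<phi> i) (0\<^sub>m (m i) (n' i)) (0\<^sub>m (m' i) (n i)) (\<phi>' i)" for i
  have C: "\<phi> i \<in> carrier_mat (m i) (n i)" "\<phi>' i \<in> carrier_mat (m' i) (n' i)" for i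
    using graded_hom_carrier[OF resolution_graded[OF F, of i]] graded_hom_carrier[OF resolution_graded[OF G, of i]]
    by (simp_all add: m_def n_def m'_def n'_def)
  have C\<chi>: "\<chi> i \<in> carrier_mat (m i + m' i) (n i + n' i)" for i
    unfolding \<chi>_def using C by simp
  have mult: "\<chi> i *\<^sub>v (v @\<^sub>v w) = (\<phi> i *\<^sub>v v) @\<^sub>v (\<phi>' i *\<^sub>v w)"
    if "v \<in> carrier_vec (n i)" "w \<in> carrier_vec (n' i)" for i v w
  proof -
    have "\<phi> i *\<^sub>v v + 0\<^sub>m (m i) (n' i) *\<^sub>v w = \<phi> i *\<^sub>v v" "0\<^sub>m (m' i) (n i) *\<^sub>v v + \<phi>' i *\<^sub>v w = \<phi>' i *\<^sub>v w"
      using zero_mult_mat_vec[OF that(1), of "m' i"] zero_mult_mat_vec[OF that(2), of "m i"] C[of i] that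
      by simp_all
    then show ?thesis
      unfolding \<chi>_def using four_block_mat_mult_vec[OF C(1) zero_carrier_mat zero_carrier_mat C(2) that] by simp
  qed
  have image: "mat_image (\<chi> i) = {v @\<^sub>v w | v w. v \<in> mat_image (\<phi> i) \<and> w \<in> mat_image (\<phi>' i)}" (is "?l = ?r") for i
  proof
    show "?l \<subseteq> ?r"
    proof
      fix x assume "x \<in> ?l"
      then obtain y where y: "y \<in> carrier_vec (n i + n' i)" "x = \<chi> i *\<^sub>v y" by (rule mat_imageE[OF _ C\<chi>])
      obtain v w where "y = v @\<^sub>v w" "v \<in> carrier_vec (n i)" "w \<in> carrier_vec (n' i)"
        using append_vec_cases[OF y(1)] by blast
      then show "x \<in> ?r" using y mult mat_imageI[OF C(1)] mat_imageI[OF C(2)] by blast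
    qed
    show "?r \<subseteq> ?l"
    proof
      fix x assume "x \<in> ?r"
      then obtain v w where vw: "v \<in> mat_image (\<phi> i)" "w \<in> mat_image (\<phi>' i)" "x = v @\<^sub>v w" by blast
      obtain v' where v': "v' \<in> carrier_vec (n i)" "v = \<phi> i *\<^sub>v v'" by (rule mat_imageE[OF vw(1) C(1)])
      obtain w' where w': "w' \<in> carrier_vec (n' i)" "w = \<phi>' i *\<^sub>v w'" by (rule mat_imageE[OF vw(2) C(2)])
      have "x = \<chi> i *\<^sub>v (v' @\<^sub>v w')" using mult v' w' vw(3) by simp
      moreover have "v' @\<^sub>v w' \<in> carrier_vec (n i + n' i)" using v'(1) w'(1) by simp
      ultimately show "x \<in> ?l" using mat_imageI[OF C\<chi>] by blast
    qed
  qed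
  have kernel: "mat_kernel (\<chi> i) = {v @\<^sub>v w | v w. v \<in> mat_kernel (\<phi> i) \<and> w \<in> mat_kernel (\<phi>' i)}" (is "?l = ?r") for i
  proof
    show "?l \<subseteq> ?r"
    proof
      fix y assume "y \<in> ?l"
      note y = mat_kernelD[OF C\<chi> this]
      obtain v w where vw: "y = v @\<^sub>v w" "v \<in> carrier_vec (n i)" "w \<in> carrier_vec (n' i)"
        using append_vec_cases[OF y(1)] by blast
      then have "(\<phi> i *\<^sub>v v) @\<^sub>v (\<phi>' i *\<^sub>v w) = 0\<^sub>v (m i) @\<^sub>v 0\<^sub>v (m' i)"
        using y(2) mult zero_vec_append by metis
      then have "\<phi> i *\<^sub>v v = 0\<^sub>v (m i)" "\<phi>' i *\<^sub>v w = 0\<^sub>v (m' i)"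
        using append_vec_inj[OF mult_mat_vec_carrier[OF C(1) vw(2)] zero_carrier_vec] by simp_all
      then show "y \<in> ?r" using vw mat_kernelI[OF C(1)] mat_kernelI[OF C(2)] by blast
    qed
    show "?r \<subseteq> ?l"
    proof
      fix y assume "y \<in> ?r"
      then obtain v w where vw: "v \<in> mat_kernel (\<phi> i)" "w \<in> mat_kernel (\<phi>' i)" "y = v @\<^sub>v w" by blast
      note v = mat_kernelD[OF C(1) vw(1)] and w = mat_kernelD[OF C(2) vw(2)]
      show "y \<in> ?l"
        using mult[OF v(1) w(1)] v w vw(3) by (intro mat_kernelI[OF C\<chi>]) (simp_all add: zero_vec_append)
    qed
  qed
  have aug: "augmented (es @ es') (\<lambda>i. D i @ D' i) i = augmented es D i @ augmented es' D' i" for i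
    by (cases i) (simp_all add: augmented_def)
  have "graded_hom (D i @ D' i) (augmented es D i @ augmented es' D' i) (\<chi> i)" for i
    unfolding \<chi>_def m_def n_def m'_def n'_def
    by (intro graded_hom_four_block resolution_graded[OF F] resolution_graded[OF G] graded_hom_zero)
  then have g: "graded_hom (D i @ D' i) (augmented (es @ es') (\<lambda>i. D i @ D' i) i) (\<chi> i)" for i
    by (simp add: aug)
  show "resolution (es @ es') {v @\<^sub>v w | v w. v \<in> K \<and> w \<in> K'} (\<lambda>i. D i @ D' i) \<chi>"
    unfolding resolution_def
  proof (intro conjI allI)
    show "graded_hom (D 0 @ D' 0) (es @ es') (\<chi> 0)" using g[of 0] by (simp add: augmented_def)
    show "graded_hom (D (Suc i) @ D' (Suc i)) (D i @ D' i) (\<chi> (Suc i))" for i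
      using g[of "Suc i"] by (simp add: augmented_def)
    show "mat_image (\<chi> 0) = {v @\<^sub>v w | v w. v \<in> K \<and> w \<in> K'}"
      unfolding image resolution_image_0[OF F] resolution_image_0[OF G] ..
    show "mat_image (\<chi> (Suc i)) = mat_kernel (\<chi> i)" for i
      unfolding image kernel resolution_exact[OF F] resolution_exact[OF G] ..
  qed
qed

text \<open>Indices are shifted: \<open>M i\<close> acts on the target of \<open>\<phi> i\<close>,
  so \<open>M 0\<close> is the given map and \<open>M (Suc i)\<close> goes from the i-th module of
  the first resolution to that of the second. The induction carries along that \<open>M i\<close>
  maps the image of \<open>\<phi> i\<close> into that of \<open>\<psi> i\<close>, which is what the
  next lift needs.\<close>

lemma chain_map_lift:
  fixes \<phi> \<psi> :: "nat \<Rightarrow> ('v::finite, 'k::field) mpoly mat"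
  assumes F: "resolution ps K P \<phi>" and G: "resolution qs L Q \<psi>"
    and \<mu>: "graded_hom ps qs \<mu>" "\<And>z. z \<in> K \<Longrightarrow> \<mu> *\<^sub>v z \<in> L"
  shows "\<exists>M. M 0 = \<mu> \<and> (\<forall>i. graded_hom (augmented ps P i) (augmented qs Q i) (M i) \<and>
    \<psi> i * M (Suc i) = M i * \<phi> i)"
proof -
  define R where "R n x \<longleftrightarrow> graded_hom (augmented ps P n) (augmented qs Q n) x \<and>
    (\<forall>z\<in>mat_image (\<phi> n). x *\<^sub>v z \<in> mat_image (\<psi> n)) \<and> (n = 0 \<longrightarrow> x = \<mu>)" for n x
  note gF = resolution_graded[OF F] and gG = resolution_graded[OF G]
  have "R 0 \<mu>"
    using \<mu> resolution_image_0[OF F] resolution_image_0[OF G] by (auto simp: R_def augmented_def)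
  moreover have "\<exists>y. R (Suc n) y \<and> \<psi> n * y = x * \<phi> n" if "R n x" for n x
  proof -
    from that have x: "graded_hom (augmented ps P n) (augmented qs Q n) x"
      "\<And>z. z \<in> mat_image (\<phi> n) \<Longrightarrow> x *\<^sub>v z \<in> mat_image (\<psi> n)" by (simp_all add: R_def)
    note Cx = graded_hom_carrier[OF x(1)] and C\<phi> = graded_hom_carrier[OF gF[of n]]
      and C\<psi> = graded_hom_carrier[OF gG[of n]]
    have "mat_image (x * \<phi> n) \<subseteq> mat_image (\<psi> n)"
    proof
      fix w assume "w \<in> mat_image (x * \<phi> n)"
      then obtain v where v: "v \<in> carrier_vec (length (P n))" "w = (x * \<phi> n) *\<^sub>v v"
        by (rule mat_imageE[OF _ mult_carrier_mat[OF Cx C\<phi>]])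
      then have "w = x *\<^sub>v (\<phi> n *\<^sub>v v)" using Cx C\<phi> by simp
      then show "w \<in> mat_image (\<psi> n)" using x(2) mat_imageI[OF C\<phi> v(1)] by simp
    qed
    then obtain y where y: "graded_hom (P n) (Q n) y" "\<psi> n * y = x * \<phi> n"
      using graded_lift[OF gG graded_hom_mult[OF x(1) gF]] by blast
    note Cy = graded_hom_carrier[OF y(1)]
    have "y *\<^sub>v z \<in> mat_kernel (\<psi> n)" if "z \<in> mat_kernel (\<phi> n)" for z
    proof (rule mat_kernelI[OF C\<psi>])
      note z = mat_kernelD[OF C\<phi> that]
      show "y *\<^sub>v z \<in> carrier_vec (length (Q n))" using Cy z by simp
      have "\<psi> n *\<^sub>v (y *\<^sub>v z) = (\<psi> n * y) *\<^sub>v z" using C\<psi> Cy z by simp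
      also have "\<dots> = x *\<^sub>v (\<phi> n *\<^sub>v z)" unfolding y(2) using Cx C\<phi> z by simp
      finally show "\<psi> n *\<^sub>v (y *\<^sub>v z) = 0\<^sub>v (length (augmented qs Q n))"
        using z(2) mult_mat_zero_vec[OF Cx] by simp
    qed
    then show ?thesis using y resolution_exact[OF F] resolution_exact[OF G]
      by (intro exI[of _ y]) (simp add: R_def augmented_def)
  qed
  ultimately obtain M where "\<And>n. R n (M n)" "\<And>n. \<psi> n * M (Suc n) = M n * \<phi> n"
    using dependent_nat_choice[of R "\<lambda>n x y. \<psi> n * y = x * \<phi> n"] by metis
  then show ?thesis by (intro exI[of _ M]) (simp add: R_def)
qed

text \<open>The resolution with twists \<open>P\<close> is moved up by one homological degree. This
  is why a shift of \<open>P\<close> by 1 does not raise the differences t - i of the cone.\<close>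

definition cone_twists :: "(nat \<Rightarrow> int list) \<Rightarrow> (nat \<Rightarrow> int list) \<Rightarrow> nat \<Rightarrow> int list" where
  "cone_twists P Q i = Q i @ (case i of 0 \<Rightarrow> [] | Suc j \<Rightarrow> P j)"

text \<open>The hypotheses describe a short exact sequence from \<open>K\<close> through
  \<open>L\<close> to its image under \<open>\<pi>\<close>. The cone differential sends (v, u) to
  (\<open>\<psi>\<close> v + M u, - \<open>\<phi>\<close> u), and the augmentation is
  \<open>\<pi> * \<psi> 0\<close>.\<close>

lemma resolution_cone:
  fixes \<phi> \<psi> :: "nat \<Rightarrow> ('v::finite, 'k::field) mpoly mat"
  assumes F: "resolution ps K P \<phi>" and G: "resolution qs L Q \<psi>"
    and \<mu>: "graded_hom ps qs \<mu>" "\<And>z. z \<in> K \<Longrightarrow> \<mu> *\<^sub>v z \<in> L"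
      "\<And>z. z \<in> K \<Longrightarrow> \<mu> *\<^sub>v z = 0\<^sub>v (length qs) \<Longrightarrow> z = 0\<^sub>v (length ps)"
    and \<pi>: "graded_hom qs os \<pi>" "\<And>z. z \<in> L \<Longrightarrow> \<pi> *\<^sub>v z = 0\<^sub>v (length os) \<longleftrightarrow> z \<in> (*\<^sub>v) \<mu> ` K"
  shows "\<exists>\<chi>. resolution os ((*\<^sub>v) \<pi> ` L) (cone_twists P Q) \<chi>"
proof -
  obtain M where M: "M 0 = \<mu>"
    "\<And>i. graded_hom (augmented ps P i) (augmented qs Q i) (M i)"
    "\<And>i. \<psi> i * M (Suc i) = M i * \<phi> i"
    using chain_map_lift[OF F G \<mu>(1,2)] by blast
  define p q where "p i = length (P i)" and "q i = length (Q i)" for i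
  have gM: "graded_hom (P i) (Q i) (M (Suc i))" for i using M(2)[of "Suc i"] by (simp add: augmented_def)
  have g\<phi>0: "graded_hom (P 0) ps (\<phi> 0)" and g\<psi>0: "graded_hom (Q 0) qs (\<psi> 0)"
    using F G by (simp_all add: resolution_def)
  note g\<phi> = resolution_graded_Suc[OF F] and g\<psi> = resolution_graded_Suc[OF G]
  have C\<phi>: "\<phi> (Suc i) \<in> carrier_mat (p i) (p (Suc i))"
    and C\<psi>: "\<psi> (Suc i) \<in> carrier_mat (q i) (q (Suc i))"
    and CM: "M (Suc i) \<in> carrier_mat (q i) (p i)" for i
    using graded_hom_carrier[OF g\<phi>[of i]] graded_hom_carrier[OF g\<psi>[of i]] graded_hom_carrier[OF gM[of i]]
    by (simp_all add: p_def q_def)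
  have C\<phi>0: "\<phi> 0 \<in> carrier_mat (length ps) (p 0)" and C\<psi>0: "\<psi> 0 \<in> carrier_mat (length qs) (q 0)"
    using graded_hom_carrier[OF g\<phi>0] graded_hom_carrier[OF g\<psi>0] by (simp_all add: p_def q_def)
  note C\<mu> = graded_hom_carrier[OF \<mu>(1)] and C\<pi> = graded_hom_carrier[OF \<pi>(1)]
  have C\<phi>': "\<phi> i \<in> carrier_mat (length (augmented ps P i)) (p i)" for i
    using graded_hom_carrier[OF resolution_graded[OF F, of i]] by (simp add: p_def)
  have C\<psi>': "\<psi> i \<in> carrier_mat (length (augmented qs Q i)) (q i)" for i
    using graded_hom_carrier[OF resolution_graded[OF G, of i]] by (simp add: q_def)
  have sq0: "\<psi> 0 *\<^sub>v (M (Suc 0) *\<^sub>v u) = \<mu> *\<^sub>v (\<phi> 0 *\<^sub>v u)" if "u \<in> carrier_vec (p 0)" for u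
    using arg_cong[OF M(3)[of 0], of "\<lambda>A. A *\<^sub>v u"]
      assoc_mult_mat_vec[OF C\<psi>0 CM[of 0] that] assoc_mult_mat_vec[OF C\<mu> C\<phi>0 that] M(1) by simp
  have sq: "\<psi> (Suc i) *\<^sub>v (M (Suc (Suc i)) *\<^sub>v u) = M (Suc i) *\<^sub>v (\<phi> (Suc i) *\<^sub>v u)"
    if "u \<in> carrier_vec (p (Suc i))" for i u
    using arg_cong[OF M(3)[of "Suc i"], of "\<lambda>A. A *\<^sub>v u"]
      assoc_mult_mat_vec[OF C\<psi>[of i] CM[of "Suc i"] that] assoc_mult_mat_vec[OF CM[of i] C\<phi>[of i] that] by simp
  have zero\<phi>: "\<phi> i *\<^sub>v (\<phi> (Suc i) *\<^sub>v u) = 0\<^sub>v (length (augmented ps P i))"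
    if "u \<in> carrier_vec (p (Suc i))" for i u
    using mat_kernelD(2)[OF C\<phi>'] mat_imageI[OF C\<phi> that] resolution_exact[OF F] by blast
  have zero\<psi>: "\<psi> i *\<^sub>v (\<psi> (Suc i) *\<^sub>v u) = 0\<^sub>v (length (augmented qs Q i))"
    if "u \<in> carrier_vec (q (Suc i))" for i u
    using mat_kernelD(2)[OF C\<psi>'] mat_imageI[OF C\<psi> that] resolution_exact[OF G] by blast
  have ex\<phi>: "\<exists>u'. u' \<in> carrier_vec (p (Suc i)) \<and> u = \<phi> (Suc i) *\<^sub>v u'"
    if "u \<in> carrier_vec (p i)" "\<phi> i *\<^sub>v u = 0\<^sub>v (length (augmented ps P i))" for i u
  proof -
    have "u \<in> mat_image (\<phi> (Suc i))"
      unfolding resolution_exact[OF F] by (rule mat_kernelI[OF C\<phi>' that])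
    then show ?thesis using mat_imageE[OF _ C\<phi>] by blast
  qed
  have ex\<psi>: "\<exists>u'. u' \<in> carrier_vec (q (Suc i)) \<and> u = \<psi> (Suc i) *\<^sub>v u'"
    if "u \<in> carrier_vec (q i)" "\<psi> i *\<^sub>v u = 0\<^sub>v (length (augmented qs Q i))" for i u
  proof -
    have "u \<in> mat_image (\<psi> (Suc i))"
      unfolding resolution_exact[OF G] by (rule mat_kernelI[OF C\<psi>' that])
    then show ?thesis using mat_imageE[OF _ C\<psi>] by blast
  qed
  \<comment> \<open>\<open>?Z j\<close> and \<open>?B j\<close> are the cycles and boundaries of the
    cone in the sum of the module \<open>Q (Suc j)\<close> and the module \<open>P j\<close>.
    Writing both as explicit sets separates the diagram chase from the block matrices.\<close>
  let ?Z = "\<lambda>j. {v @\<^sub>v u | v u. v \<in> carrier_vec (q (Suc j)) \<and> u \<in> carrier_vec (p j) \<and>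
    \<psi> (Suc j) *\<^sub>v v + M (Suc j) *\<^sub>v u = 0\<^sub>v (q j) \<and> \<phi> j *\<^sub>v u = 0\<^sub>v (length (augmented ps P j))}"
  let ?B = "\<lambda>j. {(\<psi> (Suc (Suc j)) *\<^sub>v v + M (Suc (Suc j)) *\<^sub>v u) @\<^sub>v (- (\<phi> (Suc j) *\<^sub>v u)) | v u.
    v \<in> carrier_vec (q (Suc (Suc j))) \<and> u \<in> carrier_vec (p (Suc j))}"
  have ZB: "?Z j = ?B j" for j
  proof
    show "?Z j \<subseteq> ?B j"
    proof
      fix x assume "x \<in> ?Z j"
      then obtain v u where x: "x = v @\<^sub>v u" and v: "v \<in> carrier_vec (q (Suc j))"
        and u: "u \<in> carrier_vec (p j)" and e: "\<psi> (Suc j) *\<^sub>v v + M (Suc j) *\<^sub>v u = 0\<^sub>v (q j)"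
        and z: "\<phi> j *\<^sub>v u = 0\<^sub>v (length (augmented ps P j))" by blast
      \<comment> \<open>Exactness of the first resolution lifts u to u'. By commutativity of the
        square, v plus the image of u' is then a cycle of the second resolution and lifts as well.
        The sign in the cone differential turns u' into its negative.\<close>
      obtain u' where u': "u' \<in> carrier_vec (p (Suc j))" "u = \<phi> (Suc j) *\<^sub>v u'" using ex\<phi>[OF u z] by blast
      have CMu': "M (Suc (Suc j)) *\<^sub>v u' \<in> carrier_vec (q (Suc j))" by (rule mult_mat_vec_carrier[OF CM u'(1)])
      have "\<psi> (Suc j) *\<^sub>v (v + M (Suc (Suc j)) *\<^sub>v u') = 0\<^sub>v (q j)"
        using mult_add_distrib_mat_vec[OF C\<psi> v CMu'] sq[OF u'(1)] e u'(2) by simp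
      then obtain v' where v': "v' \<in> carrier_vec (q (Suc (Suc j)))"
        "v + M (Suc (Suc j)) *\<^sub>v u' = \<psi> (Suc (Suc j)) *\<^sub>v v'"
        using ex\<psi>[of "v + M (Suc (Suc j)) *\<^sub>v u'" "Suc j"] v CMu' by (auto simp: augmented_def q_def)
      have "v = \<psi> (Suc (Suc j)) *\<^sub>v v' + M (Suc (Suc j)) *\<^sub>v (- u')"
        unfolding v'(2)[symmetric] mult_mat_vec_uminus[OF CM u'(1)] using v CM[of "Suc j"] by (intro eq_vecI) auto
      moreover have "u = - (\<phi> (Suc j) *\<^sub>v (- u'))"
        using mult_mat_vec_uminus[OF C\<phi> u'(1)] u'(2) by simp
      moreover have "- u' \<in> carrier_vec (p (Suc j))" using u' by simp
      ultimately show "x \<in> ?B j" using x v'(1) by blast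
    qed
    show "?B j \<subseteq> ?Z j"
    proof
      fix x assume "x \<in> ?B j"
      then obtain v u where x: "x = (\<psi> (Suc (Suc j)) *\<^sub>v v + M (Suc (Suc j)) *\<^sub>v u) @\<^sub>v (- (\<phi> (Suc j) *\<^sub>v u))"
        and v: "v \<in> carrier_vec (q (Suc (Suc j)))" and u: "u \<in> carrier_vec (p (Suc j))" by blast
      have Cv: "\<psi> (Suc (Suc j)) *\<^sub>v v \<in> carrier_vec (q (Suc j))" by (rule mult_mat_vec_carrier[OF C\<psi> v])
      have CMu: "M (Suc (Suc j)) *\<^sub>v u \<in> carrier_vec (q (Suc j))" by (rule mult_mat_vec_carrier[OF CM u])
      have Cu: "\<phi> (Suc j) *\<^sub>v u \<in> carrier_vec (p j)" by (rule mult_mat_vec_carrier[OF C\<phi> u])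
      have CMMu: "M (Suc j) *\<^sub>v (\<phi> (Suc j) *\<^sub>v u) \<in> carrier_vec (q j)" by (rule mult_mat_vec_carrier[OF CM Cu])
      have "\<psi> (Suc j) *\<^sub>v (\<psi> (Suc (Suc j)) *\<^sub>v v + M (Suc (Suc j)) *\<^sub>v u) + M (Suc j) *\<^sub>v (- (\<phi> (Suc j) *\<^sub>v u)) = 0\<^sub>v (q j)"
        using mult_add_distrib_mat_vec[OF C\<psi> Cv CMu] sq[OF u] zero\<psi>[OF v] mult_mat_vec_uminus[OF CM Cu] CMMu
        by (simp add: augmented_def q_def[symmetric])
      moreover have "\<phi> j *\<^sub>v (- (\<phi> (Suc j) *\<^sub>v u)) = 0\<^sub>v (length (augmented ps P j))"
        using mult_mat_vec_uminus[OF C\<phi>' Cu] zero\<phi>[OF u] by (auto intro!: eq_vecI)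
      moreover have "\<psi> (Suc (Suc j)) *\<^sub>v v + M (Suc (Suc j)) *\<^sub>v u \<in> carrier_vec (q (Suc j))"
        "- (\<phi> (Suc j) *\<^sub>v u) \<in> carrier_vec (p j)" using Cv CMu Cu by simp_all
      ultimately show "x \<in> ?Z j" using x by blast
    qed
  qed
  define \<chi> where "\<chi> i = (case i of 0 \<Rightarrow> \<pi> * \<psi> 0 | Suc j \<Rightarrow>
    (case j of 0 \<Rightarrow> hcat (\<psi> (Suc 0)) (M (Suc 0))
     | Suc k \<Rightarrow> four_block_mat (\<psi> (Suc j)) (M (Suc j)) (0\<^sub>m (p k) (q (Suc j))) (- \<phi> j)))" for i
  have \<chi>0: "\<chi> 0 = \<pi> * \<psi> 0" and \<chi>1: "\<chi> (Suc 0) = hcat (\<psi> (Suc 0)) (M (Suc 0))"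
    and \<chi>2: "\<chi> (Suc (Suc k)) = four_block_mat (\<psi> (Suc (Suc k))) (M (Suc (Suc k)))
      (0\<^sub>m (p k) (q (Suc (Suc k)))) (- \<phi> (Suc k))" for k
    by (simp_all add: \<chi>_def)
  have C\<chi>0: "\<chi> 0 \<in> carrier_mat (length os) (q 0)" unfolding \<chi>0 by (rule mult_carrier_mat[OF C\<pi> C\<psi>0])
  have C\<chi>1: "\<chi> (Suc 0) \<in> carrier_mat (q 0) (q (Suc 0) + p 0)" unfolding \<chi>1 by (rule hcat_carrier[OF C\<psi> CM])
  have C\<chi>2: "\<chi> (Suc (Suc k)) \<in> carrier_mat (q (Suc k) + p k) (q (Suc (Suc k)) + p (Suc k))" for k
    unfolding \<chi>2 by (intro four_block_carrier_mat C\<psi> uminus_carrier_mat C\<phi>)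
  have mult1: "\<chi> (Suc 0) *\<^sub>v (v @\<^sub>v u) = \<psi> (Suc 0) *\<^sub>v v + M (Suc 0) *\<^sub>v u"
    if "v \<in> carrier_vec (q (Suc 0))" "u \<in> carrier_vec (p 0)" for v u
    unfolding \<chi>1 by (rule hcat_mult_vec[OF C\<psi> CM that])
  have mult2: "\<chi> (Suc (Suc k)) *\<^sub>v (v @\<^sub>v u) =
      (\<psi> (Suc (Suc k)) *\<^sub>v v + M (Suc (Suc k)) *\<^sub>v u) @\<^sub>v (- (\<phi> (Suc k) *\<^sub>v u))"
    if v: "v \<in> carrier_vec (q (Suc (Suc k)))" and u: "u \<in> carrier_vec (p (Suc k))" for k v u
  proof -
    have "0\<^sub>m (p k) (q (Suc (Suc k))) *\<^sub>v v + (- \<phi> (Suc k)) *\<^sub>v u = - (\<phi> (Suc k) *\<^sub>v u)"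
      using zero_mult_mat_vec[OF v, of "p k"] uminus_mult_mat_vec[OF C\<phi> u] C\<phi>[of k] u by simp
    then show ?thesis
      unfolding \<chi>2 using four_block_mat_mult_vec[OF C\<psi> CM zero_carrier_mat uminus_carrier_mat[OF C\<phi>] v u]
      by simp
  qed
  have image2: "mat_image (\<chi> (Suc (Suc k))) = ?B k" for k
  proof
    show "mat_image (\<chi> (Suc (Suc k))) \<subseteq> ?B k"
    proof
      fix x assume "x \<in> mat_image (\<chi> (Suc (Suc k)))"
      then obtain y where y: "y \<in> carrier_vec (q (Suc (Suc k)) + p (Suc k))" "x = \<chi> (Suc (Suc k)) *\<^sub>v y"
        by (rule mat_imageE[OF _ C\<chi>2])
      obtain v u where "y = v @\<^sub>v u" "v \<in> carrier_vec (q (Suc (Suc k)))" "u \<in> carrier_vec (p (Suc k))"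
        using append_vec_cases[OF y(1)] by blast
      then show "x \<in> ?B k" using y(2) mult2 by blast
    qed
    show "?B k \<subseteq> mat_image (\<chi> (Suc (Suc k)))"
    proof
      fix x assume "x \<in> ?B k"
      then obtain v u where x: "x = (\<psi> (Suc (Suc k)) *\<^sub>v v + M (Suc (Suc k)) *\<^sub>v u) @\<^sub>v (- (\<phi> (Suc k) *\<^sub>v u))"
        and v: "v \<in> carrier_vec (q (Suc (Suc k)))" and u: "u \<in> carrier_vec (p (Suc k))" by blast
      have "v @\<^sub>v u \<in> carrier_vec (q (Suc (Suc k)) + p (Suc k))" using v u by simp
      then show "x \<in> mat_image (\<chi> (Suc (Suc k)))"
        using mat_imageI[OF C\<chi>2] mult2[OF v u] x by metis
    qed
  qed
  \<comment> \<open>The first differential has no component that would record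
    \<open>\<phi> 0\<close> u. That this vector vanishes for a cycle comes from injectivity of
    \<open>\<mu>\<close> on \<open>K\<close>: applying \<open>\<psi> 0\<close> to the cycle equation
    leaves \<open>\<mu>\<close> (\<open>\<phi> 0\<close> u) = 0.\<close>
  have kernel1: "mat_kernel (\<chi> (Suc 0)) = ?Z 0"
  proof
    show "mat_kernel (\<chi> (Suc 0)) \<subseteq> ?Z 0"
    proof
      fix y assume "y \<in> mat_kernel (\<chi> (Suc 0))"
      note y = mat_kernelD[OF C\<chi>1 this]
      obtain v u where vu: "y = v @\<^sub>v u" "v \<in> carrier_vec (q (Suc 0))" "u \<in> carrier_vec (p 0)"
        using append_vec_cases[OF y(1)] by blast
      have e: "\<psi> (Suc 0) *\<^sub>v v + M (Suc 0) *\<^sub>v u = 0\<^sub>v (q 0)" using y(2) mult1[OF vu(2,3)] vu(1) by simp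
      have Cv: "\<psi> (Suc 0) *\<^sub>v v \<in> carrier_vec (q 0)" by (rule mult_mat_vec_carrier[OF C\<psi> vu(2)])
      have Cu: "M (Suc 0) *\<^sub>v u \<in> carrier_vec (q 0)" by (rule mult_mat_vec_carrier[OF CM vu(3)])
      have C\<phi>u: "\<phi> 0 *\<^sub>v u \<in> carrier_vec (length ps)" by (rule mult_mat_vec_carrier[OF C\<phi>0 vu(3)])
      have "0\<^sub>v (length qs) = \<psi> 0 *\<^sub>v (\<psi> (Suc 0) *\<^sub>v v + M (Suc 0) *\<^sub>v u)"
        unfolding e by (rule mult_mat_zero_vec[OF C\<psi>0, symmetric])
      also have "\<dots> = 0\<^sub>v (length qs) + \<mu> *\<^sub>v (\<phi> 0 *\<^sub>v u)"
        using mult_add_distrib_mat_vec[OF C\<psi>0 Cv Cu] zero\<psi>[OF vu(2)] sq0[OF vu(3)] by (simp add: augmented_def)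
      also have "\<dots> = \<mu> *\<^sub>v (\<phi> 0 *\<^sub>v u)" using C\<mu> C\<phi>u by simp
      finally have "\<phi> 0 *\<^sub>v u = 0\<^sub>v (length ps)"
        using \<mu>(3) mat_imageI[OF C\<phi>0 vu(3)] resolution_image_0[OF F] by simp
      then show "y \<in> ?Z 0" using vu e by (auto simp: augmented_def)
    qed
    show "?Z 0 \<subseteq> mat_kernel (\<chi> (Suc 0))"
    proof
      fix y assume "y \<in> ?Z 0"
      then obtain v u where "y = v @\<^sub>v u" "v \<in> carrier_vec (q (Suc 0))" "u \<in> carrier_vec (p 0)"
        "\<psi> (Suc 0) *\<^sub>v v + M (Suc 0) *\<^sub>v u = 0\<^sub>v (q 0)" by blast
      then show "y \<in> mat_kernel (\<chi> (Suc 0))" using mult1 by (intro mat_kernelI[OF C\<chi>1]) simp_all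
    qed
  qed
  have kernel2: "mat_kernel (\<chi> (Suc (Suc k))) = ?Z (Suc k)" for k
  proof
    show "mat_kernel (\<chi> (Suc (Suc k))) \<subseteq> ?Z (Suc k)"
    proof
      fix y assume "y \<in> mat_kernel (\<chi> (Suc (Suc k)))"
      note y = mat_kernelD[OF C\<chi>2 this]
      obtain v u where vu: "y = v @\<^sub>v u" "v \<in> carrier_vec (q (Suc (Suc k)))" "u \<in> carrier_vec (p (Suc k))"
        using append_vec_cases[OF y(1)] by blast
      have Cv: "\<psi> (Suc (Suc k)) *\<^sub>v v + M (Suc (Suc k)) *\<^sub>v u \<in> carrier_vec (q (Suc k))" by (rule add_carrier_vec[OF mult_mat_vec_carrier[OF C\<psi> vu(2)] mult_mat_vec_carrier[OF CM vu(3)]])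
      have "(\<psi> (Suc (Suc k)) *\<^sub>v v + M (Suc (Suc k)) *\<^sub>v u) @\<^sub>v (- (\<phi> (Suc k) *\<^sub>v u)) = 0\<^sub>v (q (Suc k)) @\<^sub>v 0\<^sub>v (p k)"
        using y(2) mult2[OF vu(2,3)] vu(1) zero_vec_append by metis
      then have e: "\<psi> (Suc (Suc k)) *\<^sub>v v + M (Suc (Suc k)) *\<^sub>v u = 0\<^sub>v (q (Suc k))"
        and "- (\<phi> (Suc k) *\<^sub>v u) = 0\<^sub>v (p k)" using append_vec_inj[OF Cv zero_carrier_vec] by simp_all
      from this(2) have "- (- (\<phi> (Suc k) *\<^sub>v u)) = - 0\<^sub>v (p k)" by simp
      moreover have "- 0\<^sub>v (p k) = (0\<^sub>v (p k) :: ('v, 'k) mpoly vec)" by (intro eq_vecI) auto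
      ultimately have "\<phi> (Suc k) *\<^sub>v u = 0\<^sub>v (p k)" by simp
      then show "y \<in> ?Z (Suc k)" using vu e by (auto simp: augmented_def p_def)
    qed
    show "?Z (Suc k) \<subseteq> mat_kernel (\<chi> (Suc (Suc k)))"
    proof
      fix y assume "y \<in> ?Z (Suc k)"
      then obtain v u where "y = v @\<^sub>v u" "v \<in> carrier_vec (q (Suc (Suc k)))" "u \<in> carrier_vec (p (Suc k))"
        "\<psi> (Suc (Suc k)) *\<^sub>v v + M (Suc (Suc k)) *\<^sub>v u = 0\<^sub>v (q (Suc k))" "\<phi> (Suc k) *\<^sub>v u = 0\<^sub>v (p k)"
        by (auto simp: augmented_def p_def)
      moreover have "- 0\<^sub>v (p k) = (0\<^sub>v (p k) :: ('v, 'k) mpoly vec)" by (intro eq_vecI) auto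
      ultimately show "y \<in> mat_kernel (\<chi> (Suc (Suc k)))"
        using mult2 by (intro mat_kernelI[OF C\<chi>2]) (simp_all add: zero_vec_append)
    qed
  qed
  \<comment> \<open>Exactness in the middle of the sequence is used here. If x is killed by the
    augmentation, then \<open>\<psi> 0\<close> x is \<open>\<mu>\<close> z for some z in
    \<open>K\<close>; subtracting from x the image of a preimage of z gives an element of the kernel
    of \<open>\<psi> 0\<close>.\<close>
  have exact0: "mat_image (\<chi> (Suc 0)) = mat_kernel (\<chi> 0)"
  proof
    show "mat_image (\<chi> (Suc 0)) \<subseteq> mat_kernel (\<chi> 0)"
    proof
      fix x assume "x \<in> mat_image (\<chi> (Suc 0))"
      then obtain y where y: "y \<in> carrier_vec (q (Suc 0) + p 0)" "x = \<chi> (Suc 0) *\<^sub>v y"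
        by (rule mat_imageE[OF _ C\<chi>1])
      obtain v u where vu: "y = v @\<^sub>v u" "v \<in> carrier_vec (q (Suc 0))" "u \<in> carrier_vec (p 0)"
        using append_vec_cases[OF y(1)] by blast
      have x: "x = \<psi> (Suc 0) *\<^sub>v v + M (Suc 0) *\<^sub>v u" using y(2) vu mult1 by simp
      have Cv: "\<psi> (Suc 0) *\<^sub>v v \<in> carrier_vec (q 0)" by (rule mult_mat_vec_carrier[OF C\<psi> vu(2)])
      have Cu: "M (Suc 0) *\<^sub>v u \<in> carrier_vec (q 0)" by (rule mult_mat_vec_carrier[OF CM vu(3)])
      have C\<phi>u: "\<phi> 0 *\<^sub>v u \<in> carrier_vec (length ps)" by (rule mult_mat_vec_carrier[OF C\<phi>0 vu(3)])
      have K\<phi>u: "\<phi> 0 *\<^sub>v u \<in> K" using mat_imageI[OF C\<phi>0 vu(3)] resolution_image_0[OF F] by simp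
      have "\<psi> 0 *\<^sub>v x = 0\<^sub>v (length qs) + \<mu> *\<^sub>v (\<phi> 0 *\<^sub>v u)"
        unfolding x using mult_add_distrib_mat_vec[OF C\<psi>0 Cv Cu] zero\<psi>[OF vu(2)] sq0[OF vu(3)]
        by (simp add: augmented_def)
      also have "\<dots> = \<mu> *\<^sub>v (\<phi> 0 *\<^sub>v u)" using C\<mu> C\<phi>u by simp
      finally have "\<pi> *\<^sub>v (\<psi> 0 *\<^sub>v x) = 0\<^sub>v (length os)"
        using \<pi>(2)[OF \<mu>(2)[OF K\<phi>u]] K\<phi>u by simp
      moreover have "x \<in> carrier_vec (q 0)" using Cv Cu x by simp
      ultimately show "x \<in> mat_kernel (\<chi> 0)"
        using C\<pi> C\<psi>0 by (intro mat_kernelI[OF C\<chi>0]) (simp_all add: \<chi>0)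
    qed
    show "mat_kernel (\<chi> 0) \<subseteq> mat_image (\<chi> (Suc 0))"
    proof
      fix x assume "x \<in> mat_kernel (\<chi> 0)"
      note x = mat_kernelD[OF C\<chi>0 this]
      have "\<pi> *\<^sub>v (\<psi> 0 *\<^sub>v x) = 0\<^sub>v (length os)" using x C\<pi> C\<psi>0 by (simp add: \<chi>0)
      moreover have "\<psi> 0 *\<^sub>v x \<in> L" using mat_imageI[OF C\<psi>0 x(1)] resolution_image_0[OF G] by simp
      ultimately obtain z where z: "z \<in> K" "\<psi> 0 *\<^sub>v x = \<mu> *\<^sub>v z" using \<pi>(2) by blast
      have "z \<in> mat_image (\<phi> 0)" using z(1) resolution_image_0[OF F] by simp
      then obtain u where u: "u \<in> carrier_vec (p 0)" "z = \<phi> 0 *\<^sub>v u" by (rule mat_imageE[OF _ C\<phi>0])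
      have Cu: "M (Suc 0) *\<^sub>v u \<in> carrier_vec (q 0)" by (rule mult_mat_vec_carrier[OF CM u(1)])
      have "\<psi> 0 *\<^sub>v (x - M (Suc 0) *\<^sub>v u) = 0\<^sub>v (length qs)"
        unfolding mult_minus_distrib_mat_vec[OF C\<psi>0 x(1) Cu] sq0[OF u(1)] z(2) u(2)[symmetric]
        using C\<mu> by (intro eq_vecI) auto
      then obtain v where v: "v \<in> carrier_vec (q (Suc 0))" "x - M (Suc 0) *\<^sub>v u = \<psi> (Suc 0) *\<^sub>v v"
        using ex\<psi>[OF minus_carrier_vec[OF x(1) Cu]] by (auto simp: augmented_def)
      have "x = \<psi> (Suc 0) *\<^sub>v v + M (Suc 0) *\<^sub>v u"
        unfolding v(2)[symmetric] using x(1) CM[of 0] by (intro eq_vecI) auto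
      then have "x = \<chi> (Suc 0) *\<^sub>v (v @\<^sub>v u)" using mult1 v(1) u(1) by simp
      moreover have "v @\<^sub>v u \<in> carrier_vec (q (Suc 0) + p 0)" using v(1) u(1) by simp
      ultimately show "x \<in> mat_image (\<chi> (Suc 0))" using mat_imageI[OF C\<chi>1] by blast
    qed
  qed
  have image0: "mat_image (\<chi> 0) = (*\<^sub>v) \<pi> ` L"
  proof -
    have "mat_image (\<chi> 0) = (\<lambda>v. \<chi> 0 *\<^sub>v v) ` carrier_vec (q 0)"
      unfolding mat_image_def using C\<chi>0 by auto
    also have "\<dots> = (\<lambda>v. \<pi> *\<^sub>v (\<psi> 0 *\<^sub>v v)) ` carrier_vec (q 0)"
      unfolding \<chi>0 by (intro image_cong refl assoc_mult_mat_vec[OF C\<pi> C\<psi>0])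
    finally have "mat_image (\<chi> 0) = (\<lambda>v. \<pi> *\<^sub>v (\<psi> 0 *\<^sub>v v)) ` carrier_vec (q 0)" .
    moreover have "L = (\<lambda>v. \<psi> 0 *\<^sub>v v) ` carrier_vec (q 0)"
      unfolding resolution_image_0[OF G, symmetric] mat_image_def using C\<psi>0 by auto
    ultimately show ?thesis by (simp add: image_image)
  qed
  have "resolution os ((*\<^sub>v) \<pi> ` L) (cone_twists P Q) \<chi>"
    unfolding resolution_def
  proof (intro conjI allI)
    show "graded_hom (cone_twists P Q 0) os (\<chi> 0)"
      unfolding \<chi>0 cone_twists_def using graded_hom_mult[OF \<pi>(1) g\<psi>0] by simp
    show "mat_image (\<chi> 0) = (*\<^sub>v) \<pi> ` L" by (rule image0)
    fix i
    show "graded_hom (cone_twists P Q (Suc i)) (cone_twists P Q i) (\<chi> (Suc i))"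
    proof (cases i)
      case 0
      then show ?thesis unfolding cone_twists_def using graded_hom_hcat[OF g\<psi> gM] by (simp add: \<chi>1)
    next
      case (Suc k)
      have "graded_hom (Q (Suc (Suc k)) @ P (Suc k)) (Q (Suc k) @ P k) (\<chi> (Suc (Suc k)))"
        unfolding \<chi>2 p_def q_def
        by (intro graded_hom_four_block g\<psi> gM graded_hom_zero graded_hom_uminus g\<phi>)
      then show ?thesis by (simp add: Suc cone_twists_def)
    qed
    show "mat_image (\<chi> (Suc i)) = mat_kernel (\<chi> i)"
    proof (cases i)
      case 0 then show ?thesis using exact0 by simp
    next
      case (Suc j)
      have "mat_kernel (\<chi> (Suc j)) = ?Z j" by (cases j) (simp_all only: kernel1 kernel2)
      then show ?thesis unfolding Suc image2 ZB by simp
    qed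
  qed
  then show ?thesis by blast
qed

text \<open>The cone is taken for f -> (yf, -f) and (f, g) -> f + yg, where the twists (1) and (0,
  1) make both maps homogeneous. If f + yg = 0 with f in \<open>J\<close>, then y(-g) lies in
  \<open>J\<close>, so -g lies in \<open>J\<close> because y is a nonzerodivisor modulo
  \<open>J\<close>; thus (f, g) is the image of -g.\<close>

lemma resolution_ideal_cone:
  fixes y :: "('v::finite, 'k::field) mpoly"
  assumes F: "resolution [0] (ideal_vecs J) D \<phi>" and F': "resolution [0] (ideal_vecs J') D' \<phi>'"
    and y: "homog 1 y" and sub: "J \<subseteq> J'" and mult: "\<And>f. f \<in> J \<Longrightarrow> y * f \<in> J"
    and uminus: "\<And>f. f \<in> J' \<Longrightarrow> - f \<in> J'" and nzd: "\<And>f. y * f \<in> J \<Longrightarrow> f \<in> J"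
  shows "\<exists>\<chi>. resolution [0] (ideal_vecs {f + y * g | f g. f \<in> J \<and> g \<in> J'})
    (cone_twists (\<lambda>i. map (\<lambda>t. t + 1) (D i)) (\<lambda>i. D i @ map (\<lambda>t. t + 1) (D' i))) \<chi>"
proof -
  let ?K = "ideal_vecs J" and ?L = "{v @\<^sub>v w | v w. v \<in> ideal_vecs J \<and> w \<in> ideal_vecs J'}"
  define \<mu> where "\<mu> = (mat 2 1 (\<lambda>(i, _). if i = 0 then y else - 1) :: ('v, 'k) mpoly mat)"
  define \<pi> where "\<pi> = (mat 1 2 (\<lambda>(_, j). if j = 0 then 1 else y) :: ('v, 'k) mpoly mat)"
  have P: "resolution [1] ?K (\<lambda>i. map (\<lambda>t. t + 1) (D i)) \<phi>"
    and P': "resolution [1] (ideal_vecs J') (\<lambda>i. map (\<lambda>t. t + 1) (D' i)) \<phi>'"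
    using resolution_shift[OF F, of 1] resolution_shift[OF F', of 1] by simp_all
  obtain \<psi> where Q: "resolution [0, 1] ?L (\<lambda>i. D i @ map (\<lambda>t. t + 1) (D' i)) \<psi>"
    using resolution_direct_sum[OF F P'] by auto
  define one where "one f = vec 1 (\<lambda>_. f)" for f :: "('v, 'k) mpoly"
  define two where "two f g = vec 2 (\<lambda>i. if i = 0 then f else g)" for f g :: "('v, 'k) mpoly"
  have iv: "ideal_vecs I = one ` I" for I :: "('v, 'k) mpoly set"
  proof
    show "ideal_vecs I \<subseteq> one ` I"
    proof
      fix w assume "w \<in> ideal_vecs I"
      then have "w $ 0 \<in> I" "w = one (w $ 0)" by (auto simp: ideal_vecs_def one_def intro!: eq_vecI)
      then show "w \<in> one ` I" by blast
    qed
  qed (auto simp: ideal_vecs_def one_def)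
  have app: "one f @\<^sub>v one g = two f g" for f g
    by (intro eq_vecI) (auto simp: one_def two_def)
  have L: "?L = {two f g | f g. f \<in> J \<and> g \<in> J'}"
    unfolding iv image_def app[symmetric] by blast
  have \<mu>1: "\<mu> *\<^sub>v one f = two (y * f) (- f)" for f
    by (intro eq_vecI) (auto simp: \<mu>_def one_def two_def scalar_prod_def)
  have \<pi>2: "\<pi> *\<^sub>v two f g = one (f + y * g)" for f g
    by (intro eq_vecI) (auto simp: \<pi>_def one_def two_def scalar_prod_def numeral_2_eq_2)
  have two_inj: "two f g = two f' g' \<longleftrightarrow> f = f' \<and> g = g'" for f g f' g'
  proof
    assume "two f g = two f' g'"
    then have "two f g $ 0 = two f' g' $ 0" "two f g $ 1 = two f' g' $ 1" by (simp_all only:)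
    then show "f = f' \<and> g = g'" by (simp add: two_def)
  qed simp
  have one_inj: "one f = one g \<longleftrightarrow> f = g" for f g
  proof
    assume "one f = one g"
    then have "one f $ 0 = one g $ 0" by (simp only:)
    then show "f = g" by (simp add: one_def)
  qed simp
  have zero: "0\<^sub>v (length [0, 1 :: int]) = two 0 0" "0\<^sub>v (length [0 :: int]) = one 0" "0\<^sub>v (length [1 :: int]) = one 0"
    by (auto simp: one_def two_def intro!: eq_vecI)
  have "\<exists>\<chi>. resolution [0] ((*\<^sub>v) \<pi> ` ?L)
    (cone_twists (\<lambda>i. map (\<lambda>t. t + 1) (D i)) (\<lambda>i. D i @ map (\<lambda>t. t + 1) (D' i))) \<chi>"
  proof (rule resolution_cone[OF P Q, where \<mu> = \<mu> and \<pi> = \<pi>])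
    show "graded_hom [1] [0, 1] \<mu>"
      using y homog_uminus[OF homog_one] by (auto simp: \<mu>_def \<pi>_def graded_hom_iff less_Suc_eq)
    show "graded_hom [0, 1] [0] \<pi>"
      using y homog_one by (auto simp: \<mu>_def \<pi>_def graded_hom_iff less_Suc_eq)
    show "\<mu> *\<^sub>v z \<in> ?L" if zK: "z \<in> ?K" for z
    proof -
      obtain f where "z = one f" "f \<in> J" using zK unfolding iv by blast
      moreover from this have "y * f \<in> J" "- f \<in> J'" using mult uminus sub by auto
      ultimately show ?thesis unfolding L using \<mu>1 by blast
    qed
    show "z = 0\<^sub>v (length [1 :: int])" if "z \<in> ?K" "\<mu> *\<^sub>v z = 0\<^sub>v (length [0, 1 :: int])" for z
      using that unfolding iv zero by (auto simp: \<mu>1 two_inj)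
    show "\<pi> *\<^sub>v z = 0\<^sub>v (length [0 :: int]) \<longleftrightarrow> z \<in> (*\<^sub>v) \<mu> ` ?K" if zL: "z \<in> ?L" for z
    proof -
      obtain f g where z: "z = two f g" "f \<in> J" "g \<in> J'" using zL unfolding L by blast
      show ?thesis
      proof
        assume "\<pi> *\<^sub>v z = 0\<^sub>v (length [0 :: int])"
        then have "f + y * g = 0" unfolding z(1) \<pi>2 zero one_inj .
        then have f: "f = y * (- g)" by (simp add: eq_neg_iff_add_eq_0)
        then have "- g \<in> J" using nzd z(2) by blast
        then show "z \<in> (*\<^sub>v) \<mu> ` ?K"
          unfolding iv z(1) using f by (intro image_eqI[of _ _ "one (- g)"]) (auto simp: \<mu>1)
      next
        assume "z \<in> (*\<^sub>v) \<mu> ` ?K"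
        then obtain h where "z = two (y * h) (- h)" unfolding iv by (auto simp: \<mu>1)
        then show "\<pi> *\<^sub>v z = 0\<^sub>v (length [0 :: int])" unfolding zero by (simp add: \<pi>2)
      qed
    qed
  qed
  moreover have "(*\<^sub>v) \<pi> ` ?L = ideal_vecs {f + y * g | f g. f \<in> J \<and> g \<in> J'}"
    unfolding L unfolding iv
  proof (intro equalityI subsetI)
    fix x assume "x \<in> (*\<^sub>v) \<pi> ` {two f g | f g. f \<in> J \<and> g \<in> J'}"
    then obtain f g where "f \<in> J" "g \<in> J'" "x = \<pi> *\<^sub>v two f g" by blast
    then show "x \<in> one ` {f + y * g | f g. f \<in> J \<and> g \<in> J'}" unfolding \<pi>2 by blast
  next
    fix x assume "x \<in> one ` {f + y * g | f g. f \<in> J \<and> g \<in> J'}"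
    then obtain f g where "f \<in> J" "g \<in> J'" "x = one (f + y * g)" by blast
    then show "x \<in> (*\<^sub>v) \<pi> ` {two f g | f g. f \<in> J \<and> g \<in> J'}" unfolding \<pi>2[symmetric] by blast
  qed
  ultimately show ?thesis by simp
qed

section \<open>Squarefree powers of edge ideals\<close>

lemma keys_add_nat: "Poly_Mapping.keys (u + v) = Poly_Mapping.keys u \<union> Poly_Mapping.keys (v :: 'a \<Rightarrow>\<^sub>0 nat)"
  by (auto simp: in_keys_iff lookup_add)

text \<open>The colon ideal of the squarefree power by the product of the variables in \<open>A\<close>, for the graph
  induced on \<open>A \<union> B\<close>; the variables outside \<open>B\<close> do not occur in its generators.\<close>

definition matching_ideal :: "'v::finite set set \<Rightarrow> nat \<Rightarrow> 'v set \<Rightarrow> 'v set \<Rightarrow> ('v, 'k::field) mpoly set" where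
  "matching_ideal E s A B = {p. \<forall>u\<in>Poly_Mapping.keys p. s \<le> mnum E ((Poly_Mapping.keys u \<inter> B) \<union> A)}"

lemma matching_ideal_mult:
  assumes "q \<in> matching_ideal E s A B"
  shows "p * q \<in> matching_ideal E s A B"
  unfolding matching_ideal_def mem_Collect_eq
proof
  fix u assume "u \<in> Poly_Mapping.keys (p * q)"
  then obtain a b where u: "u = a + b" "b \<in> Poly_Mapping.keys q" using keys_mult[of p q] by blast
  have "s \<le> mnum E ((Poly_Mapping.keys b \<inter> B) \<union> A)" using assms u(2) by (simp add: matching_ideal_def)
  also have "\<dots> \<le> mnum E ((Poly_Mapping.keys u \<inter> B) \<union> A)"
    unfolding u(1) keys_add_nat by (rule mnum_mono) auto
  finally show "s \<le> mnum E ((Poly_Mapping.keys u \<inter> B) \<union> A)" .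
qed

lemma matching_ideal_add:
  "p \<in> matching_ideal E s A B \<Longrightarrow> q \<in> matching_ideal E s A B \<Longrightarrow> p + q \<in> matching_ideal E s A B"
  unfolding matching_ideal_def using keys_add[of p q] by blast

lemma matching_ideal_uminus:
  "p \<in> matching_ideal E s A B \<Longrightarrow> - p \<in> matching_ideal E s A B"
  by (simp add: matching_ideal_def keys_uminus)

lemma lookup_single_mult:
  fixes f :: "('v \<Rightarrow>\<^sub>0 nat) \<Rightarrow>\<^sub>0 'k::comm_ring_1"
  shows "Poly_Mapping.lookup (Poly_Mapping.single m 1 * f) (m + u) = Poly_Mapping.lookup f u"
  by (simp add: lookup_mult lookup_single when_mult)

lemma keys_single_mult:
  fixes f :: "('v \<Rightarrow>\<^sub>0 nat) \<Rightarrow>\<^sub>0 'k::comm_ring_1"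
  shows "Poly_Mapping.keys (Poly_Mapping.single m 1 * f) = (+) m ` Poly_Mapping.keys f"
proof
  show "Poly_Mapping.keys (Poly_Mapping.single m 1 * f) \<subseteq> (+) m ` Poly_Mapping.keys f"
    using keys_mult[of "Poly_Mapping.single m (1 :: 'k)" f] by (auto split: if_splits)
  show "(+) m ` Poly_Mapping.keys f \<subseteq> Poly_Mapping.keys (Poly_Mapping.single m 1 * f)"
    by (auto simp: in_keys_iff lookup_single_mult)
qed

text \<open>Membership depends only on exponents at vertices of \<open>B - {y}\<close>, which
  multiplication by y does not alter. This supplies the nonzerodivisor property required by the
  cone.\<close>

lemma matching_ideal_var_cancel:
  fixes f :: "('v::finite, 'k::field) mpoly"
  assumes "var y * f \<in> matching_ideal E s A (B - {y})"
  shows "f \<in> matching_ideal E s A (B - {y})"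
  unfolding matching_ideal_def mem_Collect_eq
proof
  fix u assume "u \<in> Poly_Mapping.keys f"
  then have "Poly_Mapping.single y 1 + u \<in> Poly_Mapping.keys (var y * f)"
    unfolding var_def keys_single_mult by blast
  then have "s \<le> mnum E ((Poly_Mapping.keys (Poly_Mapping.single y 1 + u) \<inter> (B - {y})) \<union> A)"
    using assms by (simp add: matching_ideal_def)
  moreover have "Poly_Mapping.keys (Poly_Mapping.single y 1 + u) \<inter> (B - {y}) = Poly_Mapping.keys u \<inter> (B - {y})"
    unfolding keys_add_nat by auto
  ultimately show "s \<le> mnum E ((Poly_Mapping.keys u \<inter> (B - {y})) \<union> A)" by simp
qed

lemma var_factor:
  fixes r :: "('v::finite, 'k::field) mpoly"
  assumes "\<And>u. u \<in> Poly_Mapping.keys r \<Longrightarrow> y \<in> Poly_Mapping.keys u"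
  obtains g where "r = var y * g"
proof
  let ?m = "Poly_Mapping.single y (1 :: nat)"
  let ?g = "Poly_Mapping.map_key ((+) ?m) r"
  have lookup_g: "Poly_Mapping.lookup ?g u = Poly_Mapping.lookup r (?m + u)" for u
    by (subst map_key.rep_eq) simp_all
  show "r = var y * ?g"
  proof (rule poly_mapping_eqI)
    fix k
    show "Poly_Mapping.lookup r k = Poly_Mapping.lookup (var y * ?g) k"
    proof (cases "y \<in> Poly_Mapping.keys k")
      case True
      then have "k = ?m + (k - ?m)"
        by (intro poly_mapping_eqI) (auto simp: lookup_add lookup_minus lookup_single when_def in_keys_iff)
      then show ?thesis unfolding var_def using lookup_single_mult[of ?m ?g "k - ?m"] lookup_g[of "k - ?m"] by simp
    next
      case False
      then have "k \<notin> Poly_Mapping.keys r" using assms by blast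
      moreover have "k \<notin> Poly_Mapping.keys (var y * ?g)"
        unfolding var_def keys_single_mult using False by (auto simp: keys_add_nat)
      ultimately show ?thesis by (simp add: in_keys_iff)
    qed
  qed
qed

text \<open>The terms are sorted by divisibility by y. A term without y does not see whether y
  belongs to \<open>B\<close>. For a multiple of y the vertex y is available in any case, so after
  division by y it can be moved from \<open>B\<close> to \<open>A\<close>.\<close>

lemma matching_ideal_split:
  assumes y: "y \<in> B"
  shows "(matching_ideal E s A B :: ('v::finite, 'k::field) mpoly set) =
    {f + var y * g | f g. f \<in> matching_ideal E s A (B - {y}) \<and> g \<in> matching_ideal E s (insert y A) (B - {y})}"
    (is "?J = ?R")
proof
  have var_mem: "var y * g \<in> ?J \<longleftrightarrow> g \<in> matching_ideal E s (insert y A) (B - {y})"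
    for g :: "('v, 'k) mpoly"
  proof -
    have eq: "(Poly_Mapping.keys (Poly_Mapping.single y 1 + u) \<inter> B) \<union> A =
        (Poly_Mapping.keys u \<inter> (B - {y})) \<union> insert y A" for u :: "'v \<Rightarrow>\<^sub>0 nat"
      unfolding keys_add_nat using y by auto
    show ?thesis unfolding matching_ideal_def var_def keys_single_mult mem_Collect_eq ball_simps eq ..
  qed
  show "?R \<subseteq> ?J"
  proof
    fix p assume "p \<in> ?R"
    then obtain f g where p: "p = f + var y * g" and f: "f \<in> matching_ideal E s A (B - {y})"
      and g: "g \<in> matching_ideal E s (insert y A) (B - {y})" by blast
    have "f \<in> ?J"
      unfolding matching_ideal_def mem_Collect_eq
    proof
      fix u assume "u \<in> Poly_Mapping.keys f"
      then have "s \<le> mnum E ((Poly_Mapping.keys u \<inter> (B - {y})) \<union> A)" using f by (simp add: matching_ideal_def)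
      also have "\<dots> \<le> mnum E ((Poly_Mapping.keys u \<inter> B) \<union> A)" by (rule mnum_mono) auto
      finally show "s \<le> mnum E ((Poly_Mapping.keys u \<inter> B) \<union> A)" .
    qed
    then show "p \<in> ?J" unfolding p using g var_mem by (intro matching_ideal_add) simp_all
  qed
  show "?J \<subseteq> ?R"
  proof
    fix p assume p: "p \<in> ?J"
    define f where "f = restrict_keys (\<lambda>u. y \<notin> Poly_Mapping.keys u) p"
    define r where "r = restrict_keys (\<lambda>u. \<not> y \<notin> Poly_Mapping.keys u) p"
    have split: "p = f + r" unfolding f_def r_def by (rule restrict_keys_split)
    have "f \<in> matching_ideal E s A (B - {y})"
      unfolding matching_ideal_def mem_Collect_eq
    proof
      fix u assume u: "u \<in> Poly_Mapping.keys f"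
      then have "s \<le> mnum E ((Poly_Mapping.keys u \<inter> B) \<union> A)"
        using p by (simp add: f_def keys_restrict_keys matching_ideal_def)
      moreover have "Poly_Mapping.keys u \<inter> B = Poly_Mapping.keys u \<inter> (B - {y})"
        using u by (auto simp: f_def keys_restrict_keys)
      ultimately show "s \<le> mnum E ((Poly_Mapping.keys u \<inter> (B - {y})) \<union> A)" by simp
    qed
    moreover obtain g where g: "r = var y * g"
      by (rule var_factor[of r y]) (auto simp: r_def keys_restrict_keys)
    moreover have "r \<in> ?J" using p by (simp add: r_def keys_restrict_keys matching_ideal_def)
    ultimately show "p \<in> ?R" using split var_mem by blast
  qed
qed

section \<open>The zero ideal, the unit ideal and the inductive bound\<close>

lemma mat_image_no_cols:
  fixes A :: "'a::comm_ring_1 mat"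
  assumes "A \<in> carrier_mat n 0"
  shows "mat_image A = {0\<^sub>v n}"
proof -
  have "A *\<^sub>v v = 0\<^sub>v n" if "v \<in> carrier_vec 0" for v
    using assms that by (intro eq_vecI) (auto simp: scalar_prod_def)
  then show ?thesis unfolding mat_image_def using assms by (auto intro: exI[of _ "0\<^sub>v 0"])
qed

lemma mat_kernel_no_cols:
  fixes A :: "'a::comm_ring_1 mat"
  assumes "A \<in> carrier_mat n 0"
  shows "mat_kernel A = {0\<^sub>v 0}"
proof -
  have "A *\<^sub>v v = 0\<^sub>v n" if "v \<in> carrier_vec 0" for v
    using assms that by (intro eq_vecI) (auto simp: scalar_prod_def)
  moreover have "v = 0\<^sub>v 0" if "v \<in> carrier_vec 0" for v :: "'a vec" using that by (intro eq_vecI) auto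
  ultimately show ?thesis unfolding mat_kernel[OF assms] by auto
qed

lemma resolution_zero_ideal:
  "resolution [0] (ideal_vecs {0 :: ('v::finite, 'k::field) mpoly}) (\<lambda>_. []) (\<lambda>i. case i of 0 \<Rightarrow> 0\<^sub>m 1 0 | Suc _ \<Rightarrow> 0\<^sub>m 0 0)"
proof -
  have "ideal_vecs {0 :: ('v, 'k) mpoly} = {0\<^sub>v 1}"
    by (auto simp: ideal_vecs_def intro!: eq_vecI)
  moreover have C: "(case i of 0 \<Rightarrow> 0\<^sub>m 1 0 | Suc _ \<Rightarrow> 0\<^sub>m 0 0) \<in> carrier_mat (case i of 0 \<Rightarrow> 1 | Suc _ \<Rightarrow> 0) 0"
    for i by (cases i) simp_all
  ultimately show ?thesis
    unfolding resolution_def mat_image_no_cols[OF C] mat_kernel_no_cols[OF C]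
    by (simp add: graded_hom_iff)
qed

lemma resolution_unit_ideal:
  "resolution [0] (ideal_vecs (UNIV :: ('v::finite, 'k::field) mpoly set)) (\<lambda>i. case i of 0 \<Rightarrow> [0] | Suc _ \<Rightarrow> [])
    (\<lambda>i. case i of 0 \<Rightarrow> 1\<^sub>m 1 | Suc j \<Rightarrow> (case j of 0 \<Rightarrow> 0\<^sub>m 1 0 | Suc _ \<Rightarrow> 0\<^sub>m 0 0))"
proof -
  have "mat_image (1\<^sub>m 1) = ideal_vecs (UNIV :: ('v, 'k) mpoly set)"
    unfolding mat_image_def ideal_vecs_def by force
  moreover have "mat_kernel (1\<^sub>m 1 :: ('v, 'k) mpoly mat) = {0\<^sub>v 1}"
    unfolding mat_kernel[OF one_carrier_mat] by auto
  moreover have C: "(case j of 0 \<Rightarrow> 0\<^sub>m 1 0 | Suc _ \<Rightarrow> 0\<^sub>m 0 0) \<in> carrier_mat (case j of 0 \<Rightarrow> 1 | Suc _ \<Rightarrow> 0) 0"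
    for j by (cases j) simp_all
  ultimately show ?thesis
    unfolding resolution_def
    by (auto simp: graded_hom_iff homog_one mat_image_no_cols[OF C] mat_kernel_no_cols[OF C] split: nat.split)
qed

text \<open>Doubling avoids half-integers. The maximum with 0 accommodates the unit ideal, which
  appears once \<open>A\<close> contains a matching of size s: its only twist is 0, while the second
  expression may then be negative.\<close>

lemma matching_ideal_resolution:
  fixes E :: "'v::finite set set"
  assumes E: "simple_graph E" and "A \<inter> B = {}"
  shows "\<exists>D \<phi>. resolution [0] (ideal_vecs (matching_ideal E s A B :: ('v, 'k::field) mpoly set)) D \<phi> \<and>
    (\<forall>i. \<forall>t\<in>set (D i). 2 * (t - int i) \<le> max 0 (int (card B) - int (coverable E (A \<union> B) A) + 2 * int s))"
  using assms(2)
proof (induction "card B" arbitrary: A B rule: less_induct)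
  case less
  let ?r = "int (card B) - int (coverable E (A \<union> B) A) + 2 * int s"
  have mem: "s \<le> mnum E A \<Longrightarrow> (p :: ('v, 'k) mpoly) \<in> matching_ideal E s A B" for p
    unfolding matching_ideal_def using mnum_mono[of A _ E] by (auto intro: order_trans)
  show ?case
  proof (cases "s \<le> mnum E A")
    case True
    then have "matching_ideal E s A B = (UNIV :: ('v, 'k) mpoly set)" using mem by blast
    then show ?thesis
      using resolution_unit_ideal
      by (intro exI[of _ "\<lambda>i. case i of 0 \<Rightarrow> [0] | Suc _ \<Rightarrow> []"] exI conjI) (auto split: nat.splits)
  next
    case False
    \<comment> \<open>Since \<open>mnum E A < s\<close>, the bound on \<open>coverable\<close> gives
      \<open>?r\<close> >= 2s - 2 \<open>mnum E A\<close> >= 2. Hence the maximum with 0 in either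
      recursive bound is harmless, even for \<open>insert y A\<close>, where \<open>?r - 2\<close>
      has to be reached.\<close>
    have r2: "?r \<ge> 2"
    proof -
      have "(A \<union> B) - A = B" using less.prems by auto
      then show ?thesis using coverable_le[OF E, of A "A \<union> B"] False by simp
    qed
    show ?thesis
    proof (cases "\<exists>y\<in>B. coverable E (A \<union> B) A < coverable E (A \<union> B) (insert y A)")
      case True
      then obtain y where y: "y \<in> B" "coverable E (A \<union> B) A < coverable E (A \<union> B) (insert y A)" by blast
      let ?B = "B - {y}"
      have yA: "y \<notin> A" using y(1) less.prems by auto
      have cB: "card B = Suc (card ?B)" using y(1) by (simp only: card_Suc_Diff1 finite)
      then have lt: "card ?B < card B" by linarith
      have U1: "A \<union> ?B = (A \<union> B) - {y}" and U2: "insert y A \<union> ?B = A \<union> B" using y(1) yA by auto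
      obtain D \<phi> where D: "resolution [0] (ideal_vecs (matching_ideal E s A ?B :: ('v, 'k) mpoly set)) D \<phi>"
        "\<And>i t. t \<in> set (D i) \<Longrightarrow> 2 * (t - int i) \<le> max 0 (int (card ?B) - int (coverable E (A \<union> ?B) A) + 2 * int s)"
        using less.hyps[OF lt, of A] less.prems by blast
      obtain D' \<phi>' where D': "resolution [0] (ideal_vecs (matching_ideal E s (insert y A) ?B :: ('v, 'k) mpoly set)) D' \<phi>'"
        "\<And>i t. t \<in> set (D' i) \<Longrightarrow> 2 * (t - int i) \<le>
          max 0 (int (card ?B) - int (coverable E (insert y A \<union> ?B) (insert y A)) + 2 * int s)"
        using less.hyps[OF lt, of "insert y A"] less.prems by blast
      have b: "2 * (t - int i) \<le> ?r" if "t \<in> set (D i)" for i t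
        using D(2)[OF that] coverable_remove[OF yA E, of "A \<union> B"] r2 cB unfolding U1 by linarith
      have b': "2 * (t - int i) \<le> ?r - 2" if "t \<in> set (D' i)" for i t
        using D'(2)[OF that] y(2) r2 cB unfolding U2 by linarith
      have sub: "matching_ideal E s A ?B \<subseteq> (matching_ideal E s (insert y A) ?B :: ('v, 'k) mpoly set)"
      proof
        fix p :: "('v, 'k) mpoly" assume p: "p \<in> matching_ideal E s A ?B"
        show "p \<in> matching_ideal E s (insert y A) ?B"
          unfolding matching_ideal_def mem_Collect_eq
        proof
          fix u assume "u \<in> Poly_Mapping.keys p"
          then have "s \<le> mnum E ((Poly_Mapping.keys u \<inter> ?B) \<union> A)" using p by (simp add: matching_ideal_def)
          also have "\<dots> \<le> mnum E ((Poly_Mapping.keys u \<inter> ?B) \<union> insert y A)" by (rule mnum_mono) auto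
          finally show "s \<le> mnum E ((Poly_Mapping.keys u \<inter> ?B) \<union> insert y A)" .
        qed
      qed
      obtain \<chi> where \<chi>: "resolution [0] (ideal_vecs (matching_ideal E s A B :: ('v, 'k) mpoly set))
        (cone_twists (\<lambda>i. map (\<lambda>t. t + 1) (D i)) (\<lambda>i. D i @ map (\<lambda>t. t + 1) (D' i))) \<chi>"
        unfolding matching_ideal_split[OF y(1)]
        using resolution_ideal_cone[OF D(1) D'(1) homog_var sub matching_ideal_mult matching_ideal_uminus
            matching_ideal_var_cancel] by blast
      have "2 * (t - int i) \<le> ?r"
        if t: "t \<in> set (cone_twists (\<lambda>i. map (\<lambda>t. t + 1) (D i)) (\<lambda>i. D i @ map (\<lambda>t. t + 1) (D' i)) i)" for i t
      proof -
        from t consider "t \<in> set (D i)" | t' where "t = t' + 1" "t' \<in> set (D' i)"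
          | j t' where "i = Suc j" "t = t' + 1" "t' \<in> set (D j)"
          unfolding cone_twists_def by (cases i) auto
        then show ?thesis
        proof cases
          case 1 then show ?thesis by (rule b)
        next
          case 2 then show ?thesis using b'[OF 2(2)] by simp
        next
          \<comment> \<open>The twist by 1 and the move to the next homological degree cancel: (t' +
            1) - (j + 1) = t' - j.\<close>
          case 3 then show ?thesis using b[OF 3(3)] by simp
        qed
      qed
      then have "\<forall>i. \<forall>t\<in>set (cone_twists (\<lambda>i. map (\<lambda>t. t + 1) (D i)) (\<lambda>i. D i @ map (\<lambda>t. t + 1) (D' i)) i).
          2 * (t - int i) \<le> max 0 ?r"
        by (intro allI ballI max.coboundedI2)
      with \<chi> show ?thesis by blast
    next
      case no: False
      have "mnum E (A \<union> B) = mnum E A"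
        using no by (intro mnum_eq_if_not_extendable[OF E]) (auto simp: not_less)
      then have "mnum E ((Poly_Mapping.keys u \<inter> B) \<union> A) < s" for u :: "'v \<Rightarrow>\<^sub>0 nat"
        using mnum_mono[of "(Poly_Mapping.keys u \<inter> B) \<union> A" "A \<union> B" E] False by (simp add: le_infI2 sup.coboundedI2)
      then have "matching_ideal E s A B = {0 :: ('v, 'k) mpoly}"
        by (auto simp: matching_ideal_def not_le[symmetric])
      then show ?thesis using resolution_zero_ideal by (intro exI conjI) auto
    qed
  qed
qed

section \<open>Identification of the squarefree power with a matching ideal\<close>

lemma module_mult: "Modules.module ((*) :: 'a::comm_ring_1 \<Rightarrow> 'a \<Rightarrow> 'a)"
  by unfold_locales (simp_all add: algebra_simps)

lemma ideal_gen_least: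
  fixes B X :: "'a::comm_ring_1 set"
  assumes "B \<subseteq> X" "0 \<in> X" "\<And>p q. p \<in> X \<Longrightarrow> q \<in> X \<Longrightarrow> p + q \<in> X" "\<And>p q. q \<in> X \<Longrightarrow> p * q \<in> X"
  shows "ideal_gen B \<subseteq> X"
  unfolding ideal_gen_def using assms
  by (intro Modules.module.span_minimal[OF module_mult] Modules.module.subspaceI[OF module_mult]) auto

lemma ideal_gen_base: "b \<in> B \<Longrightarrow> b \<in> ideal_gen (B :: 'a::comm_ring_1 set)"
  unfolding ideal_gen_def by (rule Modules.module.span_base[OF module_mult])

lemma ideal_gen_mult: "q \<in> ideal_gen B \<Longrightarrow> p * q \<in> ideal_gen (B :: 'a::comm_ring_1 set)"
  unfolding ideal_gen_def by (rule Modules.module.span_scale[OF module_mult])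

lemma ideal_gen_sum: "(\<And>x. x \<in> A \<Longrightarrow> f x \<in> ideal_gen B) \<Longrightarrow> (\<Sum>x\<in>A. f x) \<in> ideal_gen (B :: 'a::comm_ring_1 set)"
  unfolding ideal_gen_def by (rule Modules.module.span_sum[OF module_mult])

definition indicator_exp :: "'v set \<Rightarrow> ('v \<Rightarrow>\<^sub>0 nat)" where
  "indicator_exp X = (\<Sum>v\<in>X. Poly_Mapping.single v 1)"

lemma lookup_indicator_exp:
  "finite X \<Longrightarrow> Poly_Mapping.lookup (indicator_exp X) v = (if v \<in> X then 1 else 0)"
  by (simp add: indicator_exp_def lookup_sum lookup_single when_def)

lemma edge_ideal_keys:
  fixes p :: "('v::finite, 'k::field) mpoly"
  assumes "p \<in> edge_ideal E" "u \<in> Poly_Mapping.keys p"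
  shows "\<exists>e\<in>E. e \<subseteq> Poly_Mapping.keys u"
proof -
  let ?X = "{p :: ('v, 'k) mpoly. \<forall>u\<in>Poly_Mapping.keys p. \<exists>e\<in>E. e \<subseteq> Poly_Mapping.keys u}"
  have "edge_ideal E \<subseteq> ?X"
    unfolding edge_ideal_def
  proof (rule ideal_gen_least)
    show "{var v * var w | v w. {v, w} \<in> E} \<subseteq> ?X"
    proof
      fix p :: "('v, 'k) mpoly" assume "p \<in> {var v * var w | v w. {v, w} \<in> E}"
      then obtain v w where "p = var v * var w" "{v, w} \<in> E" by blast
      then show "p \<in> ?X"
        by (auto simp: var_def mult_single keys_add_nat intro!: bexI[of _ "{v, w}"] split: if_splits)
    qed
    show "p + q \<in> ?X" if "p \<in> ?X" "q \<in> ?X" for p q using that keys_add[of p q] by blast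
    show "p * q \<in> ?X" if q: "q \<in> ?X" for p q
      unfolding mem_Collect_eq
    proof
      fix u assume "u \<in> Poly_Mapping.keys (p * q)"
      then obtain a b where u: "u = a + b" "b \<in> Poly_Mapping.keys q" using keys_mult[of p q] by blast
      then obtain e where "e \<in> E" "e \<subseteq> Poly_Mapping.keys b" using q by blast
      then show "\<exists>e\<in>E. e \<subseteq> Poly_Mapping.keys u" unfolding u(1) keys_add_nat by blast
    qed
  qed simp
  then show ?thesis using assms by auto
qed

text \<open>The conclusion is divisibility by a product of s edges: the sum counts the chosen edges
  containing v, which is the exponent of v in that product. The edges may still overlap or
  repeat.\<close>

lemma keys_prod_edge_ideal:
  fixes f :: "nat \<Rightarrow> ('v::finite, 'k::field) mpoly"
  assumes "\<forall>i<s. f i \<in> edge_ideal E" "u \<in> Poly_Mapping.keys (\<Prod>i<s. f i)"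
  shows "\<exists>e. (\<forall>i<s. e i \<in> E) \<and> (\<forall>v. (\<Sum>i<s. if v \<in> e i then 1 else 0) \<le> Poly_Mapping.lookup u v)"
  using assms
proof (induction s arbitrary: u)
  case 0 then show ?case by simp
next
  case (Suc s)
  have "u \<in> Poly_Mapping.keys ((\<Prod>i<s. f i) * f s)" using Suc.prems(2) by simp
  then obtain a b where u: "u = a + b" "a \<in> Poly_Mapping.keys (\<Prod>i<s. f i)" "b \<in> Poly_Mapping.keys (f s)"
    using keys_mult[of "\<Prod>i<s. f i" "f s"] by blast
  have "\<forall>i<s. f i \<in> edge_ideal E" using Suc.prems(1) by simp
  from Suc.IH[OF this u(2)] obtain e where e: "\<forall>i<s. e i \<in> E"
    "\<forall>v. (\<Sum>i<s. if v \<in> e i then 1 else 0) \<le> Poly_Mapping.lookup a v" by blast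
  obtain e' where e': "e' \<in> E" "e' \<subseteq> Poly_Mapping.keys b"
    using edge_ideal_keys[OF _ u(3)] Suc.prems(1) by blast
  have "(if v \<in> e' then 1 else 0) \<le> Poly_Mapping.lookup b v" for v
    using e'(2) by (auto simp: in_keys_iff Suc_le_eq)
  then have "(\<Sum>i<Suc s. if v \<in> (e(s := e')) i then 1 else 0) \<le> Poly_Mapping.lookup u v" for v
  proof -
    assume b: "\<And>v. (if v \<in> e' then 1 else 0) \<le> Poly_Mapping.lookup b v"
    have "(\<Sum>i<Suc s. if v \<in> (e(s := e')) i then 1 else 0) = (\<Sum>i<s. if v \<in> e i then 1 else 0) + (if v \<in> e' then 1 else 0 :: nat)"
      by simp
    then show ?thesis using e(2) b[of v] unfolding u(1) lookup_add by (simp add: add_mono)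
  qed
  moreover have "\<forall>i<Suc s. (e(s := e')) i \<in> E" using e(1) e'(1) by simp
  ultimately show ?case by blast
qed

lemma ideal_power_keys:
  fixes p :: "('v::finite, 'k::field) mpoly"
  assumes "p \<in> ideal_power (edge_ideal E) s" "u \<in> Poly_Mapping.keys p"
  shows "\<exists>e. (\<forall>i<s. e i \<in> E) \<and> (\<forall>v. (\<Sum>i<s. if v \<in> e i then 1 else 0) \<le> Poly_Mapping.lookup u v)"
proof -
  define P where "P u \<longleftrightarrow> (\<exists>e. (\<forall>i<s. e i \<in> E) \<and>
    (\<forall>v. (\<Sum>i<s. if v \<in> e i then 1 else 0) \<le> Poly_Mapping.lookup u v))" for u :: "'v \<Rightarrow>\<^sub>0 nat"
  have "ideal_power (edge_ideal E) s \<subseteq> {p :: ('v, 'k) mpoly. \<forall>u\<in>Poly_Mapping.keys p. P u}" (is "_ \<subseteq> ?X")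
    unfolding ideal_power_def
  proof (rule ideal_gen_least)
    show "{\<Prod>i<s. f i | f. \<forall>i<s. f i \<in> edge_ideal E} \<subseteq> ?X"
      unfolding P_def using keys_prod_edge_ideal by blast
    show "p + q \<in> ?X" if "p \<in> ?X" "q \<in> ?X" for p q using that keys_add[of p q] by blast
    show "p * q \<in> ?X" if q: "q \<in> ?X" for p q
      unfolding mem_Collect_eq
    proof
      fix u assume "u \<in> Poly_Mapping.keys (p * q)"
      then obtain a b where u: "u = a + b" "b \<in> Poly_Mapping.keys q" using keys_mult[of p q] by blast
      then have "P b" using q by blast
      then show "P u" unfolding P_def u(1) lookup_add by (meson trans_le_add2)
    qed
  qed simp
  then show ?thesis using assms unfolding P_def by blast
qed

text \<open>The right-hand side is at most 1, so no vertex lies on two of the edges, and it is 0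
  outside \<open>X\<close>. Disjoint edges are distinct because they are nonempty, so the matching
  really has s elements.\<close>

lemma matching_of_edges:
  fixes E :: "'v::finite set set"
  assumes E: "simple_graph E" and e: "\<forall>i<s. e i \<in> E"
    and le: "\<forall>v. (\<Sum>i<s. if v \<in> e i then 1 else 0) \<le> (if v \<in> X then 1 else 0 :: nat)"
  shows "s \<le> mnum E X"
proof -
  have ne: "e i \<noteq> {}" if "i < s" for i using E e that unfolding simple_graph_def by fastforce
  have disj: "e i \<inter> e j = {}" if ij: "i < s" "j < s" "i \<noteq> j" for i j
  proof (rule ccontr)
    assume "e i \<inter> e j \<noteq> {}"
    then obtain v where v: "v \<in> e i" "v \<in> e j" by blast
    have "(\<Sum>k\<in>{i, j}. if v \<in> e k then 1 else 0) \<le> (\<Sum>k<s. if v \<in> e k then 1 else 0 :: nat)"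
      using ij by (intro sum_mono2) auto
    moreover have "(\<Sum>k\<in>{i, j}. if v \<in> e k then 1 else 0 :: nat) = 2" using v ij(3) by simp
    ultimately have "2 \<le> (if v \<in> X then 1 else 0 :: nat)" using le order_trans by metis
    then show False by (simp split: if_splits)
  qed
  have sub: "e i \<subseteq> X" if i: "i < s" for i
  proof
    fix v assume "v \<in> e i"
    then have "1 \<le> (\<Sum>k\<in>{i}. if v \<in> e k then 1 else 0 :: nat)" by simp
    also have "\<dots> \<le> (\<Sum>k<s. if v \<in> e k then 1 else 0 :: nat)" using i by (intro sum_mono2) auto
    also have "\<dots> \<le> (if v \<in> X then 1 else 0)" using le by blast
    finally show "v \<in> X" by (simp split: if_splits)
  qed
  have "inj_on e {..<s}"
  proof (rule inj_onI, rule ccontr)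
    fix i j assume "i \<in> {..<s}" "j \<in> {..<s}" "e i = e j" "i \<noteq> j"
    then show False using disj[of i j] ne[of i] by simp
  qed
  then have "card (e ` {..<s}) = s" by (simp add: card_image)
  moreover have "disjoint (e ` {..<s})"
    by (rule disjointI) (use disj in \<open>metis imageE lessThan_iff\<close>)
  then have "e ` {..<s} \<in> matchings_in E X" using e sub by (auto simp: matchings_in_def matching_def)
  ultimately show ?thesis using mnum_ge by metis
qed

text \<open>Exponent vectors of disjoint edges add up to the indicator of their union, so the
  monomial is the product of the edges of \<open>M\<close>. The bijection \<open>h\<close> only
  adapts this product to the indexing in \<open>ideal_power\<close>.\<close>

lemma single_matching_in_ideal_power:
  fixes E :: "'v::finite set set"
  assumes E: "simple_graph E" and M: "matching E M" "card M = s"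
  shows "Poly_Mapping.single (indicator_exp (\<Union>M)) (1 :: 'k::field) \<in> ideal_power (edge_ideal E) s"
proof -
  let ?f = "\<lambda>e. Poly_Mapping.single (indicator_exp e) (1 :: 'k)"
  have f: "?f e \<in> edge_ideal E" if e: "e \<in> M" for e
  proof -
    have eE: "e \<in> E" using e M(1) unfolding matching_def by blast
    then have "card e = 2" using E unfolding simple_graph_def by blast
    then obtain v w where vw: "e = {v, w}" "v \<noteq> w" unfolding card_2_iff by blast
    then have "?f e = var v * var w" by (simp add: indicator_exp_def var_def mult_single)
    then show ?thesis unfolding edge_ideal_def using eE vw by (intro ideal_gen_base) blast
  qed
  obtain h where h: "bij_betw h {..<s} M"
    using ex_bij_betw_nat_finite[of M] M(2) by (auto simp: lessThan_atLeast0)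
  have "(\<Prod>e\<in>N. ?f e) = Poly_Mapping.single (\<Sum>e\<in>N. indicator_exp e) 1" for N :: "'v set set"
    by (induction N rule: infinite_finite_induct) (simp_all add: mult_single)
  moreover have "(\<Sum>e\<in>M. indicator_exp e) = indicator_exp (\<Union>M)"
  proof -
    have "pairwise disjnt M" using M(1) by (simp add: matching_def)
    then show ?thesis unfolding indicator_exp_def
      by (subst sum.Union_disjoint) (auto simp: pairwise_def disjnt_def)
  qed
  moreover have "(\<Prod>i<s. ?f (h i)) = (\<Prod>e\<in>M. ?f e)" by (rule prod.reindex_bij_betw[OF h])
  ultimately have "Poly_Mapping.single (indicator_exp (\<Union>M)) 1 = (\<Prod>i<s. ?f (h i))" by simp
  moreover have "\<forall>i<s. ?f (h i) \<in> edge_ideal E" using f h by (auto simp: bij_betw_def)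
  ultimately show ?thesis unfolding ideal_power_def by (intro ideal_gen_base) blast
qed

lemma poly_mapping_sum_singles: "p = (\<Sum>u\<in>Poly_Mapping.keys p. Poly_Mapping.single u (Poly_Mapping.lookup p u))"
  by (rule poly_mapping_eqI) (simp add: lookup_sum lookup_single when_def in_keys_iff)

text \<open>Both inclusions reduce to monomials. A squarefree monomial in the ordinary power is
  divisible by a product of s edges, which squarefreeness makes a matching in its support.
  Conversely, a monomial whose support contains s disjoint edges is a multiple of their squarefree
  product.\<close>

lemma squarefree_power_edge_ideal:
  fixes E :: "'v::finite set set"
  assumes E: "simple_graph E"
  shows "squarefree_power (edge_ideal E) s = (matching_ideal E s {} UNIV :: ('v, 'k::field) mpoly set)"
proof
  show "squarefree_power (edge_ideal E) s \<subseteq> (matching_ideal E s {} UNIV :: ('v, 'k) mpoly set)"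
    unfolding squarefree_power_def
  proof (rule ideal_gen_least)
    show "{m \<in> ideal_power (edge_ideal E) s. squarefree_monomial m} \<subseteq> (matching_ideal E s {} UNIV :: ('v, 'k) mpoly set)"
    proof
      fix m :: "('v, 'k) mpoly" assume "m \<in> {m \<in> ideal_power (edge_ideal E) s. squarefree_monomial m}"
      then obtain u where m: "m \<in> ideal_power (edge_ideal E) s" "m = Poly_Mapping.single u 1"
        and u: "\<forall>v. Poly_Mapping.lookup u v \<le> 1" unfolding squarefree_monomial_def by blast
      obtain e where e: "\<forall>i<s. e i \<in> E" "\<forall>v. (\<Sum>i<s. if v \<in> e i then 1 else 0) \<le> Poly_Mapping.lookup u v"
        using ideal_power_keys[OF m(1), of u] m(2) by auto
      have "Poly_Mapping.lookup u v = (if v \<in> Poly_Mapping.keys u then 1 else 0)" for v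
        using spec[OF u, of v] by (auto simp: in_keys_iff)
      then have "s \<le> mnum E (Poly_Mapping.keys u)"
        using e by (intro matching_of_edges[OF E e(1)]) metis
      then show "m \<in> matching_ideal E s {} UNIV" by (simp add: m(2) matching_ideal_def)
    qed
  qed (simp_all add: matching_ideal_add matching_ideal_mult, simp add: matching_ideal_def)
  show "(matching_ideal E s {} UNIV :: ('v, 'k) mpoly set) \<subseteq> squarefree_power (edge_ideal E) s"
  proof
    fix p :: "('v, 'k) mpoly" assume p: "p \<in> matching_ideal E s {} UNIV"
    have "Poly_Mapping.single u c \<in> squarefree_power (edge_ideal E) s"
      if u: "u \<in> Poly_Mapping.keys p" for u and c :: 'k
    proof -
      have "s \<le> mnum E (Poly_Mapping.keys u)" using p u by (simp add: matching_ideal_def)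
      moreover obtain N where N: "N \<in> matchings_in E (Poly_Mapping.keys u)" "card N = mnum E (Poly_Mapping.keys u)"
        by (rule mnum_attained)
      \<comment> \<open>A maximum matching of the support may have more than s edges; exactly s of
        them are kept to match the s factors of the power.\<close>
      ultimately obtain M where M: "M \<subseteq> N" "card M = s" using obtain_subset_with_card_n by metis
      have "disjoint M" using N(1) M(1) pairwise_subset unfolding matchings_in_def matching_def by blast
      then have mM: "matching E M" "\<Union>M \<subseteq> Poly_Mapping.keys u"
        using N(1) M(1) unfolding matchings_in_def matching_def by blast+
      let ?w = "indicator_exp (\<Union>M)"
      have "?w + (u - ?w) = u"
      proof (rule poly_mapping_eqI)
        fix v
        show "Poly_Mapping.lookup (?w + (u - ?w)) v = Poly_Mapping.lookup u v"
          using mM(2) by (auto simp: lookup_add lookup_minus lookup_indicator_exp in_keys_iff Suc_le_eq)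
      qed
      then have "Poly_Mapping.single u c = Poly_Mapping.single (u - ?w) c * Poly_Mapping.single ?w 1"
        by (simp add: mult_single add.commute)
      moreover have "Poly_Mapping.single ?w (1 :: 'k) \<in> squarefree_power (edge_ideal E) s"
        unfolding squarefree_power_def squarefree_monomial_def
        using single_matching_in_ideal_power[OF E mM(1) M(2)]
        by (intro ideal_gen_base) (auto simp: lookup_indicator_exp)
      ultimately show ?thesis unfolding squarefree_power_def by (simp add: ideal_gen_mult)
    qed
    then show "p \<in> squarefree_power (edge_ideal E) s"
      by (subst poly_mapping_sum_singles) (simp add: squarefree_power_def ideal_gen_sum)
  qed
qed

theorem corollary3p6:
  fixes E :: "'v::finite set set" and s :: nat
  assumes "simple_graph E"
    and "very_well_covered E"
    and "s \<ge> 1"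
    and "s \<le> match E"
  shows "reg (squarefree_power (edge_ideal E :: ('v, 'k::field) mpoly set) s) \<le> int (match E) + int s"
proof -
  let ?J = "matching_ideal E s {} UNIV :: ('v, 'k) mpoly set"
  obtain D \<phi> where D: "resolution [0] (ideal_vecs ?J) D \<phi>"
    "\<And>i t. t \<in> set (D i) \<Longrightarrow> 2 * (t - int i) \<le> max 0 (int CARD('v) - int (coverable E ({} \<union> UNIV) {}) + 2 * int s)"
    using matching_ideal_resolution[OF assms(1), of "{}" UNIV s] by blast
  have "t - int i \<le> int (match E) + int s" if "t \<in> set (D i)" for i t
  proof -
    have "max 0 (int CARD('v) - int (coverable E ({} \<union> UNIV) {}) + 2 * int s) \<le> 2 * (int (match E) + int s)"
      using very_well_covered_match[OF assms(2,1)] by simp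
    from order_trans[OF D(2)[OF that] this] show ?thesis by simp
  qed
  moreover have "\<exists>p\<in>?J. p \<noteq> 0"
  proof
    \<comment> \<open>The product of all variables has full support, and the whole vertex set
      contains a matching of size \<open>match E\<close>. Thus \<open>s \<le> match E\<close> makes
      the ideal nonzero, which \<open>reg_le\<close> needs for a nonempty set of
      differences.\<close>
    let ?p = "Poly_Mapping.single (indicator_exp UNIV) 1 :: ('v, 'k) mpoly"
    have "Poly_Mapping.keys (indicator_exp (UNIV :: 'v set)) = UNIV"
      by (auto simp: in_keys_iff lookup_indicator_exp)
    then show "?p \<in> ?J" using assms(4) by (simp add: matching_ideal_def match_eq_mnum)
    show "?p \<noteq> 0" by (metis keys_single keys_zero insert_not_empty one_neq_zero)
  qed
  ultimately show ?thesis
    unfolding squarefree_power_edge_ideal[OF assms(1)] using reg_le[OF D(1)] by blast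
qed

end
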